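(* Let $S$ be any $\mathrm{EEXP}$-complete set. Then there is a function $r:\mathbb{N}\to\mathbb{N}$ such that, for all $n$, $r(n)$ can be computed in time polynomial in $n$, and the pairwise-disjoint sets \[ A=\{x \mid x\in S \land r(|x|)\equiv 0 \pmod 3\},\quad B=\{x \mid x\in S \land r(|x|)\equiv 1 \pmod 3\},\quad C=\{x \mid x\in S \land r(|x|)\equiv 2 \pmod 3\} \] belong to $\mathrm{EEXP}$, satisfy $S=A\cup B\cup C$, and none of them is $\mathrm{EEXP}$-hard under polynomial-time Turing reductions.
   Context: All sets are over $\Sigma=\{0,1\}$. $\mathrm{EEXP}=\bigcup_{k\ge1}\mathrm{DTIME}(2^{2^{n^k}})$. A set is $\mathrm{EEXP}$-complete if it is in $\mathrm{EEXP}$ and every $\mathrm{EEXP}$ set reduces to it by a polynomial-time many-one reduction (a polynomial-time computable $f$ with $x\in A\iff f(x)\in S$). A set $B$ is $\mathrm{EEXP}$-hard under polynomial-time Turing reductions if $L\in\mathrm{P}^B$ for every $L\in\mathrm{EEXP}$. *)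

theory Defs
  imports Main "HOL-Computational_Algebra.Polynomial"
begin

section \<open>Strings and numbers\<close>

text \<open>
  Strings over the alphabet \<open>{0,1}\<close> are boolean lists, \<open>False\<close> being 0 and \<open>True\<close> being 1.
\<close>

type_synonym language = "bool list set"

text \<open>Binary representation, most significant bit first; 0 is represented by the string \<open>0\<close>.\<close>

fun bin :: "nat \<Rightarrow> bool list" where
  "bin n = (if n < 2 then [n = 1] else bin (n div 2) @ [odd n])"

declare bin.simps [simp del]


section \<open>Deterministic multitape Turing machines\<close>

datatype move = Go_Left | Stay | Go_Right

text \<open>
  Tapes are infinite in both directions. Tape symbols are natural numbers: 0 is the blank,
  1 and 2 stand for the bits 0 and 1, and larger numbers are auxiliary symbols.
\<close>

datatype tape = Tape (cells: "int \<Rightarrow> nat") (head: int)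

definition bit_sym :: "bool \<Rightarrow> nat" where
  "bit_sym b = (if b then 2 else 1)"

definition blank_tape :: tape where
  "blank_tape = Tape (\<lambda>_. 0) 0"

definition input_tape :: "bool list \<Rightarrow> tape" where
  "input_tape w =
     Tape (\<lambda>i. if 0 \<le> i \<and> nat i < length w then bit_sym (w ! nat i) else 0) 0"

text \<open>
  The string written on a tape: the bits from cell 0 rightwards up to the first cell that does
  not hold a bit. Only finitely many cells are ever non-blank, so such a cell exists.
\<close>

definition tape_string :: "tape \<Rightarrow> bool list" where
  "tape_string t =
     map (\<lambda>i. cells t (int i) = bit_sym True) [0..<(LEAST n. cells t (int n) \<notin> range bit_sym)]"

definition read :: "tape \<Rightarrow> nat" where
  "read t = cells t (head t)"

fun act :: "nat \<times> move \<Rightarrow> tape \<Rightarrow> tape" where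
  "act (s, m) (Tape f h) =
     Tape (f(h := s)) (case m of Go_Left \<Rightarrow> h - 1 | Stay \<Rightarrow> h | Go_Right \<Rightarrow> h + 1)"

text \<open>
  The states are \<open>{..<num_states M}\<close> and the tape symbols \<open>{..<num_symbols M}\<close>. Only the values
  of \<open>delta\<close> on states and on tuples (one symbol per tape) over these finite sets matter.
\<close>

record tm =
  num_tapes :: nat
  num_symbols :: nat
  num_states :: nat
  start :: nat
  accept :: nat
  reject :: nat
  delta :: "nat \<Rightarrow> nat list \<Rightarrow> nat \<times> (nat \<times> move) list"

definition wf_tm :: "'a tm_scheme \<Rightarrow> bool" where
  "wf_tm M \<longleftrightarrow>
     num_tapes M \<ge> 1 \<and> num_symbols M \<ge> 3 \<and>
     start M < num_states M \<and> accept M < num_states M \<and> reject M < num_states M \<and>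
     accept M \<noteq> reject M \<and>
     (\<forall>q ss q' as.
        q < num_states M \<longrightarrow> length ss = num_tapes M \<longrightarrow> set ss \<subseteq> {..<num_symbols M} \<longrightarrow>
        delta M q ss = (q', as) \<longrightarrow>
        q' < num_states M \<and> length as = num_tapes M \<and> fst ` set as \<subseteq> {..<num_symbols M})"

record config =
  state :: nat
  tapes :: "tape list"

definition init :: "'a tm_scheme \<Rightarrow> bool list \<Rightarrow> config" where
  "init M w =
     \<lparr>state = start M, tapes = input_tape w # replicate (num_tapes M - 1) blank_tape\<rparr>"

definition halted :: "'a tm_scheme \<Rightarrow> config \<Rightarrow> bool" where
  "halted M c \<longleftrightarrow> state c = accept M \<or> state c = reject M"

definition step :: "'a tm_scheme \<Rightarrow> config \<Rightarrow> config" where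
  "step M c =
     (if halted M c then c
      else let (q, as) = delta M (state c) (map read (tapes c))
           in \<lparr>state = q, tapes = map2 act as (tapes c)\<rparr>)"

definition run :: "tm \<Rightarrow> bool list \<Rightarrow> nat \<Rightarrow> config" where
  "run M w t = (step M ^^ t) (init M w)"

text \<open>The output of a machine computing a function is read off its last tape.\<close>

definition outputs_within :: "tm \<Rightarrow> bool list \<Rightarrow> bool list \<Rightarrow> nat \<Rightarrow> bool" where
  "outputs_within M w v T \<longleftrightarrow>
     (\<exists>t\<le>T. halted M (run M w t) \<and> tape_string (last (tapes (run M w t))) = v)"

definition decides_within :: "tm \<Rightarrow> language \<Rightarrow> (nat \<Rightarrow> nat) \<Rightarrow> bool" where
  "decides_within M L T \<longleftrightarrow>
     (\<forall>w. \<exists>t\<le>T (length w). state (run M w t) = (if w \<in> L then accept M else reject M))"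


section \<open>Oracle machines\<close>

text \<open>
  Tape 1 is the oracle tape. In the state \<open>query\<close> the machine moves, in a single step that leaves
  all tapes unchanged, to \<open>answer_yes\<close> or \<open>answer_no\<close> according to whether the string on the
  oracle tape belongs to the oracle.
\<close>

record oracle_tm = tm +
  query :: nat
  answer_yes :: nat
  answer_no :: nat

definition wf_oracle_tm :: "oracle_tm \<Rightarrow> bool" where
  "wf_oracle_tm M \<longleftrightarrow>
     wf_tm M \<and> num_tapes M \<ge> 2 \<and>
     query M < num_states M \<and> query M \<noteq> accept M \<and> query M \<noteq> reject M \<and>
     answer_yes M < num_states M \<and> answer_no M < num_states M"

definition oracle_step :: "language \<Rightarrow> oracle_tm \<Rightarrow> config \<Rightarrow> config" where
  "oracle_step X M c =
     (if state c = query M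
      then c\<lparr>state := if tape_string (tapes c ! 1) \<in> X then answer_yes M else answer_no M\<rparr>
      else step M c)"

definition oracle_run :: "language \<Rightarrow> oracle_tm \<Rightarrow> bool list \<Rightarrow> nat \<Rightarrow> config" where
  "oracle_run X M w t = (oracle_step X M ^^ t) (init M w)"

definition oracle_decides_within ::
  "language \<Rightarrow> oracle_tm \<Rightarrow> language \<Rightarrow> (nat \<Rightarrow> nat) \<Rightarrow> bool" where
  "oracle_decides_within X M L T \<longleftrightarrow>
     (\<forall>w. \<exists>t\<le>T (length w).
        state (oracle_run X M w t) = (if w \<in> L then accept M else reject M))"


section \<open>Complexity classes and reductions\<close>

text \<open>The additive constant makes this \<open>O(T(n))\<close> also at arguments where \<open>T\<close> vanishes.\<close>

definition DTIME :: "(nat \<Rightarrow> nat) \<Rightarrow> language set" where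
  "DTIME T = {L. \<exists>M c. wf_tm M \<and> decides_within M L (\<lambda>n. c * T n + c)}"

definition EEXP :: "language set" where
  "EEXP = (\<Union>k\<in>{1..}. DTIME (\<lambda>n. 2 ^ (2 ^ (n ^ k))))"

definition P_relative :: "language \<Rightarrow> language set" where
  "P_relative X =
     {L. \<exists>M (p :: nat poly). wf_oracle_tm M \<and> oracle_decides_within X M L (poly p)}"

definition poly_time_computable :: "(bool list \<Rightarrow> bool list) \<Rightarrow> bool" where
  "poly_time_computable f \<longleftrightarrow>
     (\<exists>M (p :: nat poly). wf_tm M \<and> (\<forall>w. outputs_within M w (f w) (poly p (length w))))"

text \<open>
  The running time is polynomial in the number \<open>n\<close> itself, not in the length of its binary
  representation.
\<close>

definition computable_in_time_poly_in_argument :: "(nat \<Rightarrow> nat) \<Rightarrow> bool" where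
  "computable_in_time_poly_in_argument r \<longleftrightarrow>
     (\<exists>M (p :: nat poly). wf_tm M \<and> (\<forall>n. outputs_within M (bin n) (bin (r n)) (poly p n)))"

definition poly_many_one_reducible :: "language \<Rightarrow> language \<Rightarrow> bool" where
  "poly_many_one_reducible L S \<longleftrightarrow>
     (\<exists>f. poly_time_computable f \<and> (\<forall>x. x \<in> L \<longleftrightarrow> f x \<in> S))"

definition EEXP_complete :: "language \<Rightarrow> bool" where
  "EEXP_complete S \<longleftrightarrow> S \<in> EEXP \<and> (\<forall>L\<in>EEXP. poly_many_one_reducible L S)"

definition EEXP_hard_Turing :: "language \<Rightarrow> bool" where
  "EEXP_hard_Turing X \<longleftrightarrow> (\<forall>L\<in>EEXP. L \<in> P_relative X)"

end

theory Submission
  imports Defs "HOL-Library.Discrete_Functions"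
begin

text \<open>
  Let \<open>r(n)\<close> count, modulo 3, how often \<open>log log\<close> can be applied to \<open>n\<close> before the value drops below 2.
  Then \<open>r\<close> is constant on blocks from \<open>b\<close> to \<open>2^2^b\<close>, so there are arbitrarily large \<open>m\<close> such that \<open>r\<close>
  omits a given residue on the two consecutive blocks covering all lengths from \<open>m\<close> to \<open>2^n\<close>, where \<open>n = 2^2^m\<close>.

  The diagonal language consists of the inputs \<open>x\<close> that encode an oracle machine together with a
  finite oracle such that this machine, with this oracle, does not accept \<open>x\<close> within \<open>2^|x|\<close> steps. It
  belongs to EEXP. If it were decided in polynomial time by a machine \<open>M\<close> with oracle \<open>A\<close>, consider an \<open>x\<close>
  of length \<open>n\<close> that encodes \<open>M\<close> and the part of \<open>A\<close> below length \<open>m\<close>; there is room for it, as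
  this part has size about \<open>2^m\<close>. In \<open>2^n\<close> steps no string longer than \<open>2^n\<close> is queried, and \<open>A\<close> has no
  strings of length between \<open>m\<close> and \<open>2^n\<close>, so \<open>M\<close> errs on \<open>x\<close>.

  Membership in EEXP is obtained from loop programs over counters and bit arrays. A multitape
  machine executes them with one tape per variable, in time polynomial in the largest loop count.
\<close>

section \<open>Structured programs for Turing machines\<close>

text \<open>The oracle table below length \<open>m\<close> has more than 2^m entries, so
  \<open>n\<close> exceeds 2^m, and the clock permits queries up to length 2^n, beyond 2^2^m. A gap
  that reaches so far overruns the block starting at \<open>m\<close> and takes up two blocks with
  two residues; a third residue is needed for the set that misses both. Beyond its finite table the
  encoded oracle answers no, because missing entries read as 0, and in the gap this is the right
  answer for \<open>A\<close>. The clock 2^n outgrows every polynomial, so one language serves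
  against all machines, each being defeated at a gap that lies far enough out. The simulated machine
  is read off the input and may claim up to w = 2^(n+1) tapes and symbols. Its transition table is
  addressed by a state with one symbol per tape, the oracle table by the queried string. Both kinds
  of address stay near w^w, which is doubly exponential in \<open>n\<close>. A loop program with
  such bounds costs a polynomial in them, and the power \<open>k\<close> in the definition of EEXP
  absorbs this polynomial.\<close>

datatype prog =
    PDo "nat list \<Rightarrow> (nat \<times> move) list"
  | PSeq prog prog
  | PIf "nat list \<Rightarrow> bool" prog prog
  | PWhile "nat list \<Rightarrow> bool" prog

text \<open>Step counts are exact: every construct pays one step for its own control, just as
  \<open>cont_step\<close> does, so that execution matches machine steps one for one.\<close>

inductive pexec :: "prog \<Rightarrow> tape list \<Rightarrow> nat \<Rightarrow> tape list \<Rightarrow> bool" where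
  PDo: "pexec (PDo f) ts 1 (map2 act (f (map read ts)) ts)"
| PSeq: "pexec a ts m ts1 \<Longrightarrow> pexec b ts1 n ts2 \<Longrightarrow> pexec (PSeq a b) ts (Suc (m + n)) ts2"
| PIfT: "b (map read ts) \<Longrightarrow> pexec p ts m ts1 \<Longrightarrow> pexec (PIf b p q) ts (Suc m) ts1"
| PIfF: "\<not> b (map read ts) \<Longrightarrow> pexec q ts m ts1 \<Longrightarrow> pexec (PIf b p q) ts (Suc m) ts1"
| PWhileF: "\<not> b (map read ts) \<Longrightarrow> pexec (PWhile b p) ts 1 ts"
| PWhileT: "b (map read ts) \<Longrightarrow> pexec p ts m ts1 \<Longrightarrow> pexec (PWhile b p) ts1 n ts2 \<Longrightarrow>
    pexec (PWhile b p) ts (Suc (m + n)) ts2"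

definition keep :: "nat list \<Rightarrow> (nat \<times> move) list" where
  "keep ss = map (\<lambda>s. (s, Stay)) ss"

lemma act_read_Stay [simp]: "act (read t, Stay) t = t"
  by (cases t) (simp add: read_def)

lemma map2_act_keep [simp]: "map2 act (keep (map read ts)) ts = ts"
  by (induction ts) (simp_all add: keep_def)

text \<open>The list is the stack of programs still to be run; a control decision leaves all tapes
  alone.\<close>

fun cont_step :: "prog list \<Rightarrow> nat list \<Rightarrow> prog list \<times> (nat \<times> move) list" where
  "cont_step [] ss = ([], keep ss)"
| "cont_step (PDo f # k) ss = (k, f ss)"
| "cont_step (PSeq a b # k) ss = (a # b # k, keep ss)"
| "cont_step (PIf b p q # k) ss = ((if b ss then p else q) # k, keep ss)"
| "cont_step (PWhile b p # k) ss = (if b ss then p # PWhile b p # k else k, keep ss)"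

text \<open>The continuations reachable while running a program in front of \<open>k\<close>. As there are finitely
  many of them, they can serve as the states of a Turing machine.\<close>

fun conts :: "prog \<Rightarrow> prog list \<Rightarrow> prog list set" where
  "conts (PDo f) k = {PDo f # k, k}"
| "conts (PSeq a b) k = insert (PSeq a b # k) (conts a (b # k) \<union> conts b k)"
| "conts (PIf b p q) k = insert (PIf b p q # k) (conts p k \<union> conts q k)"
| "conts (PWhile b p) k = insert (PWhile b p # k) (insert k (conts p (PWhile b p # k)))"

lemma finite_conts [simp]: "finite (conts p k)"
  by (induction p arbitrary: k) auto

lemma conts_start [simp]: "p # k \<in> conts p k"
  by (cases p) auto

lemma conts_end [simp]: "k \<in> conts p k"
  by (induction p arbitrary: k) auto

text \<open>At \<open>k\<close> the program has ended, and the next step would already execute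
  \<open>k\<close> itself and may lead out of the set; hence the exclusion.\<close>

lemma conts_closed: "l \<in> conts p k \<Longrightarrow> l \<noteq> k \<Longrightarrow> fst (cont_step l ss) \<in> conts p k"
proof (induction p arbitrary: k l)
  case (PSeq a b)
  show ?case
  proof (cases "l = PSeq a b # k")
    case False
    \<comment> \<open>\<open>b # k\<close> ends the first program and starts the second. It is
      assigned to the second, as the induction hypothesis for \<open>a\<close> excludes it.\<close>
    then consider "l \<in> conts b k" | "l \<in> conts a (b # k)" "l \<noteq> b # k"
      using PSeq.prems(1) conts_start[of b k] by fastforce
    then show ?thesis
      using PSeq.IH PSeq.prems(2) by cases auto
  qed auto
next
  case (PWhile b p)
  consider "l = PWhile b p # k" | "l \<in> conts p (PWhile b p # k)" "l \<noteq> PWhile b p # k"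
    using PWhile.prems by fastforce
  then show ?case
    using PWhile.IH by cases auto
qed auto

fun ok_prog :: "nat \<Rightarrow> nat \<Rightarrow> prog \<Rightarrow> bool" where
  "ok_prog k B (PDo f) \<longleftrightarrow> (\<forall>ss. length ss = k \<longrightarrow> set ss \<subseteq> {..<B} \<longrightarrow>
     length (f ss) = k \<and> fst ` set (f ss) \<subseteq> {..<B})"
| "ok_prog k B (PSeq a b) \<longleftrightarrow> ok_prog k B a \<and> ok_prog k B b"
| "ok_prog k B (PIf b p q) \<longleftrightarrow> ok_prog k B p \<and> ok_prog k B q"
| "ok_prog k B (PWhile b p) \<longleftrightarrow> ok_prog k B p"

lemma ok_conts:
  "ok_prog n B p \<Longrightarrow> list_all (ok_prog n B) k \<Longrightarrow> l \<in> conts p k \<Longrightarrow> list_all (ok_prog n B) l"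
proof (induction p arbitrary: k l)
  case (PSeq a b)
  consider "l = PSeq a b # k" | "l \<in> conts b k" | "l \<in> conts a (b # k)"
    using PSeq.prems(3) by auto
  then show ?case
    using PSeq.prems PSeq.IH(1)[of "b # k" l] PSeq.IH(2)[of k l] by cases simp_all
next
  case (PIf b p q)
  consider "l = PIf b p q # k" | "l \<in> conts p k" | "l \<in> conts q k"
    using PIf.prems(3) by auto
  then show ?case
    using PIf.prems PIf.IH(1)[of k l] PIf.IH(2)[of k l] by cases simp_all
next
  case (PWhile b p)
  consider "l = PWhile b p # k" | "l = k" | "l \<in> conts p (PWhile b p # k)"
    using PWhile.prems(3) by auto
  then show ?case
    using PWhile.prems PWhile.IH[of "PWhile b p # k" l] by cases simp_all
qed auto

lemma ok_cont_step:
  assumes "list_all (ok_prog n B) l" "length ss = n" "set ss \<subseteq> {..<B}"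
  shows "length (snd (cont_step l ss)) = n \<and> fst ` set (snd (cont_step l ss)) \<subseteq> {..<B}"
  using assms by (induction l ss rule: cont_step.induct) (simp_all add: keep_def image_image)

section \<open>From structured programs to Turing machines\<close>

definition cont_num :: "prog \<Rightarrow> prog list \<Rightarrow> nat" where
  "cont_num p = (SOME e. bij_betw e (conts p []) {0..<card (conts p [])})"

lemma cont_num: "bij_betw (cont_num p) (conts p []) {0..<card (conts p [])}"
  unfolding cont_num_def by (rule someI_ex[OF ex_bij_betw_finite_nat[OF finite_conts]])

text \<open>The empty continuation is an ordinary state, in which \<open>F\<close> inspects the
  symbols under the heads and chooses the verdict. This is the extra step in
  \<open>run_tm_of\<close>.\<close>

definition tm_of :: "nat \<Rightarrow> nat \<Rightarrow> prog \<Rightarrow> (nat list \<Rightarrow> bool) \<Rightarrow> tm" where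
  "tm_of k B p F =
    (let C = conts p []; N = card C
     in \<lparr>num_tapes = k, num_symbols = B, num_states = N + 2, start = cont_num p [p],
         accept = N, reject = N + 1,
         delta = (\<lambda>q ss. if q < N
           then let l = inv_into C (cont_num p) q; (l', as) = cont_step l ss
                in if l = [] then (if F ss then N else N + 1, keep ss)
                   else (cont_num p l', as)
           else (q, keep ss))\<rparr>)"

lemma cont_num_less: "l \<in> conts p [] \<Longrightarrow> cont_num p l < card (conts p [])"
  using bij_betw_apply[OF cont_num[of p]] by fastforce

lemma inv_cont_num [simp]: "l \<in> conts p [] \<Longrightarrow> inv_into (conts p []) (cont_num p) (cont_num p l) = l"
  using cont_num[of p] by (rule bij_betw_inv_into_left)

lemma wf_tm_of:
  assumes "k \<ge> 1" "B \<ge> 3" "ok_prog k B p"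
  shows "wf_tm (tm_of k B p F)"
proof -
  let ?C = "conts p []" and ?N = "card (conts p [])"
  have "q' < ?N + 2 \<and> length as = k \<and> fst ` set as \<subseteq> {..<B}"
    if ss: "length ss = k" "set ss \<subseteq> {..<B}" and q: "q < ?N + 2"
      and d: "delta (tm_of k B p F) q ss = (q', as)" for q ss q' as
  proof (cases "q < ?N")
    case True
    define l where "l = inv_into ?C (cont_num p) q"
    have l: "l \<in> ?C"
      using True cont_num[of p] unfolding l_def by (auto simp: bij_betw_def intro!: inv_into_into)
    have ok: "list_all (ok_prog k B) l"
      using ok_conts[OF assms(3) _ l] by simp
    have d': "(q', as) = (if l = [] then (if F ss then ?N else ?N + 1, keep ss)
        else (cont_num p (fst (cont_step l ss)), snd (cont_step l ss)))"
      using d True by (simp add: tm_of_def Let_def case_prod_beta flip: l_def)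
    show ?thesis
    proof (cases "l = []")
      case True
      then have "q' \<le> ?N + 1" "as = keep ss"
        using d' by (simp_all split: if_splits)
      then show ?thesis
        using ss by (simp add: keep_def image_image)
    next
      case False
      then have "q' = cont_num p (fst (cont_step l ss))" "as = snd (cont_step l ss)"
        using d' by simp_all
      moreover have "cont_num p (fst (cont_step l ss)) < ?N"
        by (rule cont_num_less[OF conts_closed[OF l False]])
      ultimately show ?thesis
        using ok_cont_step[OF ok ss] by simp
    qed
  next
    case False
    then have "q' = q" "as = keep ss"
      using d by (simp_all add: tm_of_def Let_def)
    then show ?thesis
      using q ss by (simp add: keep_def image_image)
  qed
  moreover have "cont_num p [p] < card (conts p [])"
    by (rule cont_num_less) simp
  ultimately show ?thesis
    using assms(1,2) unfolding wf_tm_def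
    by (simp add: tm_of_def Let_def)
qed

lemma step_tm_of:
  assumes "l \<in> conts p []" "l \<noteq> []"
  shows "step (tm_of k B p F) \<lparr>state = cont_num p l, tapes = ts\<rparr> =
    \<lparr>state = cont_num p (fst (cont_step l (map read ts))),
     tapes = map2 act (snd (cont_step l (map read ts))) ts\<rparr>"
  using assms cont_num_less[OF assms(1)]
  by (auto simp: step_def halted_def tm_of_def Let_def split: prod.splits)

text \<open>The induction needs a subprogram \<open>q\<close> in front of an arbitrary continuation
  \<open>k\<close>; the inclusion guarantees that every continuation met on the way has a
  number.\<close>

lemma pexec_tm_of:
  assumes "pexec q ts t ts'" "conts q k \<subseteq> conts p []"
  shows "(step (tm_of n B p F) ^^ t) \<lparr>state = cont_num p (q # k), tapes = ts\<rparr> =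
    \<lparr>state = cont_num p k, tapes = ts'\<rparr>"
  using assms
proof (induction arbitrary: k rule: pexec.induct)
  case (PDo f ts)
  then show ?case by (simp add: step_tm_of)
next
  case (PSeq a ts m ts1 b n' ts2)
  have "PSeq a b # k \<in> conts p []"
    using PSeq.prems by auto
  moreover have "conts a (b # k) \<subseteq> conts p []" "conts b k \<subseteq> conts p []"
    using PSeq.prems by auto
  ultimately show ?case
    using PSeq.IH by (simp add: step_tm_of funpow_Suc_right add.commute[of m] funpow_add del: funpow.simps)
next
  case (PIfT b ts p' m ts1 q)
  have "PIf b p' q # k \<in> conts p []" "conts p' k \<subseteq> conts p []"
    using PIfT.prems by auto
  then show ?case
    using PIfT by (simp add: step_tm_of funpow_Suc_right del: funpow.simps)
next
  case (PIfF b ts q m ts1 p')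
  have "PIf b p' q # k \<in> conts p []" "conts q k \<subseteq> conts p []"
    using PIfF.prems by auto
  then show ?case
    using PIfF by (simp add: step_tm_of funpow_Suc_right del: funpow.simps)
next
  case (PWhileF b ts p')
  have "PWhile b p' # k \<in> conts p []"
    using PWhileF.prems by auto
  then show ?case
    using PWhileF by (simp add: step_tm_of)
next
  case (PWhileT b ts p' m ts1 n' ts2)
  have "PWhile b p' # k \<in> conts p []" "conts p' (PWhile b p' # k) \<subseteq> conts p []"
    using PWhileT.prems by auto
  then show ?case
    using PWhileT by (simp add: step_tm_of funpow_Suc_right add.commute[of m] funpow_add del: funpow.simps)
qed

lemma run_tm_of:
  assumes "pexec p (input_tape w # replicate (k - 1) blank_tape) t ts'"
  shows "run (tm_of k B p F) w (Suc t) =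
    \<lparr>state = (if F (map read ts') then accept (tm_of k B p F) else reject (tm_of k B p F)), tapes = ts'\<rparr>"
proof -
  have "run (tm_of k B p F) w t = \<lparr>state = cont_num p [], tapes = ts'\<rparr>"
    using pexec_tm_of[OF assms, of "[]" p k B F]
    by (simp add: run_def init_def tm_of_def Let_def)
  moreover have "cont_num p [] < card (conts p [])"
    by (simp add: cont_num_less)
  ultimately show ?thesis
    by (auto simp: run_def step_def halted_def tm_of_def Let_def)
qed

text \<open>An upper bound in place of the exact count, so that costs can be rounded when runs are
  composed.\<close>

definition pruns :: "prog \<Rightarrow> tape list \<Rightarrow> nat \<Rightarrow> tape list \<Rightarrow> bool" where
  "pruns p ts B ts' \<longleftrightarrow> (\<exists>t\<le>B. pexec p ts t ts')"

lemma pruns_mono: "pruns p ts B ts' \<Longrightarrow> B \<le> C \<Longrightarrow> pruns p ts C ts'"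
  unfolding pruns_def by (meson order_trans)

lemma pruns_Do: "map2 act (f (map read ts)) ts = ts' \<Longrightarrow> pruns (PDo f) ts 1 ts'"
  unfolding pruns_def using pexec.PDo by blast

lemma pruns_Seq:
  assumes "pruns a ts A ts1" "pruns b ts1 B ts2" "Suc (A + B) \<le> C"
  shows "pruns (PSeq a b) ts C ts2"
proof -
  obtain s t where "s \<le> A" "pexec a ts s ts1" "t \<le> B" "pexec b ts1 t ts2"
    using assms(1,2) unfolding pruns_def by blast
  then have "pexec (PSeq a b) ts (Suc (s + t)) ts2" "Suc (s + t) \<le> C"
    using pexec.PSeq assms(3) by auto
  then show ?thesis
    unfolding pruns_def by blast
qed

lemma pruns_If:
  assumes "pruns (if b (map read ts) then p else q) ts A ts1" "Suc A \<le> C"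
  shows "pruns (PIf b p q) ts C ts1"
proof -
  obtain t where t: "t \<le> A" "pexec (if b (map read ts) then p else q) ts t ts1"
    using assms(1) unfolding pruns_def by blast
  then have "pexec (PIf b p q) ts (Suc t) ts1" "Suc t \<le> C"
    using assms(2) by (cases "b (map read ts)"; auto intro: pexec.PIfT pexec.PIfF)+
  then show ?thesis
    unfolding pruns_def by blast
qed

lemma pruns_While_end: "\<not> b (map read ts) \<Longrightarrow> pruns (PWhile b p) ts 1 ts"
  unfolding pruns_def using pexec.PWhileF by blast

lemma pruns_While_step:
  assumes "b (map read ts)" "pruns p ts A ts1" "pruns (PWhile b p) ts1 B ts2" "Suc (A + B) \<le> C"
  shows "pruns (PWhile b p) ts C ts2"
proof -
  obtain s t where "s \<le> A" "pexec p ts s ts1" "t \<le> B" "pexec (PWhile b p) ts1 t ts2"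
    using assms(2,3) unfolding pruns_def by blast
  then have "pexec (PWhile b p) ts (Suc (s + t)) ts2" "Suc (s + t) \<le> C"
    using pexec.PWhileT assms(1,4) by auto
  then show ?thesis
    unfolding pruns_def by blast
qed

definition pon :: "nat \<Rightarrow> (nat \<Rightarrow> nat \<times> move) \<Rightarrow> prog" where
  "pon i g = PDo (\<lambda>ss. (keep ss)[i := g (ss ! i)])"

lemma pruns_on:
  assumes "i < length ts" "ts' = ts[i := act (g (read (ts ! i))) (ts ! i)]"
  shows "pruns (pon i g) ts 1 ts'"
  unfolding pon_def
proof (rule pruns_Do)
  show "map2 act ((keep (map read ts))[i := g (map read ts ! i)]) ts = ts'"
    using assms by (intro nth_equalityI) (auto simp: keep_def nth_list_update)
qed

lemma length_keep [simp]: "length (keep ss) = length ss"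
  by (simp add: keep_def)

lemma set_list_update_subset: "set xs \<subseteq> A \<Longrightarrow> x \<in> A \<Longrightarrow> set (xs[i := x]) \<subseteq> A"
  using set_update_subset_insert[of xs i x] by blast

lemma ok_on: "i < k \<Longrightarrow> (\<And>s. s < B \<Longrightarrow> fst (g s) < B) \<Longrightarrow> ok_prog k B (pon i g)"
  unfolding pon_def ok_prog.simps
proof (intro allI impI conjI)
  fix ss :: "nat list"
  assume i: "i < k" and g: "\<And>s. s < B \<Longrightarrow> fst (g s) < B" and ss: "length ss = k" "set ss \<subseteq> {..<B}"
  have "ss ! i < B"
    using i ss by (metis lessThan_iff nth_mem subsetD)
  moreover have "set (keep ss) \<subseteq> {x. fst x < B}"
    using ss(2) by (auto simp: keep_def)
  ultimately have "set ((keep ss)[i := g (ss ! i)]) \<subseteq> {x. fst x < B}"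
    by (intro set_list_update_subset) (auto simp: g)
  then show "fst ` set ((keep ss)[i := g (ss ! i)]) \<subseteq> {..<B}"
    by auto
qed simp


section \<open>Loop programs on counters and bit arrays\<close>

record st =
  vl :: "nat \<Rightarrow> nat"
  bt :: "nat \<Rightarrow> nat \<Rightarrow> bool"

datatype com =
    Nop
  | Inc nat
  | Dec nat
  | SetB nat bool
  | Sq com com (infixr ";;" 60)
  | IfZ nat com com
  | IfB nat com com
  | For nat com

text \<open>Variable \<open>v\<close> holds the counter \<open>vl s v\<close>, which also is a position in its bit array \<open>bt s v\<close>:
  both live on one tape, the counter being the head position. The number of rounds of a loop is
  fixed on entry.\<close>

primrec sem :: "com \<Rightarrow> st \<Rightarrow> st" where
  "sem Nop s = s"
| "sem (Inc v) s = s\<lparr>vl := (vl s)(v := Suc (vl s v))\<rparr>"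
| "sem (Dec v) s = s\<lparr>vl := (vl s)(v := vl s v - 1)\<rparr>"
| "sem (SetB v x) s = s\<lparr>bt := (bt s)(v := (bt s v)(vl s v := x))\<rparr>"
| "sem (a ;; b) s = sem b (sem a s)"
| "sem (IfZ v a b) s = (if vl s v = 0 then sem a s else sem b s)"
| "sem (IfB v a b) s = (if bt s v (vl s v) then sem a s else sem b s)"
| "sem (For v c) s = (sem c ^^ vl s v) s"

text \<open>\<open>safe V c s\<close> bounds the loop counts by \<open>V\<close>, which makes the running time polynomial in \<open>V\<close>.\<close>

primrec safe :: "nat \<Rightarrow> com \<Rightarrow> st \<Rightarrow> bool" where
  "safe V Nop s \<longleftrightarrow> True"
| "safe V (Inc v) s \<longleftrightarrow> True"
| "safe V (Dec v) s \<longleftrightarrow> True"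
| "safe V (SetB v x) s \<longleftrightarrow> True"
| "safe V (a ;; b) s \<longleftrightarrow> safe V a s \<and> safe V b (sem a s)"
| "safe V (IfZ v a b) s \<longleftrightarrow> (if vl s v = 0 then safe V a s else safe V b s)"
| "safe V (IfB v a b) s \<longleftrightarrow> (if bt s v (vl s v) then safe V a s else safe V b s)"
| "safe V (For v c) s \<longleftrightarrow> vl s v \<le> V \<and> (\<forall>i<vl s v. safe V c ((sem c ^^ i) s))"

text \<open>\<open>m\<close> limits the variables, \<open>D\<close> the temporaries, and
  \<open>d\<close> is the loop depth at which the command stands. A loop at depth \<open>d\<close>
  occupies temporary \<open>Suc d\<close>.\<close>

primrec fits :: "nat \<Rightarrow> nat \<Rightarrow> nat \<Rightarrow> com \<Rightarrow> bool" where
  "fits m D d Nop \<longleftrightarrow> True"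
| "fits m D d (Inc v) \<longleftrightarrow> v < m"
| "fits m D d (Dec v) \<longleftrightarrow> v < m"
| "fits m D d (SetB v x) \<longleftrightarrow> v < m"
| "fits m D d (a ;; b) \<longleftrightarrow> fits m D d a \<and> fits m D d b"
| "fits m D d (IfZ v a b) \<longleftrightarrow> v < m \<and> fits m D d a \<and> fits m D d b"
| "fits m D d (IfB v a b) \<longleftrightarrow> v < m \<and> fits m D d a \<and> fits m D d b"
| "fits m D d (For v c) \<longleftrightarrow> v < m \<and> Suc d < D \<and> fits m D (Suc d) c"

lemma fits_mono: "fits m D d c \<Longrightarrow> m \<le> m' \<Longrightarrow> D \<le> D' \<Longrightarrow> fits m' D' d c"
  by (induction c arbitrary: d) auto

lemma ex_fits: "\<exists>m D. fits m D d c"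
proof (induction c arbitrary: d)
  case (Sq a b)
  obtain m D m' D' where "fits m D d a" "fits m' D' d b"
    using Sq by meson
  then have "fits (max m m') (max D D') d (a ;; b)"
    by (simp add: fits_mono[of _ _ _ a] fits_mono[of _ _ _ b])
  then show ?case by blast
next
  case (IfZ v a b)
  obtain m D m' D' where "fits m D d a" "fits m' D' d b"
    using IfZ by meson
  then have "fits (max (Suc v) (max m m')) (max D D') d (IfZ v a b)"
    by (simp add: fits_mono[of _ _ _ a] fits_mono[of _ _ _ b] less_max_iff_disj)
  then show ?case by blast
next
  case (IfB v a b)
  obtain m D m' D' where "fits m D d a" "fits m' D' d b"
    using IfB by meson
  then have "fits (max (Suc v) (max m m')) (max D D') d (IfB v a b)"
    by (simp add: fits_mono[of _ _ _ a] fits_mono[of _ _ _ b] less_max_iff_disj)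
  then show ?case by blast
next
  case (For v c)
  obtain m D where "fits m D (Suc d) c"
    using For by meson
  then have "fits (max (Suc v) m) (max (d + 2) D) d (For v c)"
    by (simp add: fits_mono[of _ _ _ c] less_max_iff_disj)
  then show ?case by blast
qed (auto intro: lessI)

text \<open>The counter is the head position; cell 0 carries the marker 2, which makes zero recognisable,
  and each cell adds its bit to that.\<close>

definition vtape :: "nat \<Rightarrow> (nat \<Rightarrow> bool) \<Rightarrow> tape" where
  "vtape n f = Tape (\<lambda>i. (if i = 0 then 2 else 0) + (if 0 \<le> i \<and> f (nat i) then 1 else 0)) (int n)"

lemma read_vtape: "read (vtape n f) = (if n = 0 then 2 else 0) + (if f n then 1 else 0)"
  by (simp add: vtape_def read_def)

lemma zero_vtape [simp]: "2 \<le> read (vtape n f) \<longleftrightarrow> n = 0"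
  by (simp add: read_vtape)

lemma odd_vtape [simp]: "odd (read (vtape n f)) \<longleftrightarrow> f n"
  by (simp add: read_vtape)

definition inc_sym :: "nat \<Rightarrow> nat \<times> move" where
  "inc_sym s = (s, Go_Right)"

definition dec_sym :: "nat \<Rightarrow> nat \<times> move" where
  "dec_sym s = (s, if s \<ge> 2 then Stay else Go_Left)"

definition set_sym :: "bool \<Rightarrow> nat \<Rightarrow> nat \<times> move" where
  "set_sym x s = ((if s \<ge> 2 then 2 else 0) + (if x then 1 else 0), Stay)"

lemma act_inc_sym [simp]: "act (inc_sym (read (vtape n f))) (vtape n f) = vtape (Suc n) f"
  by (auto simp: inc_sym_def vtape_def read_def)

lemma act_dec_sym [simp]: "act (dec_sym (read (vtape n f))) (vtape n f) = vtape (n - 1) f"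
  by (auto simp: dec_sym_def vtape_def read_def)

lemma act_set_sym [simp]:
  "act (set_sym x (read (vtape n f))) (vtape n f) = vtape n (f(n := x))"
proof -
  let ?c = "\<lambda>f i. (if i = (0::int) then 2 else 0) + (if 0 \<le> i \<and> f (nat i) then 1 else (0::nat))"
  have "(?c f)(int n := (if n = 0 then 2 else 0) + (if x then 1 else 0)) = ?c (f(n := x))"
  proof
    fix i
    show "((?c f)(int n := (if n = 0 then 2 else 0) + (if x then 1 else 0))) i = ?c (f(n := x)) i"
      by (cases "i = int n"; cases "0 \<le> i") (simp_all add: nat_eq_iff)
  qed
  then show ?thesis
    unfolding set_sym_def zero_vtape by (simp only: vtape_def act.simps move.case)
qed

definition var_tape :: "nat \<Rightarrow> st \<Rightarrow> (nat \<Rightarrow> nat) \<Rightarrow> nat \<Rightarrow> tape" where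
  "var_tape m s tmp v =
     (if v < m then vtape (vl s v) (bt s v) else vtape (tmp (v - m)) (\<lambda>_. False))"

text \<open>\<open>pre\<close> and \<open>post\<close> are tapes foreign to the loop program: before
  it the input and the tapes of an embedded machine, after it one tape for a machine state or for
  the output.\<close>

definition layout ::
  "tape list \<Rightarrow> tape list \<Rightarrow> nat \<Rightarrow> nat \<Rightarrow> st \<Rightarrow> (nat \<Rightarrow> nat) \<Rightarrow> tape list" where
  "layout pre post m D s tmp = pre @ map (var_tape m s tmp) [0..<m + D] @ post"

lemma length_layout [simp]: "length (layout pre post m D s tmp) = length pre + (m + D) + length post"
  by (simp add: layout_def)

lemma nth_layout [simp]: "v < m + D \<Longrightarrow> layout pre post m D s tmp ! (length pre + v) = var_tape m s tmp v"
  by (simp add: layout_def nth_append)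

lemma layout_update:
  assumes "v < m + D" "\<And>v'. v' \<noteq> v \<Longrightarrow> var_tape m s' tmp' v' = var_tape m s tmp v'"
  shows "(layout pre post m D s tmp)[length pre + v := var_tape m s' tmp' v] = layout pre post m D s' tmp'"
  using assms by (intro nth_equalityI) (auto simp: layout_def nth_append nth_list_update)

lemma pruns_on_layout:
  assumes "v < m + D" "act (g (read (var_tape m s tmp v))) (var_tape m s tmp v) = var_tape m s' tmp' v"
    "\<And>v'. v' \<noteq> v \<Longrightarrow> var_tape m s' tmp' v' = var_tape m s tmp v'"
  shows "pruns (pon (length pre + v) g) (layout pre post m D s tmp) 1 (layout pre post m D s' tmp')"
  using assms by (intro pruns_on) (simp_all add: layout_update)

section \<open>Compiling loop programs\<close>

definition tz :: "nat \<Rightarrow> nat list \<Rightarrow> bool" where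
  "tz i ss \<longleftrightarrow> ss ! i \<ge> 2"

definition tb :: "nat \<Rightarrow> nat list \<Rightarrow> bool" where
  "tb i ss \<longleftrightarrow> odd (ss ! i)"

lemma tz_layout:
  "v < m + D \<Longrightarrow> tz (length pre + v) (map read (layout pre post m D s tmp)) \<longleftrightarrow>
    (if v < m then vl s v else tmp (v - m)) = 0"
  by (simp add: tz_def var_tape_def)

lemma tb_layout:
  "v < m \<Longrightarrow> tb (length pre + v) (map read (layout pre post m D s tmp)) \<longleftrightarrow> bt s v (vl s v)"
  by (simp add: tb_def var_tape_def)

text \<open>A loop moves its counter to two temporaries: from \<open>m\<close> it is restored, and \<open>m + Suc d\<close>, where
  \<open>d\<close> is the nesting depth, counts the remaining rounds.\<close>

abbreviation split_prog :: "nat \<Rightarrow> nat \<Rightarrow> nat \<Rightarrow> nat \<Rightarrow> prog" where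
  "split_prog b m v d \<equiv> PWhile (\<lambda>ss. \<not> tz (b + v) ss) (PSeq (pon (b + v) dec_sym) (PSeq (pon (b + (m + Suc d)) inc_sym) (pon (b + (m + 0)) inc_sym)))"

abbreviation restore_prog :: "nat \<Rightarrow> nat \<Rightarrow> nat \<Rightarrow> prog" where
  "restore_prog b m v \<equiv> PWhile (\<lambda>ss. \<not> tz (b + (m + 0)) ss) (PSeq (pon (b + (m + 0)) dec_sym) (pon (b + v) inc_sym))"

abbreviation rounds_prog :: "nat \<Rightarrow> nat \<Rightarrow> nat \<Rightarrow> prog \<Rightarrow> prog" where
  "rounds_prog b m d p \<equiv> PWhile (\<lambda>ss. \<not> tz (b + (m + Suc d)) ss) (PSeq (pon (b + (m + Suc d)) dec_sym) p)"

primrec compile :: "nat \<Rightarrow> nat \<Rightarrow> nat \<Rightarrow> com \<Rightarrow> prog" where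
  "compile b m d Nop = PDo keep"
| "compile b m d (Inc v) = pon (b + v) inc_sym"
| "compile b m d (Dec v) = pon (b + v) dec_sym"
| "compile b m d (SetB v x) = pon (b + v) (set_sym x)"
| "compile b m d (p ;; q) = PSeq (compile b m d p) (compile b m d q)"
| "compile b m d (IfZ v p q) = PIf (tz (b + v)) (compile b m d p) (compile b m d q)"
| "compile b m d (IfB v p q) = PIf (tb (b + v)) (compile b m d p) (compile b m d q)"
| "compile b m d (For v c) =
    PSeq (split_prog b m v d)
   (PSeq (restore_prog b m v)
         (rounds_prog b m d (compile b m (Suc d) c)))"

text \<open>Per round, a loop spends 6 steps on splitting its counter, 4 on restoring it and 3 on
  counting down; 20 is a generous bound for these 13.\<close>

primrec time_bound :: "com \<Rightarrow> nat \<Rightarrow> nat" where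
  "time_bound Nop V = 1"
| "time_bound (Inc v) V = 1"
| "time_bound (Dec v) V = 1"
| "time_bound (SetB v x) V = 1"
| "time_bound (a ;; b) V = time_bound a V + time_bound b V + 1"
| "time_bound (IfZ v a b) V = time_bound a V + time_bound b V + 1"
| "time_bound (IfB v a b) V = time_bound a V + time_bound b V + 1"
| "time_bound (For v c) V = V * (time_bound c V + 20) + 20"

lemma pruns_inc_var:
  "v < m \<Longrightarrow> pruns (pon (length pre + v) inc_sym) (layout pre post m D s tmp) 1
    (layout pre post m D (s\<lparr>vl := (vl s)(v := Suc (vl s v))\<rparr>) tmp)"
  by (rule pruns_on_layout) (auto simp: var_tape_def)

lemma pruns_dec_var:
  "v < m \<Longrightarrow> pruns (pon (length pre + v) dec_sym) (layout pre post m D s tmp) 1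
    (layout pre post m D (s\<lparr>vl := (vl s)(v := vl s v - 1)\<rparr>) tmp)"
  by (rule pruns_on_layout) (auto simp: var_tape_def)

lemma pruns_set_var:
  "v < m \<Longrightarrow> pruns (pon (length pre + v) (set_sym x)) (layout pre post m D s tmp) 1
    (layout pre post m D (s\<lparr>bt := (bt s)(v := (bt s v)(vl s v := x))\<rparr>) tmp)"
  by (rule pruns_on_layout) (auto simp: var_tape_def)

lemma pruns_inc_tmp:
  "i < D \<Longrightarrow> pruns (pon (length pre + (m + i)) inc_sym) (layout pre post m D s tmp) 1
    (layout pre post m D s (tmp(i := Suc (tmp i))))"
  by (rule pruns_on_layout) (auto simp: var_tape_def)

lemma pruns_dec_tmp:
  "i < D \<Longrightarrow> pruns (pon (length pre + (m + i)) dec_sym) (layout pre post m D s tmp) 1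
    (layout pre post m D s (tmp(i := tmp i - 1)))"
  by (rule pruns_on_layout) (auto simp: var_tape_def)

lemma pruns_split:
  assumes "v < m" "Suc d < D" "vl s v = n" "b = length pre"
  shows "pruns (split_prog b m v d)
    (layout pre post m D s tmp) (6 * n + 1)
    (layout pre post m D (s\<lparr>vl := (vl s)(v := 0)\<rparr>) (tmp(0 := tmp 0 + n, Suc d := tmp (Suc d) + n)))"
  using assms
proof (induction n arbitrary: s tmp)
  case 0
  then have "s\<lparr>vl := (vl s)(v := 0)\<rparr> = s"
    by (simp add: fun_upd_idem)
  then show ?case
    using 0 pruns_While_end[of "\<lambda>ss. \<not> tz (length pre + v) ss" "layout pre post m D s tmp"]
    by (simp add: tz_layout del: fun_upd_apply)
next
  case (Suc n)
  let ?s = "s\<lparr>vl := (vl s)(v := n)\<rparr>"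
  let ?tmp = "tmp(Suc d := Suc (tmp (Suc d)))"
  let ?tmp' = "?tmp(0 := Suc (?tmp 0))"
  have 1: "pruns (pon (b + v) dec_sym) (layout pre post m D s tmp) 1 (layout pre post m D ?s tmp)"
    using pruns_dec_var[of v m pre post D s tmp] Suc.prems by simp
  have 2: "pruns (pon (b + (m + Suc d)) inc_sym) (layout pre post m D ?s tmp) 1 (layout pre post m D ?s ?tmp)"
    using pruns_inc_tmp[of "Suc d" D pre m post ?s tmp] Suc.prems by simp
  have 3: "pruns (pon (b + (m + 0)) inc_sym) (layout pre post m D ?s ?tmp) 1 (layout pre post m D ?s ?tmp')"
    using pruns_inc_tmp[of 0 D pre m post ?s ?tmp] Suc.prems by simp
  have 4: "?tmp'(0 := ?tmp' 0 + n, Suc d := ?tmp' (Suc d) + n) = tmp(0 := tmp 0 + Suc n, Suc d := tmp (Suc d) + Suc n)"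
    by auto
  show ?case
  proof (rule pruns_While_step[OF _ pruns_Seq[OF 1 pruns_Seq[OF 2 3 order.refl] order.refl]])
    show "\<not> tz (b + v) (map read (layout pre post m D s tmp))"
      using Suc.prems by (simp add: tz_layout)
  next
    show "pruns (split_prog b m v d)
      (layout pre post m D ?s ?tmp') (6 * n + 1)
      (layout pre post m D (s\<lparr>vl := (vl s)(v := 0)\<rparr>) (tmp(0 := tmp 0 + Suc n, Suc d := tmp (Suc d) + Suc n)))"
      using Suc.IH[of ?s ?tmp'] Suc.prems unfolding 4 by (simp del: fun_upd_apply add: fun_upd_same)
  qed simp
qed

lemma pruns_restore:
  assumes "v < m" "0 < D" "tmp 0 = n" "b = length pre"
  shows "pruns (restore_prog b m v)
    (layout pre post m D s tmp) (4 * n + 1)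
    (layout pre post m D (s\<lparr>vl := (vl s)(v := vl s v + n)\<rparr>) (tmp(0 := 0)))"
  using assms
proof (induction n arbitrary: s tmp)
  case 0
  then have "tmp(0 := 0) = tmp"
    by auto
  then show ?case
    using 0 pruns_While_end[of "\<lambda>ss. \<not> tz (length pre + (m + 0)) ss" "layout pre post m D s tmp"]
    by (simp add: tz_layout[of "m + 0", simplified])
next
  case (Suc n)
  let ?s = "s\<lparr>vl := (vl s)(v := Suc (vl s v))\<rparr>"
  let ?tmp = "tmp(0 := n)"
  have 1: "pruns (pon (b + (m + 0)) dec_sym) (layout pre post m D s tmp) 1 (layout pre post m D s ?tmp)"
    using pruns_dec_tmp[of 0 D pre m post s tmp] Suc.prems by simp
  have 2: "pruns (pon (b + v) inc_sym) (layout pre post m D s ?tmp) 1 (layout pre post m D ?s ?tmp)"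
    using pruns_inc_var[of v m pre post D s ?tmp] Suc.prems by simp
  show ?case
  proof (rule pruns_While_step[OF _ pruns_Seq[OF 1 2 order.refl]])
    show "\<not> tz (b + (m + 0)) (map read (layout pre post m D s tmp))"
      using Suc.prems by (simp add: tz_layout[of "m + 0", simplified])
  next
    show "pruns (restore_prog b m v)
      (layout pre post m D ?s ?tmp) (4 * n + 1)
      (layout pre post m D (s\<lparr>vl := (vl s)(v := vl s v + Suc n)\<rparr>) (tmp(0 := 0)))"
      using Suc.IH[of ?tmp ?s] Suc.prems by (simp del: fun_upd_apply add: fun_upd_same)
  qed simp
qed

text \<open>The body is assumed correct for all contents of the temporaries 1 to
  \<open>Suc d\<close>, because the remaining count in \<open>Suc d\<close> changes between rounds.
  Only the temporaries available to the body itself must be clear.\<close>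

lemma pruns_rounds:
  assumes "Suc d < D" "b = length pre" "tmp (Suc d) = n"
    and body: "\<And>i tmp. i < n \<Longrightarrow> tmp 0 = 0 \<Longrightarrow> (\<And>j. j > Suc d \<Longrightarrow> tmp j = 0) \<Longrightarrow>
      pruns p (layout pre post m D ((f ^^ i) s) tmp) B (layout pre post m D ((f ^^ Suc i) s) tmp)"
    and tmp: "tmp 0 = 0" "\<And>j. j > Suc d \<Longrightarrow> tmp j = 0"
  shows "pruns (rounds_prog b m d p)
    (layout pre post m D s tmp) (n * (B + 3) + 1)
    (layout pre post m D ((f ^^ n) s) (tmp(Suc d := 0)))"
  using assms
proof (induction n arbitrary: s tmp)
  case 0
  then have "tmp(Suc d := 0) = tmp"
    by auto
  then show ?case
    using 0 pruns_While_end[of "\<lambda>ss. \<not> tz (length pre + (m + Suc d)) ss" "layout pre post m D s tmp"]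
    by (simp add: tz_layout[of "m + Suc d", simplified])
next
  case (Suc n)
  let ?tmp = "tmp(Suc d := n)"
  have 1: "pruns (pon (b + (m + Suc d)) dec_sym) (layout pre post m D s tmp) 1 (layout pre post m D s ?tmp)"
    using pruns_dec_tmp[of "Suc d" D pre m post s tmp] Suc.prems by simp
  have 2: "pruns p (layout pre post m D s ?tmp) B (layout pre post m D (f s) ?tmp)"
    using Suc.prems(4)[of 0 ?tmp] Suc.prems(5,6) by (simp del: fun_upd_apply add: fun_upd_same fun_upd_other)
  show ?case
  proof (rule pruns_While_step[OF _ pruns_Seq[OF 1 2 order.refl]])
    show "\<not> tz (b + (m + Suc d)) (map read (layout pre post m D s tmp))"
      using Suc.prems(1-3) by (simp add: tz_layout[of "m + Suc d", simplified])
  next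
    have "pruns (rounds_prog b m d p)
      (layout pre post m D (f s) ?tmp) (n * (B + 3) + 1)
      (layout pre post m D ((f ^^ n) (f s)) (?tmp(Suc d := 0)))"
    proof (rule Suc.IH)
      show "pruns p (layout pre post m D ((f ^^ i) (f s)) tmp') B (layout pre post m D ((f ^^ Suc i) (f s)) tmp')"
        if "i < n" "tmp' 0 = 0" "\<And>j. j > Suc d \<Longrightarrow> tmp' j = 0" for i tmp'
        using Suc.prems(4)[of "Suc i" tmp'] that by (simp add: funpow_swap1[of f, symmetric])
    qed (use Suc.prems in simp_all)
    then show "pruns (rounds_prog b m d p)
      (layout pre post m D (f s) ?tmp) (n * (B + 3) + 1)
      (layout pre post m D ((f ^^ Suc n) s) (tmp(Suc d := 0)))"
      by (simp add: funpow_swap1[of f, symmetric] del: fun_upd_apply)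
  qed simp
qed

text \<open>Temporary 0 is nonzero only while a loop copies its counter, so loops at all depths
  share it; the round counters of nested loops lie at different depths. All temporaries end as they
  began, which carries the hypotheses through sequences and rounds.\<close>

theorem compile_correct:
  assumes "fits m D d c" "safe V c s" "tmp 0 = 0" "\<And>j. j > d \<Longrightarrow> tmp j = 0" "b = length pre"
  shows "pruns (compile b m d c) (layout pre post m D s tmp) (time_bound c V)
    (layout pre post m D (sem c s) tmp)"
  using assms
proof (induction c arbitrary: d s tmp)
  case Nop
  show ?case
    unfolding compile.simps sem.simps time_bound.simps by (rule pruns_Do) simp
next
  case (Inc v)
  then show ?case by (simp add: pruns_inc_var[unfolded One_nat_def])
next
  case (Dec v)
  then show ?case using pruns_dec_var[of v m pre post D s tmp] by simp
next
  case (SetB v x)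
  then show ?case by (simp add: pruns_set_var[unfolded One_nat_def])
next
  case (Sq p q)
  show ?case
    unfolding compile.simps sem.simps
    by (rule pruns_Seq[OF Sq.IH(1)[of d s tmp] Sq.IH(2)[of d "sem p s" tmp]]) (use Sq.prems in simp_all)
next
  case (IfZ v p q)
  show ?case
    unfolding compile.simps
  proof (rule pruns_If)
    show "pruns (if tz (b + v) (map read (layout pre post m D s tmp)) then compile b m d p else compile b m d q)
      (layout pre post m D s tmp) (time_bound p V + time_bound q V) (layout pre post m D (sem (IfZ v p q) s) tmp)"
    proof (cases "vl s v = 0")
      case True
      then show ?thesis
        using IfZ.prems pruns_mono[OF IfZ.IH(1)[of d s tmp]] by (simp add: tz_layout)
    next
      case False
      then show ?thesis
        using IfZ.prems pruns_mono[OF IfZ.IH(2)[of d s tmp]] by (simp add: tz_layout)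
    qed
  qed simp
next
  case (IfB v p q)
  show ?case
    unfolding compile.simps
  proof (rule pruns_If)
    show "pruns (if tb (b + v) (map read (layout pre post m D s tmp)) then compile b m d p else compile b m d q)
      (layout pre post m D s tmp) (time_bound p V + time_bound q V) (layout pre post m D (sem (IfB v p q) s) tmp)"
    proof (cases "bt s v (vl s v)")
      case True
      then show ?thesis
        using IfB.prems pruns_mono[OF IfB.IH(1)[of d s tmp]] by (simp add: tb_layout)
    next
      case False
      then show ?thesis
        using IfB.prems pruns_mono[OF IfB.IH(2)[of d s tmp]] by (simp add: tb_layout)
    qed
  qed simp
next
  case (For v c)
  define n where "n = vl s v"
  let ?s = "s\<lparr>vl := (vl s)(v := 0)\<rparr>"
  let ?tmp = "tmp(0 := n, Suc d := n)"
  let ?tmp' = "tmp(Suc d := n)"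
  have v: "v < m" "Suc d < D" and n: "n \<le> V" and t0: "tmp (Suc d) = 0"
    using For.prems by (auto simp: n_def)
  have 1: "pruns (split_prog b m v d)
    (layout pre post m D s tmp) (6 * n + 1) (layout pre post m D ?s ?tmp)"
    using pruns_split[of v m d D s n b pre post tmp] v For.prems t0 by (simp add: n_def)
  have "?s\<lparr>vl := (vl ?s)(v := vl ?s v + n)\<rparr> = s" "?tmp(0 := 0) = ?tmp'"
    using For.prems(3) by (auto simp: n_def)
  then have 2: "pruns (restore_prog b m v)
    (layout pre post m D ?s ?tmp) (4 * n + 1) (layout pre post m D s ?tmp')"
    using pruns_restore[of v m D ?tmp n b pre post ?s] v For.prems(5) by simp
  have "pruns (compile b m (Suc d) c) (layout pre post m D ((sem c ^^ i) s) tmp'') (time_bound c V)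
      (layout pre post m D ((sem c ^^ Suc i) s) tmp'')"
    if "i < n" "tmp'' 0 = 0" "\<And>j. j > Suc d \<Longrightarrow> tmp'' j = 0" for i tmp''
    using For.IH[of "Suc d" "(sem c ^^ i) s" tmp''] For.prems that by (simp add: n_def)
  then have 3: "pruns (rounds_prog b m d (compile b m (Suc d) c))
    (layout pre post m D s ?tmp') (n * (time_bound c V + 3) + 1) (layout pre post m D ((sem c ^^ n) s) (?tmp'(Suc d := 0)))"
    using v For.prems by (intro pruns_rounds) auto
  have 4: "?tmp'(Suc d := 0) = tmp"
    using t0 by auto
  have "Suc (6 * n + 1 + Suc (4 * n + 1 + (n * (time_bound c V + 3) + 1))) \<le> n * (time_bound c V + 20) + 20"
    by (simp add: algebra_simps)
  also have "\<dots> \<le> time_bound (For v c) V"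
    using n by simp
  finally show ?case
    unfolding compile.simps sem.simps n_def[symmetric]
    by (intro pruns_Seq[OF 1 pruns_Seq[OF 2 3[unfolded 4] order.refl]])
qed

lemma ok_compile:
  assumes "fits m D d c" "b + (m + D) \<le> k" "B \<ge> 4"
  shows "ok_prog k B (compile b m d c)"
  using assms
  by (induction c arbitrary: d)
    (auto simp: keep_def inc_sym_def dec_sym_def set_sym_def intro!: ok_on)

lemma time_bound_poly: "\<exists>p :: nat poly. \<forall>V. time_bound c V = poly p V"
proof (induction c)
  case (Sq a b)
  then obtain p q where "\<forall>V. time_bound a V = poly p V" "\<forall>V. time_bound b V = poly q V"
    by blast
  then show ?case by (intro exI[of _ "p + q + 1"]) simp
next
  case (IfZ v a b)
  then obtain p q where "\<forall>V. time_bound a V = poly p V" "\<forall>V. time_bound b V = poly q V"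
    by blast
  then show ?case by (intro exI[of _ "p + q + 1"]) simp
next
  case (IfB v a b)
  then obtain p q where "\<forall>V. time_bound a V = poly p V" "\<forall>V. time_bound b V = poly q V"
    by blast
  then show ?case by (intro exI[of _ "p + q + 1"]) simp
next
  case (For v c)
  then obtain p where "\<forall>V. time_bound c V = poly p V"
    by blast
  then show ?case by (intro exI[of _ "[:0, 1:] * (p + [:20:]) + [:20:]"]) simp
qed (auto intro: exI[of _ 1])

section \<open>Input and output of loop programs\<close>

definition itape :: "bool list \<Rightarrow> int \<Rightarrow> tape" where
  "itape w h = Tape (cells (input_tape w)) h"

lemma itape_0: "itape w 0 = input_tape w"
  by (simp add: itape_def input_tape_def)

lemma read_itape:
  "read (itape w h) = (if 0 \<le> h \<and> nat h < length w then bit_sym (w ! nat h) else 0)"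
  by (simp add: itape_def input_tape_def read_def)

definition left_sym :: "nat \<Rightarrow> nat \<times> move" where
  "left_sym s = (s, Go_Left)"

lemma act_itape [simp]:
  "act (inc_sym (read (itape w h))) (itape w h) = itape w (h + 1)"
  "act (left_sym (read (itape w h))) (itape w h) = itape w (h - 1)"
  by (simp_all add: itape_def inc_sym_def left_sym_def read_def)

text \<open>The state in which a loop program finds its input: the bits of \<open>w\<close> in the array of
  variable 0, and the length of \<open>w\<close> in the variables 0 and 1.\<close>

definition input_state :: "bool list \<Rightarrow> nat \<Rightarrow> st" where
  "input_state w i =
     \<lparr>vl = (\<lambda>_. 0)(0 := i, 1 := i), bt = (\<lambda>_ _. False)(0 := (\<lambda>j. j < i \<and> w ! j))\<rparr>"

abbreviation "input_st w \<equiv> input_state w (length w)"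

text \<open>A variable with counter 0 and no bits differs from a blank tape only by the marker in
  cell 0, so a single step prepares all variables.\<close>

definition mark_prog :: "nat \<Rightarrow> nat \<Rightarrow> nat \<Rightarrow> prog" where
  "mark_prog b N k =
     PDo (\<lambda>ss. map (\<lambda>i. (if b \<le> i \<and> i < b + N then 2 else ss ! i, Stay)) [0..<k])"

definition copy_prog :: "nat \<Rightarrow> prog" where
  "copy_prog b = PWhile (\<lambda>ss. ss ! 0 \<noteq> 0)
     (PSeq (PIf (\<lambda>ss. ss ! 0 = 2) (pon (b + 0) (set_sym True)) (PDo keep))
     (PSeq (pon (b + 0) inc_sym) (PSeq (pon (b + 1) inc_sym) (pon 0 inc_sym))))"

text \<open>The head stands on the blank behind the input, where the loop would stop at once; hence
  the step to the left before it. The input has to be rewound because an embedded machine may read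
  it next.\<close>

definition rewind_prog :: prog where
  "rewind_prog = PSeq (pon 0 left_sym)
     (PSeq (PWhile (\<lambda>ss. ss ! 0 \<noteq> 0) (pon 0 left_sym)) (pon 0 inc_sym))"

definition loop_prog :: "nat \<Rightarrow> nat \<Rightarrow> nat \<Rightarrow> com \<Rightarrow> prog \<Rightarrow> prog" where
  "loop_prog b m D c fin = PSeq (mark_prog b (m + D) (b + (m + D) + 1))
     (PSeq (copy_prog b) (PSeq rewind_prog (PSeq (compile b m 0 c) fin)))"

lemma blank_vtape: "act (2, Stay) blank_tape = vtape 0 (\<lambda>_. False)"
  by (auto simp: blank_tape_def vtape_def)

lemma pruns_mark:
  assumes "length pre = b"
  shows "pruns (mark_prog b (m + D) (b + (m + D) + 1)) (pre @ replicate (m + D) blank_tape @ [blank_tape]) 1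
    (layout pre [blank_tape] m D (input_state w 0) (\<lambda>_. 0))"
  unfolding mark_prog_def
proof (rule pruns_Do)
  let ?ts = "pre @ replicate (m + D) blank_tape @ [blank_tape]"
  show "map2 act (map (\<lambda>i. (if b \<le> i \<and> i < b + (m + D) then 2 else map read ?ts ! i, Stay)) [0..<b + (m + D) + 1]) ?ts =
    layout pre [blank_tape] m D (input_state w 0) (\<lambda>_. 0)" (is "?l = ?r")
  proof (rule nth_equalityI)
    fix i assume "i < length ?l"
    then have i: "i < b + (m + D) + 1"
      by simp
    then have l: "?l ! i = act (if b \<le> i \<and> i < b + (m + D) then 2 else read (?ts ! i), Stay) (?ts ! i)"
      using assms by (simp del: upt_Suc map_append map_replicate)
    consider "i < b" | v where "i = b + v" "v < m + D" | "i = b + (m + D)"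
      using i by (metis add_diff_inverse_nat less_Suc_eq Suc_eq_plus1 nat_add_left_cancel_less)
    then show "?l ! i = ?r ! i"
    proof cases
      case 1
      then show ?thesis
        using assms by (simp add: l) (simp add: layout_def nth_append)
    next
      case 2
      then have "?ts ! i = blank_tape"
        using assms by (simp add: nth_append)
      then have "?l ! i = vtape 0 (\<lambda>_. False)"
        using 2 unfolding l by (simp add: blank_vtape)
      moreover have "?r ! i = vtape 0 (\<lambda>_. False)"
        using 2 assms by (auto simp: var_tape_def input_state_def)
      ultimately show ?thesis by simp
    next
      case 3
      then show ?thesis
        using assms by (simp add: l) (simp add: layout_def nth_append)
    qed
  qed (simp add: assms)
qed

lemma pruns_on_head:
  "t' = act (g (read t)) t \<Longrightarrow> pruns (pon 0 g) (layout (t # rest) post m D s tmp) 1 (layout (t' # rest) post m D s tmp)"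
  by (rule pruns_on) (simp_all add: layout_def)

lemma read_layout_head [simp]: "map read (layout (t # rest) post m D s tmp) ! 0 = read t"
  by (simp add: layout_def)

lemma pruns_copy:
  assumes "2 \<le> m" "b = Suc (length rest)" "i \<le> length w"
  shows "pruns (copy_prog b) (layout (itape w (int i) # rest) post m D (input_state w i) tmp) (20 * (length w - i) + 1)
    (layout (itape w (int (length w)) # rest) post m D (input_st w) tmp)"
  using assms(3)
proof (induction "length w - i" arbitrary: i)
  case 0
  then have "i = length w" by simp
  then show ?case
    using pruns_While_end[of "\<lambda>ss. ss ! 0 \<noteq> 0" "layout (itape w (int i) # rest) post m D (input_state w i) tmp"]
    by (simp add: copy_prog_def read_itape)
next
  case (Suc n)
  then have i: "i < length w" by simp
  \<comment> \<open>The state after bit \<open>i\<close> is written and before the counters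
    move.\<close>
  define s1 where "s1 = \<lparr>vl = (\<lambda>_. 0)(0 := i, 1 := i), bt = (\<lambda>_ _. False)(0 := (\<lambda>j. j < Suc i \<and> w ! j))\<rparr>"
  let ?s2 = "s1\<lparr>vl := (vl s1)(0 := Suc (vl s1 0))\<rparr>"
  let ?s3 = "?s2\<lparr>vl := (vl ?s2)(1 := Suc (vl ?s2 1))\<rparr>"
  let ?lay = "\<lambda>h s. layout (itape w (int h) # rest) post m D s tmp"
  have s3: "?s3 = input_state w (Suc i)"
    by (auto simp: s1_def input_state_def)
  have b: "b = length (itape w (int i) # rest)"
    using assms(2) by simp
  have 1: "pruns (PIf (\<lambda>ss. ss ! 0 = 2) (pon (b + 0) (set_sym True)) (PDo keep)) (?lay i (input_state w i)) 2 (?lay i s1)"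
  proof (rule pruns_If)
    show "pruns (if map read (?lay i (input_state w i)) ! 0 = 2 then pon (b + 0) (set_sym True) else PDo keep)
      (?lay i (input_state w i)) 1 (?lay i s1)"
    proof (cases "w ! i")
      case True
      have "s1 = (input_state w i)\<lparr>bt := (bt (input_state w i))(0 := (bt (input_state w i) 0)(vl (input_state w i) 0 := True))\<rparr>"
        using True by (auto simp: s1_def input_state_def fun_eq_iff less_Suc_eq)
      then have "pruns (pon (b + 0) (set_sym True)) (?lay i (input_state w i)) 1 (?lay i s1)"
        using pruns_set_var[of 0 m "itape w (int i) # rest" True post D "input_state w i" tmp] assms(1) b by simp
      moreover have "map read (?lay i (input_state w i)) ! 0 = 2"
        using True i by (simp add: read_itape bit_sym_def)
      ultimately show ?thesis by simp
    next
      case False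
      have "s1 = input_state w i"
        using False by (auto simp: s1_def input_state_def fun_eq_iff less_Suc_eq)
      moreover have "map read (?lay i (input_state w i)) ! 0 \<noteq> 2"
        using False i by (simp add: read_itape bit_sym_def)
      ultimately show ?thesis
        using pruns_Do[of keep "?lay i (input_state w i)"] by simp
    qed
  qed simp
  have 2: "pruns (pon (b + 0) inc_sym) (?lay i s1) 1 (?lay i ?s2)"
    unfolding b by (rule pruns_inc_var) (use assms(1) in simp)
  have 3: "pruns (pon (b + 1) inc_sym) (?lay i ?s2) 1 (?lay i (input_state w (Suc i)))"
    unfolding b s3[symmetric] by (rule pruns_inc_var) (use assms(1) in simp)
  have 4: "pruns (pon 0 inc_sym) (?lay i (input_state w (Suc i))) 1 (?lay (Suc i) (input_state w (Suc i)))"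
    by (rule pruns_on_head) (simp add: algebra_simps)
  have 5: "pruns (copy_prog b) (?lay (Suc i) (input_state w (Suc i))) (20 * (length w - Suc i) + 1) (?lay (length w) (input_st w))"
    by (rule Suc.hyps(1)) (use Suc.hyps(2) i in simp_all)
  show ?case
    unfolding copy_prog_def
  proof (rule pruns_While_step[OF _ pruns_Seq[OF 1 pruns_Seq[OF 2 pruns_Seq[OF 3 4 order.refl] order.refl] order.refl] 5[unfolded copy_prog_def]])
    show "map read (?lay i (input_state w i)) ! 0 \<noteq> 0"
      using i by (simp add: read_itape bit_sym_def)
    show "Suc (Suc (2 + Suc (1 + Suc (1 + 1))) + (20 * (length w - Suc i) + 1)) \<le> 20 * (length w - i) + 1"
      using i by simp
  qed
qed

lemma pruns_rewind_loop:
  assumes "i \<le> length w"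
  shows "pruns (PWhile (\<lambda>ss. ss ! 0 \<noteq> 0) (pon 0 left_sym)) (layout (itape w (int i - 1) # rest) post m D s tmp)
    (2 * i + 1) (layout (itape w (- 1) # rest) post m D s tmp)"
  using assms
proof (induction i)
  case 0
  then show ?case
    using pruns_While_end[of "\<lambda>ss. ss ! 0 \<noteq> 0" "layout (itape w (- 1) # rest) post m D s tmp"]
    by (simp add: read_itape)
next
  case (Suc i)
  have 1: "pruns (pon 0 left_sym) (layout (itape w (int i) # rest) post m D s tmp) 1 (layout (itape w (int i - 1) # rest) post m D s tmp)"
    by (rule pruns_on_head) simp
  have 2: "int (Suc i) - 1 = int i" by simp
  show ?case
    unfolding 2
  proof (rule pruns_While_step[OF _ 1])
    show "map read (layout (itape w (int i) # rest) post m D s tmp) ! 0 \<noteq> 0"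
      using Suc.prems by (simp add: read_itape bit_sym_def)
    show "pruns (PWhile (\<lambda>ss. ss ! 0 \<noteq> 0) (pon 0 left_sym)) (layout (itape w (int i - 1) # rest) post m D s tmp)
      (2 * i + 1) (layout (itape w (- 1) # rest) post m D s tmp)"
      using Suc by simp
  qed simp
qed

lemma pruns_rewind:
  "pruns rewind_prog (layout (itape w (int (length w)) # rest) post m D s tmp) (2 * length w + 5)
    (layout (input_tape w # rest) post m D s tmp)"
proof -
  have 1: "pruns (pon 0 left_sym) (layout (itape w (int (length w)) # rest) post m D s tmp) 1
      (layout (itape w (int (length w) - 1) # rest) post m D s tmp)"
    by (rule pruns_on_head) simp
  have 2: "pruns (pon 0 inc_sym) (layout (itape w (- 1) # rest) post m D s tmp) 1 (layout (input_tape w # rest) post m D s tmp)"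
    by (rule pruns_on_head) (simp add: itape_0)
  show ?thesis
    unfolding rewind_prog_def
    by (rule pruns_Seq[OF 1 pruns_Seq[OF pruns_rewind_loop[OF order.refl] 2 order.refl]]) simp
qed

lemma pruns_loop_prog:
  assumes "fits m D 0 c" "2 \<le> m" "safe V c (input_st w)" "k = b + (m + D) + 1" "b \<ge> 1"
    and fin: "pruns fin (layout (input_tape w # replicate (b - 1) blank_tape) [blank_tape] m D (sem c (input_st w)) (\<lambda>_. 0)) T ts"
  shows "pruns (loop_prog b m D c fin) (input_tape w # replicate (k - 1) blank_tape)
    (22 * length w + time_bound c V + T + 20) ts"
proof -
  let ?rest = "replicate (b - 1) blank_tape"
  have b: "b = Suc (length ?rest)" "length (itape w (int 0) # ?rest) = b" "b = length (input_tape w # ?rest)"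
    using assms(5) by simp_all
  have init: "input_tape w # replicate (k - 1) blank_tape = (itape w (int 0) # ?rest) @ replicate (m + D) blank_tape @ [blank_tape]"
    using assms(4,5) by (simp add: itape_0 replicate_add[symmetric] replicate_append_same flip: replicate_Suc)
  have copy: "pruns (copy_prog b) (layout (itape w (int 0) # ?rest) [blank_tape] m D (input_state w 0) (\<lambda>_. 0))
      (20 * length w + 1) (layout (itape w (int (length w)) # ?rest) [blank_tape] m D (input_st w) (\<lambda>_. 0))"
    using pruns_copy[OF assms(2) b(1), of 0 w "[blank_tape]" D "\<lambda>_. 0"] by simp
  have comp: "pruns (compile b m 0 c) (layout (input_tape w # ?rest) [blank_tape] m D (input_st w) (\<lambda>_. 0))
      (time_bound c V) (layout (input_tape w # ?rest) [blank_tape] m D (sem c (input_st w)) (\<lambda>_. 0))"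
    by (rule compile_correct[OF assms(1,3) refl refl b(3)])
  show ?thesis
    unfolding loop_prog_def init
    by (rule pruns_Seq[OF pruns_mark[OF b(2)] pruns_Seq[OF copy
      pruns_Seq[OF pruns_rewind pruns_Seq[OF comp fin order.refl] order.refl] order.refl]]) simp
qed

lemma ok_loop_prog:
  assumes "fits m D 0 c" "2 \<le> m" "k = b + (m + D) + 1" "b \<ge> 1" "B \<ge> 4" "ok_prog k B fin"
  shows "ok_prog k B (loop_prog b m D c fin)"
proof -
  have 1: "ok_prog k B (mark_prog b (m + D) (b + (m + D) + 1))"
    unfolding mark_prog_def ok_prog.simps assms(3)[symmetric]
  proof (intro allI impI conjI)
    fix ss :: "nat list" assume ss: "length ss = k" "set ss \<subseteq> {..<B}"
    then have "ss ! i < B" if "i < k" for i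
      using that by (metis lessThan_iff nth_mem subsetD)
    then show "fst ` set (map (\<lambda>i. (if b \<le> i \<and> i < b + (m + D) then 2 else ss ! i, Stay)) [0..<k]) \<subseteq> {..<B}"
      using assms(5) by auto
  qed simp
  have 2: "ok_prog k B (copy_prog b)" "ok_prog k B rewind_prog"
    using assms(2-5) unfolding copy_prog_def rewind_prog_def
    by (auto simp: keep_def inc_sym_def left_sym_def set_sym_def intro!: ok_on)
  have 3: "ok_prog k B (compile b m 0 c)"
    by (rule ok_compile[OF assms(1) _ assms(5)]) (simp add: assms(3))
  show ?thesis
    using 1 2 3 assms(6) by (simp add: loop_prog_def)
qed

section \<open>Running a given machine after a loop program\<close>

definition config_ok :: "'a tm_scheme \<Rightarrow> config \<Rightarrow> bool" where
  "config_ok M c \<longleftrightarrow> state c < num_states M \<and> length (tapes c) = num_tapes M \<and>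
     (\<forall>t\<in>set (tapes c). \<forall>i. cells t i < num_symbols M)"

lemma config_ok_init: "wf_tm M \<Longrightarrow> config_ok M (init M w)"
  by (auto simp: config_ok_def init_def wf_tm_def input_tape_def blank_tape_def bit_sym_def)

lemma config_ok_reads:
  assumes "config_ok M c"
  shows "length (map read (tapes c)) = num_tapes M" "set (map read (tapes c)) \<subseteq> {..<num_symbols M}"
  using assms by (auto simp: config_ok_def read_def)

lemma cells_act: "cells (act a t) i = (if i = head t then fst a else cells t i)"
  by (cases t; cases a) simp

text \<open>\<open>wf_tm\<close> constrains \<open>delta\<close> only on states and symbols of the
  machine, so its use along a run requires that the run never leaves them.\<close>

lemma config_ok_step:
  assumes "wf_tm M" "config_ok M c"
  shows "config_ok M (step M c)"
proof (cases "halted M c")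
  case False
  obtain q as where d: "delta M (state c) (map read (tapes c)) = (q, as)"
    by fastforce
  have q: "q < num_states M" "length as = num_tapes M" "fst ` set as \<subseteq> {..<num_symbols M}"
    using assms(1)[unfolded wf_tm_def] assms(2) config_ok_reads[OF assms(2)] d unfolding config_ok_def by blast+
  have "cells t i < num_symbols M" if t: "t \<in> set (map2 act as (tapes c))" for t i
  proof -
    obtain l where l: "l < length as" "l < length (tapes c)" "t = act (as ! l) (tapes c ! l)"
      using t unfolding in_set_conv_nth by auto
    then have "fst (as ! l) \<in> {..<num_symbols M}" "cells (tapes c ! l) i < num_symbols M"
      using subsetD[OF q(3) imageI[OF nth_mem]] assms(2) nth_mem[OF l(2)] by (auto simp: config_ok_def)
    then show ?thesis
      by (simp add: l(3) cells_act)
  qed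
  then show ?thesis
    using False d q assms(2) by (simp add: step_def config_ok_def)
qed (use assms in \<open>simp add: step_def\<close>)

definition stape :: "nat \<Rightarrow> tape" where
  "stape q = Tape ((\<lambda>_. 0)(0 := q)) 0"

lemma stape [simp]: "read (stape q) = q" "act (q, Stay) (stape q') = stape q" "act (q, Stay) blank_tape = stape q"
  by (simp_all add: stape_def read_def blank_tape_def)

text \<open>A machine \<open>M\<close> is run by a program that keeps the state of \<open>M\<close> as a symbol on its last tape.
  Symbols that are none of \<open>M\<close> do not occur there; the case distinction only keeps the program
  well-formed, since \<open>delta M\<close> is arbitrary on them.\<close>

definition tm_step_acts :: "tm \<Rightarrow> nat list \<Rightarrow> (nat \<times> move) list" where
  "tm_step_acts M ss =
     (let q = last ss; rs = take (num_tapes M) ss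
      in if q < num_states M \<and> set rs \<subseteq> {..<num_symbols M}
         then (case delta M q rs of (q', as) \<Rightarrow>
           as @ keep (drop (num_tapes M) (butlast ss)) @ [(q', Stay)])
         else keep ss)"

definition run_prog :: "tm \<Rightarrow> prog" where
  "run_prog M = PWhile (\<lambda>ss. last ss \<noteq> accept M \<and> last ss \<noteq> reject M) (PDo (tm_step_acts M))"

text \<open>Each step of \<open>M\<close> costs a loop test and an action. A halted machine stays
  put under \<open>step\<close>, so \<open>t\<close> may exceed the halting time.\<close>

lemma pruns_run_prog:
  assumes "wf_tm M" "config_ok M c" "halted M ((step M ^^ t) c)"
  shows "pruns (run_prog M) (tapes c @ mid @ [stape (state c)]) (2 * t + 1)
    (tapes ((step M ^^ t) c) @ mid @ [stape (state ((step M ^^ t) c))])"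
  using assms(2,3)
proof (induction t arbitrary: c)
  case 0
  then show ?case
    using pruns_While_end[of "\<lambda>ss. last ss \<noteq> accept M \<and> last ss \<noteq> reject M"]
    by (auto simp: run_prog_def halted_def)
next
  case (Suc t)
  have eq: "(step M ^^ Suc t) c = (step M ^^ t) (step M c)"
    by (simp only: funpow_Suc_right o_apply)
  show ?case
  proof (cases "halted M c")
    case True
    then have "step M c = c"
      by (simp add: step_def)
    then show ?thesis
      unfolding eq using Suc.IH[of c] Suc.prems eq by (auto intro: pruns_mono)
  next
    case False
    obtain q as where d: "delta M (state c) (map read (tapes c)) = (q, as)"
      by fastforce
    have as: "length as = length (tapes c)"
      using assms(1)[unfolded wf_tm_def] Suc.prems(1) config_ok_reads[OF Suc.prems(1)] d
      unfolding config_ok_def by metis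
    have s: "step M c = \<lparr>state = q, tapes = map2 act as (tapes c)\<rparr>"
      using False d by (simp add: step_def)
    have n: "num_tapes M = length (tapes c)"
      using Suc.prems(1) by (simp add: config_ok_def)
    have acts: "tm_step_acts M (map read (tapes c @ mid @ [stape (state c)])) = as @ keep (map read mid) @ [(q, Stay)]"
      using Suc.prems(1) config_ok_reads[OF Suc.prems(1)] d
      by (simp add: tm_step_acts_def butlast_append n config_ok_def)
    have "pruns (PDo (tm_step_acts M)) (tapes c @ mid @ [stape (state c)]) 1
      (map2 act as (tapes c) @ mid @ [stape q])"
      by (rule pruns_Do, unfold acts) (simp add: as zip_append1)
    then have 1: "pruns (PDo (tm_step_acts M)) (tapes c @ mid @ [stape (state c)]) 1
      (tapes (step M c) @ mid @ [stape (state (step M c))])"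
      by (simp add: s)
    have 2: "pruns (run_prog M) (tapes (step M c) @ mid @ [stape (state (step M c))]) (2 * t + 1)
      (tapes ((step M ^^ t) (step M c)) @ mid @ [stape (state ((step M ^^ t) (step M c)))])"
      using Suc.IH[of "step M c"] Suc.prems config_ok_step[OF assms(1)] eq by simp
    show ?thesis
      unfolding run_prog_def eq
    proof (rule pruns_While_step[OF _ 1 2[unfolded run_prog_def]])
      show "last (map read (tapes c @ mid @ [stape (state c)])) \<noteq> accept M \<and>
        last (map read (tapes c @ mid @ [stape (state c)])) \<noteq> reject M"
        using False by (simp add: halted_def)
    qed simp
  qed
qed

lemma ok_run_prog:
  assumes "wf_tm M" "num_tapes M < k" "num_symbols M \<le> B" "num_states M \<le> B"
  shows "ok_prog k B (run_prog M)"
  unfolding run_prog_def ok_prog.simps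
proof (intro allI impI)
  fix ss :: "nat list"
  assume ss: "length ss = k" "set ss \<subseteq> {..<B}"
  let ?rs = "take (num_tapes M) ss"
  show "length (tm_step_acts M ss) = k \<and> fst ` set (tm_step_acts M ss) \<subseteq> {..<B}"
  proof (cases "last ss < num_states M \<and> set ?rs \<subseteq> {..<num_symbols M}")
    case True
    obtain q as where d: "delta M (last ss) ?rs = (q, as)"
      by fastforce
    have "length ?rs = num_tapes M"
      using ss(1) assms(2) by simp
    then have q: "q < num_states M" "length as = num_tapes M" "fst ` set as \<subseteq> {..<num_symbols M}"
      using assms(1)[unfolded wf_tm_def] True d by blast+
    have "set (drop (num_tapes M) (butlast ss)) \<subseteq> {..<B}"
      using ss(2) by (meson in_set_butlastD in_set_dropD subset_code(1))
    moreover have "{..<num_symbols M} \<subseteq> {..<B}" "q \<in> {..<B}"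
      using assms(3,4) q(1) by auto
    moreover have "fst ` set as \<subseteq> {..<B}"
      using order_trans[OF q(3)] assms(3) by simp
    ultimately have "fst ` set (as @ keep (drop (num_tapes M) (butlast ss)) @ [(q, Stay)]) \<subseteq> {..<B}"
      by (simp add: keep_def image_Un image_image)
    then show ?thesis
      using True d q(2) ss(1) assms(2) by (simp add: tm_step_acts_def)
  next
    case False
    then have "tm_step_acts M ss = keep ss"
      by (simp only: tm_step_acts_def Let_def if_False)
    then show ?thesis
      using ss by (simp add: keep_def image_image)
  qed
qed

text \<open>The loop program acts as a filter: \<open>M\<close> is started only if variable
  \<open>R\<close> ends at 0. Both the three parts of \<open>S\<close> and the diagonal language are
  obtained from this one construction.\<close>

theorem intersection_machine:
  assumes S: "wf_tm M" "decides_within M S T"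
    and safe: "\<And>w. safe (V (length w)) c (input_st w)"
  obtains M' :: tm where "wf_tm M'" "decides_within M' {w \<in> S. vl (sem c (input_st w)) R = 0}
      (\<lambda>n. 22 * n + time_bound c (V n) + 2 * T n + 30)"
proof -
  obtain m0 D where "fits m0 D 0 c"
    using ex_fits by blast
  then have fits: "fits (max m0 (R + 2)) D 0 c"
    by (rule fits_mono) auto
  define m where "m = max m0 (R + 2)"
  define b where "b = num_tapes M"
  define k where "k = b + (m + D) + 1"
  \<comment> \<open>Variable tapes use the symbols 0 to 3, and the states of \<open>M\<close> appear
    as symbols on the last tape.\<close>
  define B where "B = max 4 (max (num_symbols M) (num_states M))"
  \<comment> \<open>If the filter fails, \<open>reject M\<close> is put where
    \<open>run_prog\<close> would leave the final state, so one look at the last tape gives the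
    verdict in both cases.\<close>
  define fin where "fin = PIf (tz (b + R))
    (PSeq (pon (k - 1) (\<lambda>_. (start M, Stay))) (run_prog M)) (pon (k - 1) (\<lambda>_. (reject M, Stay)))"
  let ?p = "loop_prog b m D c fin"
  let ?M = "tm_of k B ?p (\<lambda>ss. last ss = accept M)"
  have m: "2 \<le> m" "R < m" and fits': "fits m D 0 c"
    using fits by (auto simp: m_def)
  have b: "1 \<le> b"
    using S(1) by (simp add: b_def wf_tm_def)
  have st: "start M < num_states M" "reject M < num_states M" "accept M \<noteq> reject M"
    using S(1) by (simp_all add: wf_tm_def)
  have "ok_prog k B fin"
    using st by (auto simp: fin_def k_def b_def B_def intro!: ok_on ok_run_prog S(1))
  then have wf: "wf_tm ?M"
    by (intro wf_tm_of ok_loop_prog[OF fits' m(1) k_def b]) (auto simp: k_def B_def)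
  have "\<exists>t\<le>22 * length w + time_bound c (V (length w)) + 2 * T (length w) + 30.
      state (run ?M w t) = (if w \<in> {w \<in> S. vl (sem c (input_st w)) R = 0} then accept ?M else reject ?M)" for w
  proof -
    let ?s = "sem c (input_st w)"
    let ?pre = "input_tape w # replicate (b - 1) blank_tape"
    let ?mid = "map (var_tape m ?s (\<lambda>_. 0)) [0..<m + D]"
    let ?lay = "layout ?pre [blank_tape] m D ?s (\<lambda>_. 0)"
    have pre: "length ?pre = b"
      using b by simp
    have lay: "?lay = ?pre @ ?mid @ [blank_tape]"
      by (simp add: layout_def)
    have len: "k - 1 = length (?pre @ ?mid)"
      using pre by (simp add: k_def)
    have upd: "?lay[k - 1 := stape q] = ?pre @ ?mid @ [stape q]" for q
      unfolding lay len using list_update_length[of "?pre @ ?mid" blank_tape "[]" "stape q"]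
      by (simp only: append_assoc)
    have nth: "?lay ! (k - 1) = blank_tape"
      unfolding lay len using nth_append_length[of "?pre @ ?mid" blank_tape "[]"]
      by (simp only: append_assoc)
    have on: "pruns (pon (k - 1) (\<lambda>_. (q, Stay))) ?lay 1 (?pre @ ?mid @ [stape q])" for q
    proof (rule pruns_on)
      show "k - 1 < length ?lay"
        unfolding lay len by simp
    qed (simp only: upd nth stape)
    have tz: "tz (b + R) (map read ?lay) \<longleftrightarrow> vl ?s R = 0"
      using tz_layout[of R m D ?pre] m pre by simp
    obtain t0 where t0: "t0 \<le> T (length w)" "state (run M w t0) = (if w \<in> S then accept M else reject M)"
      using S(2) unfolding decides_within_def by blast
    have init: "init M w = \<lparr>state = start M, tapes = ?pre\<rparr>"
      by (simp add: init_def b_def)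
    have "\<exists>ts. pruns fin ?lay (2 * T (length w) + 5) ts \<and>
        (last (map read ts) = accept M \<longleftrightarrow> w \<in> S \<and> vl ?s R = 0)"
    proof (cases "vl ?s R = 0")
      case True
      have "halted M ((step M ^^ t0) (init M w))"
        using t0(2) by (auto simp: halted_def run_def split: if_splits)
      from pruns_run_prog[OF S(1) config_ok_init[OF S(1)] this, of ?mid]
      have "pruns (run_prog M) (?pre @ ?mid @ [stape (start M)]) (2 * t0 + 1)
          (tapes (run M w t0) @ ?mid @ [stape (state (run M w t0))])"
        by (simp add: init k_def b_def run_def)
      note * = pruns_Seq[OF on this order.refl]
      have "pruns fin ?lay (2 * T (length w) + 5) (tapes (run M w t0) @ ?mid @ [stape (state (run M w t0))])"
        unfolding fin_def
        by (rule pruns_If[where A = "Suc (1 + (2 * t0 + 1))"], subst if_P) (use True tz t0(1) * in simp_all)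
      then show ?thesis
        using t0(2) True st(3) by (intro exI conjI) (assumption, simp)
    next
      case False
      have "pruns fin ?lay (2 * T (length w) + 5) (?pre @ ?mid @ [stape (reject M)])"
        unfolding fin_def
        by (intro pruns_If[where A = 1]) (use False tz on in auto)
      then show ?thesis
        using False st(3) by (intro exI conjI) (assumption, simp)
    qed
    then obtain ts where ts: "pruns fin ?lay (2 * T (length w) + 5) ts"
        "last (map read ts) = accept M \<longleftrightarrow> w \<in> S \<and> vl ?s R = 0"
      by blast
    obtain t where t: "t \<le> 22 * length w + time_bound c (V (length w)) + (2 * T (length w) + 5) + 20"
        "pexec ?p (input_tape w # replicate (k - 1) blank_tape) t ts"
      using pruns_loop_prog[OF fits' m(1) safe k_def b ts(1)] unfolding pruns_def by blast
    show ?thesis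
      using run_tm_of[OF t(2), of B "\<lambda>ss. last ss = accept M"] t(1) ts(2) by (intro exI[of _ "Suc t"]) auto
  qed
  then have "decides_within ?M {w \<in> S. vl (sem c (input_st w)) R = 0}
      (\<lambda>n. 22 * n + time_bound c (V n) + 2 * T n + 30)"
    unfolding decides_within_def by blast
  then show thesis
    using that wf by blast
qed

text \<open>Symbols 1 and 2 stand for the bits 0 and 1; the branches write 0, 1 and 10, the binary
  forms of the three possible values.\<close>

definition out_prog :: "nat \<Rightarrow> nat \<Rightarrow> prog" where
  "out_prog r p = PIf (tz r) (pon p (\<lambda>_. (1, Stay)))
     (PSeq (pon r dec_sym) (PIf (tz r) (pon p (\<lambda>_. (2, Stay)))
       (PSeq (pon p (\<lambda>_. (2, Go_Right))) (pon p (\<lambda>_. (1, Stay))))))"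

lemma tape_string_stape:
  "tape_string (stape 1) = bin 0" "tape_string (stape 2) = bin 1"
  "tape_string (act (1, Stay) (act (2, Go_Right) blank_tape)) = bin 2"
proof -
  have 1: "(LEAST n. cells (stape q) (int n) \<notin> range bit_sym) = 1" if "q \<in> {1, 2}" for q
    using that by (intro Least_equality) (auto simp: stape_def bit_sym_def image_iff split: if_splits intro: Suc_leI)
  have 2: "(LEAST n. cells (stape 1) (int n) \<notin> range bit_sym) = 1" "(LEAST n. cells (stape 2) (int n) \<notin> range bit_sym) = 1"
    by (rule 1, simp)+
  show "tape_string (stape 1) = bin 0" "tape_string (stape 2) = bin 1"
    unfolding tape_string_def 2 by (simp_all add: stape_def bit_sym_def bin.simps[of 0] bin.simps[of "Suc 0"])
  let ?t = "act (1, Stay) (act (2, Go_Right) blank_tape)"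
  have 3: "(LEAST n. cells ?t (int n) \<notin> range bit_sym) = 2"
    by (intro Least_equality) (auto simp: blank_tape_def bit_sym_def image_iff split: if_splits)
  show "tape_string ?t = bin 2"
    unfolding tape_string_def 3
    by (simp add: blank_tape_def bit_sym_def bin.simps[of 2] bin.simps[of "Suc 0"] upt_rec[of _ 2])
qed

theorem output_machine:
  assumes "\<And>w. vl (sem c (input_st w)) R < 3"
  obtains M :: tm and T :: "nat poly" where "wf_tm M"
    "\<And>w V. safe V c (input_st w) \<Longrightarrow>
      outputs_within M w (bin (vl (sem c (input_st w)) R)) (22 * length w + poly T V + 40)"
proof -
  obtain m0 D where "fits m0 D 0 c"
    using ex_fits by blast
  then have fits: "fits (max m0 (R + 2)) D 0 c"
    by (rule fits_mono) auto
  define m where "m = max m0 (R + 2)"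
  define k where "k = 1 + (m + D) + 1"
  define fin where "fin = out_prog (1 + R) (k - 1)"
  let ?p = "loop_prog 1 m D c fin"
  let ?M = "tm_of k 4 ?p (\<lambda>_. True)"
  have m: "2 \<le> m" "R < m" and fits': "fits m D 0 c"
    using fits by (auto simp: m_def)
  have "ok_prog k 4 fin"
    using m by (auto simp: fin_def out_prog_def k_def dec_sym_def intro!: ok_on)
  then have wf: "wf_tm ?M"
    by (intro wf_tm_of ok_loop_prog[OF fits' m(1) k_def]) (auto simp: k_def)
  have out: "outputs_within ?M w (bin (vl (sem c (input_st w)) R)) (22 * length w + time_bound c V + 40)"
    if safe: "safe V c (input_st w)" for w V
  proof -
    let ?s = "sem c (input_st w)"
    let ?pre = "[input_tape w]"
    let ?lay = "\<lambda>t s. layout ?pre [t] m D s (\<lambda>_. 0)"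
    have on: "pruns (pon (k - 1) (\<lambda>_. a)) (?lay t s) 1 (?lay (act a t) s)" for a t s
      by (rule pruns_on) (simp_all add: k_def layout_def nth_append list_update_append)
    have tz: "tz (1 + R) (map read (?lay t s)) \<longleftrightarrow> vl s R = 0" for t s
      using tz_layout[of R m D ?pre] m by simp
    have dec: "pruns (pon (1 + R) dec_sym) (?lay t s) 1 (?lay t (s\<lparr>vl := (vl s)(R := vl s R - 1)\<rparr>))" for t s
      using pruns_dec_var[of R m ?pre "[t]" D s] m by simp
    let ?tail = "PIf (tz (1 + R)) (pon (k - 1) (\<lambda>_. (2, Stay)))
        (PSeq (pon (k - 1) (\<lambda>_. (2, Go_Right))) (pon (k - 1) (\<lambda>_. (1, Stay))))"
    have "\<exists>t s. pruns fin (?lay blank_tape ?s) 10 (?lay t s) \<and> tape_string t = bin (vl ?s R)"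
    proof -
      consider "vl ?s R = 0" | "vl ?s R = 1" | "vl ?s R = 2"
        using assms[of w] by linarith
      then show ?thesis
      proof cases
        case 1
        have "pruns fin (?lay blank_tape ?s) 10 (?lay (stape 1) ?s)"
          unfolding fin_def out_prog_def
          by (rule pruns_If[where A = 1]) (use 1 on[of "(1, Stay)" blank_tape] tz in auto)
        then show ?thesis
          using 1 tape_string_stape(1) by auto
      next
        case 2
        let ?s' = "?s\<lparr>vl := (vl ?s)(R := vl ?s R - 1)\<rparr>"
        have "pruns ?tail (?lay blank_tape ?s') 2 (?lay (stape 2) ?s')"
          by (rule pruns_If[where A = 1]) (use 2 on[of "(2, Stay)" blank_tape] tz in auto)
        note * = pruns_Seq[OF dec this order.refl]
        have "pruns fin (?lay blank_tape ?s) 10 (?lay (stape 2) ?s')"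
          unfolding fin_def out_prog_def
          by (rule pruns_If[OF pruns_mono]) (use 2 tz * in auto)
        then show ?thesis
          using 2 tape_string_stape(2) by auto
      next
        case 3
        let ?s' = "?s\<lparr>vl := (vl ?s)(R := vl ?s R - 1)\<rparr>"
        let ?t = "act (1, Stay) (act (2, Go_Right) blank_tape)"
        have "pruns ?tail (?lay blank_tape ?s') 4 (?lay ?t ?s')"
          by (rule pruns_If[where A = "Suc (1 + 1)"])
            (use 3 pruns_Seq[OF on[of "(2, Go_Right)" blank_tape ?s'] on[of "(1, Stay)" _ ?s'] order.refl] tz in auto)
        note * = pruns_Seq[OF dec this order.refl]
        have "pruns fin (?lay blank_tape ?s) 10 (?lay ?t ?s')"
          unfolding fin_def out_prog_def
          by (rule pruns_If[OF pruns_mono]) (use 3 tz * in auto)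
        then show ?thesis
          using 3 tape_string_stape(3) by auto
      qed
    qed
    then obtain t s where ts: "pruns fin (?lay blank_tape ?s) 10 (?lay t s)" "tape_string t = bin (vl ?s R)"
      by blast
    have "pruns ?p (input_tape w # replicate (k - 1) blank_tape) (22 * length w + time_bound c V + 10 + 20) (?lay t s)"
      by (rule pruns_loop_prog[OF fits' m(1) safe k_def order.refl]) (use ts(1) in simp)
    then obtain t' where t': "t' \<le> 22 * length w + time_bound c V + 10 + 20"
        "pexec ?p (input_tape w # replicate (k - 1) blank_tape) t' (?lay t s)"
      unfolding pruns_def by blast
    have "run ?M w (Suc t') = \<lparr>state = accept ?M, tapes = ?lay t s\<rparr>"
      using run_tm_of[OF t'(2), of 4 "\<lambda>_. True"] by simp
    moreover have "last (?lay t s) = t"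
      by (simp add: layout_def)
    ultimately have "halted ?M (run ?M w (Suc t')) \<and> tape_string (last (tapes (run ?M w (Suc t')))) = bin (vl ?s R)"
      using ts(2) by (simp add: halted_def)
    moreover have "Suc t' \<le> 22 * length w + time_bound c V + 40"
      using t'(1) by simp
    ultimately show ?thesis
      unfolding outputs_within_def by blast
  qed
  obtain T :: "nat poly" where T: "\<And>V. time_bound c V = poly T V"
    using time_bound_poly by blast
  show thesis
    by (rule that[OF wf out[unfolded T]])
qed

section \<open>Arithmetic and arrays in loop programs\<close>

text \<open>Safety of a round refers to the state left by the earlier rounds, so safety and
  invariant are carried together.\<close>

lemma For_inv:
  assumes "I 0 s" "vl s v = n" "n \<le> V"
    and step: "\<And>i t. i < n \<Longrightarrow> I i t \<Longrightarrow> safe V c t \<and> I (Suc i) (sem c t)"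
  shows "safe V (For v c) s \<and> I n (sem (For v c) s)"
proof -
  have "I i ((sem c ^^ i) s)" if "i \<le> n" for i
    using that
  proof (induction i)
    case (Suc i)
    then show ?case using step[of i "(sem c ^^ i) s"] by simp
  qed (simp add: assms(1))
  then show ?thesis
    using assms(2,3) step by simp
qed

definition Zero :: "nat \<Rightarrow> com" where
  "Zero v = For v (Dec v)"

lemma dec_funpow: "(sem (Dec v) ^^ n) s = s\<lparr>vl := (vl s)(v := vl s v - n)\<rparr>"
  by (induction n) (simp_all add: fun_upd_same del: fun_upd_apply)

lemma inc_funpow: "(sem (Inc v) ^^ n) s = s\<lparr>vl := (vl s)(v := vl s v + n)\<rparr>"
  by (induction n) (simp_all add: fun_upd_same del: fun_upd_apply)

lemma sem_Zero [simp]: "sem (Zero v) s = s\<lparr>vl := (vl s)(v := 0)\<rparr>"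
  by (simp add: Zero_def dec_funpow del: sem.simps(3))

lemma safe_Zero [simp]: "safe V (Zero v) s \<longleftrightarrow> vl s v \<le> V"
  by (simp add: Zero_def)

definition AddR :: "nat \<Rightarrow> nat \<Rightarrow> com" where
  "AddR x y = For y (Inc x)"

lemma sem_AddR [simp]: "sem (AddR x y) s = s\<lparr>vl := (vl s)(x := vl s x + vl s y)\<rparr>"
  by (simp add: AddR_def inc_funpow del: sem.simps(2))

lemma safe_AddR [simp]: "safe V (AddR x y) s \<longleftrightarrow> vl s y \<le> V"
  by (simp add: AddR_def)

definition SubR :: "nat \<Rightarrow> nat \<Rightarrow> com" where
  "SubR x y = For y (Dec x)"

lemma sem_SubR [simp]: "sem (SubR x y) s = s\<lparr>vl := (vl s)(x := vl s x - vl s y)\<rparr>"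
  by (simp add: SubR_def dec_funpow del: sem.simps(3))

lemma safe_SubR [simp]: "safe V (SubR x y) s \<longleftrightarrow> vl s y \<le> V"
  by (simp add: SubR_def)

definition Mov :: "nat \<Rightarrow> nat \<Rightarrow> com" where
  "Mov x y = Zero x ;; AddR x y"

lemma sem_Mov [simp]: "x \<noteq> y \<Longrightarrow> sem (Mov x y) s = s\<lparr>vl := (vl s)(x := vl s y)\<rparr>"
  by (simp add: Mov_def)

lemma safe_Mov [simp]: "x \<noteq> y \<Longrightarrow> safe V (Mov x y) s \<longleftrightarrow> vl s x \<le> V \<and> vl s y \<le> V"
  by (simp add: Mov_def)

definition MulAdd :: "nat \<Rightarrow> nat \<Rightarrow> nat \<Rightarrow> com" where
  "MulAdd x y z = For y (AddR x z)"

lemma addr_funpow: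
  "x \<noteq> z \<Longrightarrow> (sem (AddR x z) ^^ n) s = s\<lparr>vl := (vl s)(x := vl s x + n * vl s z)\<rparr>"
  by (induction n) (simp_all add: fun_upd_same fun_upd_other add_ac del: fun_upd_apply)

lemma sem_MulAdd [simp]:
  "x \<noteq> z \<Longrightarrow> sem (MulAdd x y z) s = s\<lparr>vl := (vl s)(x := vl s x + vl s y * vl s z)\<rparr>"
  by (simp add: MulAdd_def addr_funpow del: sem_AddR)

lemma safe_MulAdd [simp]:
  "x \<noteq> z \<Longrightarrow> safe V (MulAdd x y z) s \<longleftrightarrow> vl s y \<le> V \<and> (0 < vl s y \<longrightarrow> vl s z \<le> V)"
  by (auto simp: MulAdd_def addr_funpow simp del: sem_AddR)

primrec Incs :: "nat \<Rightarrow> nat \<Rightarrow> com" where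
  "Incs 0 v = Nop"
| "Incs (Suc n) v = Inc v ;; Incs n v"

lemma sem_Incs [simp]: "sem (Incs n v) s = s\<lparr>vl := (vl s)(v := vl s v + n)\<rparr>"
  by (induction n arbitrary: s) simp_all

lemma safe_Incs [simp]: "safe V (Incs n v) s"
  by (induction n arbitrary: s) simp_all

text \<open>A bit array is read as an array of numbers at most \<open>w\<close>: entry \<open>i\<close> is the number of bits set
  in row \<open>i\<close>, the rows having width \<open>w\<close>.\<close>

definition arr :: "nat \<Rightarrow> (nat \<Rightarrow> bool) \<Rightarrow> nat \<Rightarrow> nat" where
  "arr w f i = card {u. u < w \<and> f (i * w + u)}"

lemma arr_le: "arr w f i \<le> w"
  unfolding arr_def using card_mono[of "{..<w}" "{u. u < w \<and> f (i * w + u)}"] by auto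

text \<open>The counter of \<open>a\<close> is the address into its own array; resetting it to 0
  keeps it bounded between accesses.\<close>

definition Get :: "nat \<Rightarrow> nat \<Rightarrow> nat \<Rightarrow> nat \<Rightarrow> com" where
  "Get x a i w = Zero a ;; MulAdd a i w ;; Zero x ;; For w (IfB a (Inc x) Nop ;; Inc a) ;; Zero a"

lemma card_Suc_filter: "card {u. u < Suc n \<and> P u} = card {u. u < n \<and> P u} + (if P n then 1 else 0)"
proof (cases "P n")
  case True
  then have "{u. u < Suc n \<and> P u} = insert n {u. u < n \<and> P u}"
    by (auto simp: less_Suc_eq)
  then show ?thesis
    using True by simp
next
  case False
  then have "{u. u < Suc n \<and> P u} = {u. u < n \<and> P u}"
    by (auto simp: less_Suc_eq)
  then show ?thesis
    using False by simp
qed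

lemma count_funpow:
  assumes "x \<noteq> a"
  shows "(sem (IfB a (Inc x) Nop ;; Inc a) ^^ n) s =
    s\<lparr>vl := (vl s)(x := vl s x + card {u. u < n \<and> bt s a (vl s a + u)}, a := vl s a + n)\<rparr>"
proof (induction n)
  case (Suc n)
  show ?case
    unfolding funpow.simps o_apply Suc card_Suc_filter
    using assms by (cases "bt s a (vl s a + n)")
      (simp_all add: fun_upd_same fun_upd_other fun_upd_twist del: fun_upd_apply)
qed simp

lemma sem_Get [simp]:
  assumes "x \<noteq> a" "i \<noteq> a" "w \<noteq> a" "x \<noteq> w"
  shows "sem (Get x a i w) s = s\<lparr>vl := (vl s)(x := arr (vl s w) (bt s a) (vl s i), a := 0)\<rparr>"
  unfolding Get_def sem.simps(5)[of "Zero a"] sem.simps(5)[of "MulAdd a i w"] sem.simps(5)[of "Zero x"]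
    sem.simps(5)[of "For w p" for p] sem.simps(8) count_funpow[OF assms(1)]
  using assms by (simp add: arr_def fun_upd_twist)

lemma safe_count: "safe V (IfB a (Inc x) Nop ;; Inc a) s"
  by simp

lemma safe_Get [simp]:
  assumes "x \<noteq> a" "i \<noteq> a" "w \<noteq> a" "x \<noteq> w"
  shows "safe V (Get x a i w) s \<longleftrightarrow>
    vl s a \<le> V \<and> vl s i \<le> V \<and> vl s x \<le> V \<and> vl s w \<le> V \<and> vl s i * vl s w + vl s w \<le> V"
  unfolding Get_def safe.simps(5)[of V "Zero a"] safe.simps(5)[of V "MulAdd a i w"] safe.simps(5)[of V "Zero x"]
    safe.simps(5)[of V "For w p" for p] safe.simps(8) sem.simps(8) count_funpow[OF assms(1)]
  using assms by (auto simp: safe_count)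

text \<open>\<open>t\<close> counts the bits still to be set. A value beyond the row width is cut
  off, and its excess remains in \<open>t\<close>.\<close>

definition Put :: "nat \<Rightarrow> nat \<Rightarrow> nat \<Rightarrow> nat \<Rightarrow> nat \<Rightarrow> com" where
  "Put a i x w t = Zero a ;; MulAdd a i w ;; Mov t x ;;
     For w (IfZ t (SetB a False) (SetB a True ;; Dec t) ;; Inc a) ;; Zero a"

definition putrow :: "nat \<Rightarrow> (nat \<Rightarrow> bool) \<Rightarrow> nat \<Rightarrow> nat \<Rightarrow> nat \<Rightarrow> bool" where
  "putrow w f b x u = (if b \<le> u \<and> u < b + w then u < b + x else f u)"

lemma upd_bt_vl: "(s :: st)\<lparr>bt := b, vl := v\<rparr> = s\<lparr>vl := v, bt := b\<rparr>"
  by simp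

lemma put_funpow:
  assumes "a \<noteq> t"
  shows "(sem (IfZ t (SetB a False) (SetB a True ;; Dec t) ;; Inc a) ^^ n) s =
    s\<lparr>vl := (vl s)(t := vl s t - n, a := vl s a + n),
      bt := (bt s)(a := putrow n (bt s a) (vl s a) (vl s t))\<rparr>"
proof (induction n)
  case 0
  have "putrow 0 f b x = f" for f b x
    by (auto simp: putrow_def fun_eq_iff)
  then show ?case by simp
next
  case (Suc n)
  have 1: "(putrow n f b x)(b + n := n < x) = putrow (Suc n) f b x" for f b x
    by (auto simp: putrow_def fun_eq_iff)
  show ?case
    unfolding funpow.simps o_apply Suc
    using assms 1[of "bt s a" "vl s a" "vl s t"]
    by (cases "vl s t \<le> n") (simp_all add: fun_upd_same fun_upd_other fun_upd_twist upd_bt_vl del: fun_upd_apply)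
qed

lemma sem_Put [simp]:
  assumes "a \<noteq> t" "i \<noteq> a" "w \<noteq> a" "x \<noteq> a" "t \<noteq> w" "t \<noteq> x"
  shows "sem (Put a i x w t) s = s\<lparr>vl := (vl s)(t := vl s x - vl s w, a := 0),
     bt := (bt s)(a := putrow (vl s w) (bt s a) (vl s i * vl s w) (vl s x))\<rparr>"
  unfolding Put_def sem.simps(5)[of "Zero a"] sem.simps(5)[of "MulAdd a i w"] sem.simps(5)[of "Mov t x"]
    sem.simps(5)[of "For w p" for p] sem.simps(8) put_funpow[OF assms(1)]
  using assms by (simp add: fun_upd_twist)

lemma safe_put: "safe V (IfZ t (SetB a False) (SetB a True ;; Dec t) ;; Inc a) s"
  by simp

lemma safe_Put [simp]:
  assumes "a \<noteq> t" "i \<noteq> a" "w \<noteq> a" "x \<noteq> a" "t \<noteq> w" "t \<noteq> x"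
  shows "safe V (Put a i x w t) s \<longleftrightarrow> vl s a \<le> V \<and> vl s i \<le> V \<and> vl s t \<le> V \<and> vl s x \<le> V \<and>
    vl s w \<le> V \<and> vl s i * vl s w + vl s w \<le> V"
  unfolding Put_def safe.simps(5)[of V "Zero a"] safe.simps(5)[of V "MulAdd a i w"] safe.simps(5)[of V "Mov t x"]
    safe.simps(5)[of V "For w p" for p] safe.simps(8) sem.simps(8) put_funpow[OF assms(1)]
  using assms by (auto simp: safe_put)

lemma arr_putrow [simp]: "arr w (putrow w f (i * w) x) = (arr w f)(i := min x w)"
proof
  fix j
  show "arr w (putrow w f (i * w) x) j = ((arr w f)(i := min x w)) j"
  proof (cases "j = i")
    case True
    have "{u. u < w \<and> putrow w f (i * w) x (i * w + u)} = {..<min x w}"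
      by (auto simp: putrow_def)
    then show ?thesis
      using True by (simp add: arr_def)
  next
    case False
    have "putrow w f (i * w) x (j * w + u) = f (j * w + u)" if "u < w" for u
    proof -
      have "\<not> (i * w \<le> j * w + u \<and> j * w + u < i * w + w)"
      proof
        assume *: "i * w \<le> j * w + u \<and> j * w + u < i * w + w"
        then have "i * w < Suc j * w" "j * w < Suc i * w"
          using that by (simp_all)
        then show False
          using False by (simp only: mult_less_cancel2) linarith
      qed
      then show ?thesis
        unfolding putrow_def by (rule if_not_P)
    qed
    then show ?thesis
      using False by (simp add: arr_def cong: conj_cong)
  qed
qed

section \<open>Counting iterated logarithms\<close>

lemma floor_log_less: "0 < n \<Longrightarrow> floor_log n < n"
  using less_le_trans[OF less_exp floor_log_exp2_le] by blast

lemma floor_log_le: "floor_log n \<le> n"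
  using floor_log_less[of n] by (cases "n = 0") auto

text \<open>This is \<open>r\<close>. Reduction modulo 3 at every level means that a program needs a
  counter with three values only.\<close>

function stage :: "nat \<Rightarrow> nat" where
  "stage n = (if n < 2 then 0 else (stage (floor_log (floor_log n)) + 1) mod 3)"
  by auto
termination
proof (relation "measure id")
  fix n :: nat assume "\<not> n < 2"
  then show "(floor_log (floor_log n), n) \<in> measure id"
    using floor_log_le[of "floor_log n"] floor_log_less[of n] by simp
qed simp

declare stage.simps [simp del]

text \<open>Variable 2 holds the argument and variable 7 the value.\<close>

definition log_com :: com where
  "log_com = Zero 3 ;; Zero 4 ;; Inc 4 ;;
     For 2 (Mov 5 4 ;; AddR 5 4 ;; Mov 6 5 ;; SubR 6 2 ;; IfZ 6 (Mov 4 5 ;; Inc 3) Nop) ;; Mov 2 3"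

definition inc3_com :: com where
  "inc3_com = IfZ 7 (Inc 7) (Dec 7 ;; IfZ 7 (Incs 2 7) (Zero 7))"

definition number_com :: com where
  "number_com = Zero 0 ;; For 1 (Mov 8 2 ;; AddR 2 8 ;; IfB 0 (Inc 2) Nop ;; Inc 0)"

definition stage_com :: com where
  "stage_com = For 2 (Mov 6 2 ;; Dec 6 ;; IfZ 6 Nop (log_com ;; log_com ;; inc3_com))"

lemma le_floor_log_iff: "0 < n \<Longrightarrow> k \<le> floor_log n \<longleftrightarrow> 2 ^ k \<le> n"
proof
  assume n: "0 < n" and "k \<le> floor_log n"
  then have "(2::nat) ^ k \<le> 2 ^ floor_log n"
    by (simp add: power_increasing)
  then show "2 ^ k \<le> n"
    using floor_log_exp2_le[OF n] by (rule order_trans)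
next
  assume "2 ^ k \<le> n"
  then show "k \<le> floor_log n"
    using floor_log_le_iff[of "2 ^ k" n] by simp
qed

text \<open>Clearing a variable is a loop over its value, so even scratch variables must be bounded
  to be \<open>safe\<close>.\<close>

definition stage_inv :: "nat \<Rightarrow> nat \<Rightarrow> nat \<Rightarrow> st \<Rightarrow> bool" where
  "stage_inv V n c s \<longleftrightarrow> vl s 2 = n \<and> vl s 7 = c \<and> vl s 3 \<le> V \<and> vl s 4 \<le> V \<and> vl s 5 \<le> V \<and> vl s 6 \<le> V"

lemma log_com:
  assumes "stage_inv V n c s" "2 * n + 2 \<le> V"
  shows "safe V log_com s \<and> stage_inv V (floor_log n) c (sem log_com s)"
proof -
  \<comment> \<open>Variable 4 is 2 to the power of variable 3. A round doubles it if the result is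
    at most \<open>n\<close>, which the truncated difference in variable 6 decides.\<close>
  define I where "I i t \<longleftrightarrow> vl t 2 = n \<and> vl t 7 = c \<and> vl t 3 = min i (floor_log n) \<and>
    vl t 4 = 2 ^ (min i (floor_log n)) \<and> vl t 5 \<le> V \<and> vl t 6 \<le> V" for i and t :: st
  let ?b = "Mov 5 4 ;; AddR 5 4 ;; Mov 6 5 ;; SubR 6 2 ;; IfZ 6 (Mov 4 5 ;; Inc 3) Nop"
  let ?s = "sem (Inc 4) (sem (Zero 4) (sem (Zero 3) s))"
  have "safe V (For 2 ?b) ?s \<and> I n (sem (For 2 ?b) ?s)"
  proof (rule For_inv)
    show "I 0 ?s" "vl ?s 2 = n" "n \<le> V"
      using assms by (simp_all add: I_def stage_inv_def)
    fix i t assume i: "i < n" and I: "I i t"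
    let ?m = "min i (floor_log n)"
    have n: "0 < n" using i by simp
    have p: "2 ^ ?m \<le> n"
      using le_floor_log_iff[OF n, of ?m] by simp
    have le: "2 * 2 ^ ?m \<le> n \<longleftrightarrow> Suc ?m \<le> floor_log n"
      using le_floor_log_iff[OF n, of "Suc ?m"] by simp
    show "safe V ?b t \<and> I (Suc i) (sem ?b t)"
    proof (cases "Suc ?m \<le> floor_log n")
      case True
      then have m: "?m = i" "min (Suc i) (floor_log n) = Suc i"
        by auto
      show ?thesis
        using I p assms(2) True le unfolding I_def m by simp
    next
      case False
      then have m: "?m = floor_log n" "min (Suc i) (floor_log n) = floor_log n"
        by auto
      show ?thesis
        using I p assms(2) False le unfolding I_def m by simp
    qed
  qed
  moreover have "min n (floor_log n) = floor_log n"
    using floor_log_less[of n] by (cases "n = 0") auto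
  moreover have "2 ^ floor_log n \<le> V"
    using floor_log_exp2_le[of n] assms(2) by (cases "n = 0") auto
  moreover have "floor_log n \<le> V"
    using floor_log_less[of n] assms(2) by (cases "n = 0") auto
  ultimately show ?thesis
    using assms unfolding log_com_def I_def stage_inv_def by simp
qed

lemma inc3_com:
  assumes "stage_inv V n c s" "c < 3" "3 \<le> V"
  shows "safe V inc3_com s \<and> stage_inv V n ((c + 1) mod 3) (sem inc3_com s)"
proof -
  consider "c = 0" | "c = 1" | "c = 2"
    using assms(2) by linarith
  then show ?thesis
    using assms by cases (simp_all add: inc3_com_def stage_inv_def)
qed

lemma stage_com:
  assumes "stage_inv V n 0 s" "2 * n + 3 \<le> V"
  shows "safe V stage_com s \<and> vl (sem stage_com s) 7 = stage n"
proof -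
  \<comment> \<open>A round lowers \<open>k\<close> by at least 1 as long as \<open>k\<close> is at
    least 2, so \<open>n\<close> rounds bring it to at most 1, where \<open>stage\<close> is 0 and
    the count \<open>c\<close> is the answer.\<close>
  define I where "I i t \<longleftrightarrow> (\<exists>k c. stage_inv V k c t \<and> k \<le> n \<and> c < 3 \<and> (c + stage k) mod 3 = stage n \<and>
    k \<le> n - i + 1)" for i t
  let ?b = "Mov 6 2 ;; Dec 6 ;; IfZ 6 Nop (log_com ;; log_com ;; inc3_com)"
  have stage3: "stage k < 3" for k
    by (subst stage.simps) simp
  have "safe V (For 2 ?b) s \<and> I n (sem (For 2 ?b) s)"
  proof (rule For_inv)
    show "I 0 s"
      using assms(1) stage3[of n] unfolding I_def by (intro exI[of _ n] exI[of _ 0]) simp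
    show "vl s 2 = n" "n \<le> V"
      using assms by (simp_all add: stage_inv_def)
    fix i t assume i: "i < n" and "I i t"
    then obtain k c where I: "stage_inv V k c t" "k \<le> n" "c < 3" "(c + stage k) mod 3 = stage n" "k \<le> n - i + 1"
      unfolding I_def by blast
    show "safe V ?b t \<and> I (Suc i) (sem ?b t)"
    proof (cases "k < 2")
      case True
      then have "stage_inv V k c (sem ?b t)"
        using I(1-3) assms(2) by (simp add: stage_inv_def)
      then have "I (Suc i) (sem ?b t)"
        unfolding I_def using I True by (intro exI[of _ k] exI[of _ c]) simp
      then show ?thesis
        using True I(1) assms(2) by (simp add: stage_inv_def)
    next
      case False
      let ?t = "sem (Dec 6) (sem (Mov 6 2) t)"
      let ?l = "floor_log k" and ?ll = "floor_log (floor_log k)" and ?c = "(c + 1) mod 3"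
      have k: "?l < k" "?ll \<le> ?l"
        using False floor_log_less[of k] floor_log_le[of ?l] by simp_all
      have t: "stage_inv V k c ?t" "vl ?t 6 \<noteq> 0"
        using I(1,2) False assms(2) by (simp_all add: stage_inv_def)
      have l: "safe V log_com ?t \<and> stage_inv V ?l c (sem log_com ?t)"
        by (rule log_com[OF t(1)]) (use I(2) assms(2) in simp)
      have ll: "safe V log_com (sem log_com ?t) \<and> stage_inv V ?ll c (sem log_com (sem log_com ?t))"
        by (rule log_com[OF conjunct2[OF l]]) (use k I(2) assms(2) in simp)
      have c: "safe V inc3_com (sem log_com (sem log_com ?t)) \<and> stage_inv V ?ll ?c (sem inc3_com (sem log_com (sem log_com ?t)))"
        by (rule inc3_com[OF conjunct2[OF ll] I(3)]) (use assms(2) in simp)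
      have sem: "sem ?b t = sem inc3_com (sem log_com (sem log_com ?t))"
        using t(2) by (simp only: sem.simps(5,6) if_False)
      have "stage k = (stage ?ll + 1) mod 3"
        using False by (subst stage.simps) simp
      then have "(?c + stage ?ll) mod 3 = stage n"
        using I(4) by presburger
      then have "I (Suc i) (sem ?b t)"
        unfolding I_def sem using c k I(2,5) i by (intro exI[of _ ?ll] exI[of _ ?c]) simp
      moreover have "safe V ?b t"
        using t(2) l ll c I(1,2) assms(2) unfolding safe.simps(5,6)
        by (simp only: if_False simp_thms) (simp add: stage_inv_def)
      ultimately show ?thesis by blast
    qed
  qed
  then have "safe V stage_com s" "I n (sem stage_com s)"
    unfolding stage_com_def by blast+
  then obtain k c where "stage_inv V k c (sem stage_com s)" "c < 3" "(c + stage k) mod 3 = stage n" "k \<le> 1"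
    unfolding I_def by auto
  moreover from this have "stage k = 0"
    by (subst stage.simps) simp
  ultimately show ?thesis
    using \<open>safe V stage_com s\<close> by (simp add: stage_inv_def)
qed

lemma stage_less: "stage n < 3"
  by (subst stage.simps) simp

section \<open>Binary input and the machines for \<open>r\<close> and for the parts\<close>

definition num :: "bool list \<Rightarrow> nat" where
  "num w = foldl (\<lambda>a b. 2 * a + of_bool b) 0 w"

lemma num_snoc: "num (w @ [b]) = 2 * num w + of_bool b"
  by (simp add: num_def)

lemma num_bin: "num (bin n) = n"
proof (induction n rule: bin.induct)
  case (1 n)
  show ?case
  proof (cases "n < 2")
    case True
    then show ?thesis
      by (subst bin.simps) (auto simp: num_def)
  next
    case False
    then have "num (bin n) = 2 * num (bin (n div 2)) + of_bool (odd n)"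
      by (subst bin.simps) (simp add: num_snoc)
    then show ?thesis
      using 1 False by simp
  qed
qed

lemma length_bin: "length (bin n) \<le> n + 1"
proof (induction n rule: bin.induct)
  case (1 n)
  show ?case
    by (subst bin.simps) (use 1 in auto)
qed

lemma num_take_le: "num (take i w) \<le> num w"
proof (induction w rule: rev_induct)
  case (snoc b w)
  then show ?case
    by (cases "i \<le> length w") (auto simp: num_snoc)
qed simp

lemma number_com:
  assumes "num w \<le> V" "length w \<le> V"
  shows "safe V number_com (input_st w) \<and> stage_inv V (num w) 0 (sem number_com (input_st w))"
proof -
  define I where "I i t \<longleftrightarrow> vl t 0 = i \<and> bt t 0 = bt (input_st w) 0 \<and> vl t 8 \<le> V \<and>
    stage_inv V (num (take i w)) 0 t" for i and t :: st
  let ?b = "Mov 8 2 ;; AddR 2 8 ;; IfB 0 (Inc 2) Nop ;; Inc 0"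
  let ?s = "sem (Zero 0) (input_st w)"
  have "safe V (For 1 ?b) ?s \<and> I (length w) (sem (For 1 ?b) ?s)"
  proof (rule For_inv)
    show "I 0 ?s" "vl ?s 1 = length w" "length w \<le> V"
      using assms by (simp_all add: I_def stage_inv_def num_def input_state_def)
    fix i t assume i: "i < length w" and I: "I i t"
    have "take (Suc i) w = take i w @ [w ! i]"
      using i by (rule take_Suc_conv_app_nth)
    then have "num (take (Suc i) w) = 2 * num (take i w) + of_bool (w ! i)"
      by (simp add: num_snoc)
    moreover have "num (take i w) \<le> V"
      using num_take_le[of i w] assms(1) by simp
    moreover have "bt t 0 i \<longleftrightarrow> w ! i"
      using I i by (simp add: I_def input_state_def)
    ultimately show "safe V ?b t \<and> I (Suc i) (sem ?b t)"
      using I by (cases "w ! i") (simp_all add: I_def stage_inv_def)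
  qed
  then show ?thesis
    using assms(2) unfolding number_com_def I_def by (simp add: input_state_def)
qed

definition r_com :: com where
  "r_com = number_com ;; stage_com"

lemma r_com:
  assumes "2 * num w + length w + 3 \<le> V"
  shows "safe V r_com (input_st w) \<and> vl (sem r_com (input_st w)) 7 = stage (num w)"
  using number_com[of w V] stage_com[of V "num w" "sem number_com (input_st w)"] assms
  by (simp add: r_com_def)

lemma stage_computable: "computable_in_time_poly_in_argument stage"
proof -
  have less: "vl (sem r_com (input_st w)) 7 < 3" for w
    using r_com[OF order.refl] stage_less by simp
  obtain M :: tm and T :: "nat poly" where M: "wf_tm M"
    "\<And>w V. safe V r_com (input_st w) \<Longrightarrow>
      outputs_within M w (bin (vl (sem r_com (input_st w)) 7)) (22 * length w + poly T V + 40)"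
    using output_machine[of r_com 7] less by blast
  \<comment> \<open>By \<open>length_bin\<close>, the linear part is at most 22 * (n + 1) + 40, and
    \<open>r_com\<close> needs a bound of at most 2 * n + (n + 1) + 3 = 3 * n + 4.\<close>
  define p where "p = [:62, 22:] + pcompose T [:4, 3:]"
  have "outputs_within M (bin n) (bin (stage n)) (poly p n)" for n
  proof -
    have "safe (3 * n + 4) r_com (input_st (bin n)) \<and> vl (sem r_com (input_st (bin n))) 7 = stage n"
      using r_com[of "bin n" "3 * n + 4"] length_bin[of n] by (simp add: num_bin)
    then have "outputs_within M (bin n) (bin (stage n)) (22 * length (bin n) + poly T (3 * n + 4) + 40)"
      using M(2)[of "3 * n + 4" "bin n"] by simp
    moreover have "22 * length (bin n) + poly T (3 * n + 4) + 40 \<le> poly p n"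
      using length_bin[of n] by (simp add: p_def poly_pcompose algebra_simps)
    ultimately show ?thesis
      unfolding outputs_within_def by (meson order_trans)
  qed
  then show ?thesis
    unfolding computable_in_time_poly_in_argument_def using M(1) by blast
qed

text \<open>The filter of \<open>intersection_machine\<close> tests for 0 only. A counter that is 0
  too early is set to 1, so it ends at 0 just for the value \<open>i\<close>.\<close>

primrec test_com :: "nat \<Rightarrow> com" where
  "test_com 0 = Nop"
| "test_com (Suc i) = IfZ 7 (Inc 7) (Dec 7 ;; test_com i)"

lemma test_com: "safe V (test_com i) s \<and> (vl (sem (test_com i) s) 7 = 0 \<longleftrightarrow> vl s 7 = i)"
  by (induction i arbitrary: s) auto

text \<open>The argument of \<open>stage\<close> is now the input length, present in variable 1 from
  the start, so nothing has to be decoded.\<close>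

definition part_com :: "nat \<Rightarrow> com" where
  "part_com i = Mov 2 1 ;; stage_com ;; test_com i"

lemma part_com:
  assumes "2 * length w + 3 \<le> V"
  shows "safe V (part_com i) (input_st w) \<and> (vl (sem (part_com i) (input_st w)) 7 = 0 \<longleftrightarrow> stage (length w) = i)"
proof -
  have "stage_inv V (length w) 0 (sem (Mov 2 1) (input_st w))"
    by (simp add: stage_inv_def input_state_def)
  from stage_com[OF this assms] show ?thesis
    using assms test_com unfolding part_com_def by (simp add: input_state_def)
qed

section \<open>Blocks of constant stage and gaps\<close>

fun tow :: "nat \<Rightarrow> nat" where
  "tow 0 = 2"
| "tow (Suc k) = 2 ^ 2 ^ tow k"

text \<open>Positivity of \<open>m\<close> matters: for l = 1 and m = 0 the left side holds and the
  right side fails.\<close>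

lemma loglog_le_iff:
  assumes "0 < l" "0 < m"
  shows "m \<le> floor_log (floor_log l) \<longleftrightarrow> 2 ^ 2 ^ m \<le> l"
proof (cases "floor_log l = 0")
  case True
  have "l < 2"
    using True le_floor_log_iff[OF assms(1), of 1] by simp
  moreover have "(2::nat) ^ 1 \<le> 2 ^ 2 ^ m"
    by (rule power_increasing) simp_all
  ultimately show ?thesis
    using True assms(2) by simp
next
  case False
  then show ?thesis
    using le_floor_log_iff[of "floor_log l" m] le_floor_log_iff[of l "2 ^ m"] assms by simp
qed

lemma tow_ge: "k + 2 \<le> tow k"
proof (induction k)
  case (Suc k)
  have "tow k < 2 ^ tow k" "(2::nat) ^ tow k < 2 ^ 2 ^ tow k"
    by (rule less_exp)+
  then show ?case
    using Suc by (simp only: tow.simps)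
qed simp

lemma stage_tow:
  assumes "tow k \<le> l" "l < tow (Suc k)"
  shows "stage l = (k + 1) mod 3"
  using assms
proof (induction k arbitrary: l)
  case 0
  have "\<not> 2 \<le> floor_log (floor_log l)"
    using loglog_le_iff[of l 2] 0 by simp
  then have "stage (floor_log (floor_log l)) = 0"
    by (subst stage.simps) simp
  then show ?case
    using 0 by (subst stage.simps) simp
next
  case (Suc k)
  let ?l = "floor_log (floor_log l)"
  have pos: "0 < l" "0 < tow k" "0 < tow (Suc k)" "\<not> l < 2"
    using tow_ge[of k] tow_ge[of "Suc k"] Suc.prems(1) by linarith+
  have "tow k \<le> ?l"
    using loglog_le_iff[OF pos(1,2)] Suc.prems(1) by simp
  moreover have "?l < tow (Suc k)"
    using loglog_le_iff[OF pos(1,3)] Suc.prems(2) by (simp add: not_le[symmetric] del: not_le)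
  ultimately have "stage ?l = (k + 1) mod 3"
    by (rule Suc.IH)
  then show ?case
    using pos(4) by (subst stage.simps) (simp add: mod_simps)
qed

lemma stage_gap:
  assumes "i < 3"
  obtains m where "C \<le> m" "\<And>l. m \<le> l \<Longrightarrow> l \<le> 2 ^ 2 ^ 2 ^ m \<Longrightarrow> stage l \<noteq> i"
proof -
  \<comment> \<open>On the blocks \<open>k\<close> and \<open>k + 1\<close> the stage is i + 1 and i
    + 2 modulo 3, so \<open>i\<close> is missing. The multiple of 3 moves the gap outwards without
    changing the residues.\<close>
  define k where "k = 3 * C + i"
  have "stage l \<noteq> i" if l: "tow k \<le> l" "l \<le> 2 ^ 2 ^ 2 ^ tow k" for l
  proof (cases "l < tow (Suc k)")
    case True
    then have "stage l = (k + 1) mod 3"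
      by (rule stage_tow[OF l(1)])
    also have "\<dots> \<noteq> i"
      using assms unfolding k_def by presburger
    finally show ?thesis .
  next
    case False
    \<comment> \<open>Two blocks reach four exponentials above \<open>tow k\<close>; the gap asks
      for three.\<close>
    have "tow k < 2 ^ tow k"
      by (rule less_exp)
    then have "(2::nat) ^ 2 ^ 2 ^ tow k < 2 ^ 2 ^ 2 ^ 2 ^ tow k"
      by (intro power_strict_increasing) simp_all
    then have "l < tow (Suc (Suc k))"
      using le_less_trans[OF l(2)] by simp
    then have "stage l = (Suc k + 1) mod 3"
      using False by (intro stage_tow) simp_all
    also have "\<dots> \<noteq> i"
      using assms unfolding k_def by presburger
    finally show ?thesis .
  qed
  moreover have "C \<le> tow k"
    using tow_ge[of k] by (simp add: k_def)
  ultimately show thesis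
    using that by blast
qed

section \<open>A universal program for oracle machines\<close>

text \<open>Three tables of unknown length share one array, separated by the residue of the index
  modulo 3.\<close>

definition tab :: "nat \<Rightarrow> nat" where
  "tab b = 3 * b + 2"

type_synonym nfun = "nat \<Rightarrow> nat"

text \<open>Horner's scheme in base \<open>B\<close> for the state followed by the symbols read; it
  numbers the rows of the transition table.\<close>

fun code_index :: "nat \<Rightarrow> nat \<Rightarrow> nat \<Rightarrow> nfun \<Rightarrow> nfun \<Rightarrow> nat \<Rightarrow> nat" where
  "code_index k B q H M 0 = q"
| "code_index k B q H M (Suc i) = code_index k B q H M i * B + M (H i * k + i)"

text \<open>A table row holds the next state at offset 0 and then a symbol and a move per tape.
  Moves are coded 0, 1, 2, hence the -1; \<open>min\<close> with \<open>w\<close> is the cut-off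
  made by \<open>Put\<close>.\<close>

fun apply_acts :: "nat \<Rightarrow> nat \<Rightarrow> nfun \<Rightarrow> nat \<Rightarrow> nfun \<Rightarrow> nfun \<Rightarrow> nat \<Rightarrow>
    nfun \<times> nfun" where
  "apply_acts w k E e H M 0 = (H, M)"
| "apply_acts w k E e H M (Suc i) =
    (let (H', M') = apply_acts w k E e H M i
     in (H'(i := min (H' i + E (tab (e + 2 + 2 * i)) - 1) w),
         M'(H' i * k + i := min (E (tab (e + 1 + 2 * i))) w)))"

text \<open>The code starts from 1 so that leading zeros count. The first component turns to 1 at
  the first symbol that is not a bit.\<close>

fun scan_query :: "nfun \<Rightarrow> nat \<Rightarrow> nat \<times> nat" where
  "scan_query g 0 = (0, 1)"
| "scan_query g (Suc i) =
    (let (f, c) = scan_query g i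
     in if f = 0 then if g i = 1 then (0, 2 * c) else if g i = 2 then (0, 2 * c + 1) else (1, c)
        else (f, c))"

text \<open>One step of the simulation. The numbers \<open>E\<close> describe the oracle machine and its oracle:
  \<open>E (3 * c)\<close> is the oracle's answer to the string with code \<open>c\<close>, \<open>E (3 * q + 1)\<close> is the type of
  state \<open>q\<close> (0 ordinary, 1 query, 2 reject, 3 accept), and \<open>E (tab b)\<close> holds the parameters
  (\<open>b < 5\<close>: number of tapes, number of symbols, start state, states after a positive and a
  negative answer) and then the transition table. The head of tape \<open>j\<close> is at \<open>H j\<close>, and
  \<open>M (p * k + j)\<close> is the symbol at position \<open>p\<close> of tape \<open>j\<close>; position \<open>T\<close> stands for cell 0.\<close>

definition ustep :: "nat \<Rightarrow> nat \<Rightarrow> nat \<Rightarrow> nat \<Rightarrow> nfun \<Rightarrow>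
    nat \<times> nfun \<times> nfun \<Rightarrow> nat \<times> nfun \<times> nfun" where
  "ustep w T k B E = (\<lambda>(q, H, M).
     let f = E (3 * q + 1)
     in if f = 0 then
          (let e = 5 + code_index k B q H M k * (2 * k + 1)
           in (E (tab e), apply_acts w k E e H M k))
        else if f = 1 then
          (let c = snd (scan_query (\<lambda>i. M ((T + i) * k + 1)) T)
           in (if E (3 * c) = 0 then E (tab 4) else E (tab 3), H, M))
        else (q, H, M))"

text \<open>Variables 2, 3 and 4 are the arrays \<open>E\<close>, \<open>H\<close> and \<open>M\<close>; variables 5 to 9 hold the row width
  \<open>w\<close>, \<open>T\<close>, the numbers of tapes and of symbols, and the state. Among the auxiliary variables, 14 is
  an address, 16 the type of the state, 17 the code of a query, and 18 an index for \<open>tab\<close>.\<close>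

definition fetch :: "nat \<Rightarrow> com" where
  "fetch x = Zero 14 ;; Incs 2 14 ;; AddR 14 18 ;; AddR 14 18 ;; AddR 14 18 ;; Get x 2 14 5"

lemma fetch [simp]:
  assumes "x \<noteq> 2" "x \<noteq> 5" "x \<noteq> 14"
  shows "sem (fetch x) s =
      s\<lparr>vl := (vl s)(14 := tab (vl s 18), x := arr (vl s 5) (bt s 2) (tab (vl s 18)), 2 := 0)\<rparr>"
      (is ?sem)
    "safe V (fetch x) s \<longleftrightarrow> vl s 14 \<le> V \<and> vl s 18 \<le> V \<and> vl s 2 \<le> V \<and> tab (vl s 18) \<le> V \<and>
      vl s x \<le> V \<and> vl s 5 \<le> V \<and> tab (vl s 18) * vl s 5 + vl s 5 \<le> V" (is ?safe)
proof -
  have "Suc (Suc (vl s 18 + vl s 18 + vl s 18)) = tab (vl s 18)"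
    by (simp add: tab_def)
  then show ?sem ?safe
    using assms by (auto simp: fetch_def)
qed

definition read_com :: com where
  "read_com = Mov 13 9 ;; Zero 10 ;; For 7 (Get 11 3 10 5 ;; Zero 14 ;; MulAdd 14 11 7 ;; AddR 14 10 ;;
     Get 12 4 14 5 ;; Zero 15 ;; MulAdd 15 13 8 ;; AddR 15 12 ;; Mov 13 15 ;; Inc 10)"

definition write_com :: com where
  "write_com = Zero 18 ;; Incs 5 18 ;; AddR 18 13 ;; MulAdd 18 13 7 ;; MulAdd 18 13 7 ;; fetch 9 ;;
     Inc 18 ;; Zero 10 ;; For 7 (Get 11 3 10 5 ;; fetch 12 ;; Zero 14 ;; MulAdd 14 11 7 ;; AddR 14 10 ;;
       Put 4 14 12 5 15 ;; Inc 18 ;; fetch 12 ;; AddR 11 12 ;; Dec 11 ;; Put 3 10 11 5 15 ;; Inc 18 ;; Inc 10)"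

definition query_com :: com where
  "query_com = Zero 17 ;; Inc 17 ;; Mov 11 6 ;;
     For 6 (Zero 14 ;; MulAdd 14 11 7 ;; Inc 14 ;; Get 12 4 14 5 ;;
       IfZ 16 (IfZ 12 (Inc 16) (Dec 12 ;; IfZ 12 (AddR 17 17) (Dec 12 ;; IfZ 12 (AddR 17 17 ;; Inc 17) (Inc 16)))) Nop ;;
       Inc 11) ;;
     Zero 14 ;; AddR 14 17 ;; AddR 14 17 ;; AddR 14 17 ;; Get 12 2 14 5 ;;
     Zero 14 ;; IfZ 12 (Incs 14 14) (Incs 11 14) ;; Get 9 2 14 5"

definition flag_com :: com where
  "flag_com = Zero 14 ;; Inc 14 ;; AddR 14 9 ;; AddR 14 9 ;; AddR 14 9 ;; Get 16 2 14 5"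

definition step_com :: com where
  "step_com = flag_com ;; IfZ 16 (read_com ;; write_com) (Dec 16 ;; IfZ 16 query_com Nop)"

section \<open>Address bounds and correctness of one simulated step\<close>

definition uinv :: "nat \<Rightarrow> nat \<Rightarrow> nat \<Rightarrow> nat \<Rightarrow> nat \<Rightarrow> nfun \<Rightarrow> nat \<Rightarrow> nfun \<Rightarrow> nfun \<Rightarrow> st \<Rightarrow> bool" where
  "uinv V w T k B E q H M s \<longleftrightarrow> vl s 5 = w \<and> vl s 6 = T \<and> vl s 7 = k \<and> vl s 8 = B \<and> vl s 9 = q \<and>
     arr w (bt s 2) = E \<and> arr w (bt s 3) = H \<and> arr w (bt s 4) = M \<and>
     vl s 2 \<le> V \<and> vl s 3 \<le> V \<and> vl s 4 \<le> V \<and> vl s 10 \<le> V \<and> vl s 11 \<le> V \<and> vl s 12 \<le> V \<and>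
     vl s 13 \<le> V \<and> vl s 14 \<le> V \<and> vl s 15 \<le> V \<and> vl s 16 \<le> V \<and> vl s 17 \<le> V \<and> vl s 18 \<le> V"

text \<open>The largest addresses come from the transition table, whose row numbers go up to (w +
  1)^(w + 1) with at most 2 * w + 1 entries per row, and from the codes of queries of at most
  \<open>w\<close> bits. The factor 17 leaves room for offsets and small addresses.
  \<open>value_bound\<close> covers bit positions, which are addresses times the row width.\<close>

definition addr_bound :: "nat \<Rightarrow> nat" where
  "addr_bound w = 17 * (w + 2) ^ (w + 2)"

definition value_bound :: "nat \<Rightarrow> nat" where
  "value_bound w = 18 * (w + 2) ^ (w + 3)"

lemma pow_ge: "w + 2 \<le> (w + 2) ^ (w + 2)" "(w + 2) ^ 2 \<le> (w + 2) ^ (w + 2)" for w :: nat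
  using power_increasing[of 1 "w + 2" "w + 2"] power_increasing[of 2 "w + 2" "w + 2"] by simp_all

lemma addr_value:
  assumes "a \<le> addr_bound w"
  shows "a * w + w \<le> value_bound w" "a \<le> value_bound w"
proof -
  define P where "P = (w + 2) ^ (w + 2)"
  have P: "w + 2 \<le> P" and a: "a \<le> 17 * P"
    using assms pow_ge(1)[of w] unfolding addr_bound_def P_def by simp_all
  have "Suc (w + 2) = w + 3"
    by simp
  then have "(w + 2) ^ (w + 3) = (w + 2) * P"
    using power_Suc[of "w + 2" "w + 2"] unfolding P_def by metis
  then have V: "value_bound w = 17 * P * (w + 2) + P * (w + 2)"
    by (simp add: value_bound_def algebra_simps)
  have "a * w \<le> 17 * P * (w + 2)" "w \<le> P * (w + 2)" "a \<le> 17 * P * (w + 2)"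
    using mult_le_mono[OF a, of w "w + 2"] mult_le_mono[OF a, of 1 "w + 2"] mult_le_mono[OF P, of 1 "w + 2"] by simp_all
  then show "a * w + w \<le> value_bound w" "a \<le> value_bound w"
    unfolding V by linarith+
qed

lemma small_addr: "x \<le> 17 * (w + 2) ^ 2 \<Longrightarrow> x \<le> addr_bound w"
  using pow_ge(2)[of w] unfolding addr_bound_def by simp

lemma table_addr:
  assumes "x \<le> (w + 1) ^ (w + 1)" "k \<le> w" "y \<le> 2 * k + 1"
  shows "tab (5 + x * (2 * k + 1) + y) \<le> addr_bound w"
proof -
  define Q where "Q = (w + 2) ^ (w + 1)"
  have x: "x \<le> Q"
    using assms(1) power_mono[of "w + 1" "w + 2" "w + 1"] unfolding Q_def by simp
  have Q: "1 \<le> Q"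
    unfolding Q_def by (rule one_le_power) simp
  have "x * (2 * k + 1) \<le> Q * (2 * (w + 2))"
    using x assms(2) by (intro mult_mono) simp_all
  moreover have "3 * (w + 2) \<le> Q * (3 * (w + 2))" "w + 2 \<le> Q * (w + 2)"
    using mult_le_mono1[OF Q, of "3 * (w + 2)"] mult_le_mono1[OF Q, of "w + 2"] by simp_all
  moreover have "addr_bound w = Q * (17 * (w + 2))"
  proof -
    have "Suc (w + 1) = w + 2"
      by simp
    then have "(w + 2) ^ (w + 2) = (w + 2) * Q"
      using power_Suc[of "w + 2" "w + 1"] unfolding Q_def by metis
    then show ?thesis
      by (simp only: addr_bound_def mult_ac)
  qed
  moreover have "3 * (5 + x * (2 * k + 1) + y) + 2 \<le> 3 * (6 + 2 * w + x * (2 * k + 1)) + 2"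
    using assms(2,3) by simp
  ultimately show ?thesis
    by (simp add: algebra_simps tab_def)
qed

context
  fixes V w T k B :: nat and E :: "nat \<Rightarrow> nat"
  assumes V: "value_bound w \<le> V" and T: "T \<le> w" and k: "k \<le> w" and B: "B \<le> w"
    and E: "\<And>i. E i \<le> w"
begin

lemma addr: "a \<le> addr_bound w \<Longrightarrow> a * w + w \<le> V" "a \<le> addr_bound w \<Longrightarrow> a \<le> V"
  using addr_value[of a w] V by auto

lemma small: "x \<le> 17 * (w + 2) ^ 2 \<Longrightarrow> x \<le> V"
  using small_addr addr(2) by blast

lemma w_le: "w \<le> V" "w + 2 \<le> V"
  by (rule small, simp add: power2_eq_square)+

lemma le_wV: "x \<le> w \<Longrightarrow> x \<le> V"
  using w_le(1) by (rule order_trans[rotated])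

abbreviation "ust \<equiv> uinv V w T k B E"

lemma arr_le': "ust q H M s \<Longrightarrow> H i \<le> w" "ust q H M s \<Longrightarrow> M i \<le> w"
  unfolding uinv_def by (metis arr_le)+

lemma cell_addr:
  assumes "p \<le> w" "j \<le> w"
  shows "p * k + j \<le> addr_bound w"
proof (rule small_addr)
  have "p * k + j \<le> w * w + w"
    using assms k by (intro add_mono mult_mono) simp_all
  then show "p * k + j \<le> 17 * (w + 2) ^ 2"
    by (simp add: power2_eq_square)
qed

lemma code_index_le:
  assumes "ust q H M s" "q \<le> w"
  shows "code_index k B q H M i \<le> (w + 1) ^ (i + 1)"
proof (induction i)
  case (Suc i)
  have "code_index k B q H M (Suc i) \<le> (w + 1) ^ (i + 1) * w + w"
    unfolding code_index.simps using Suc B arr_le'(2)[OF assms(1)] by (intro add_mono mult_mono) simp_all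
  also have "\<dots> \<le> (w + 1) ^ (i + 1) * w + (w + 1) ^ (i + 1)"
  proof -
    have "w + 1 \<le> (w + 1) ^ (i + 1)"
      by (rule self_le_power) simp_all
    then show ?thesis by simp
  qed
  also have "\<dots> = (w + 1) ^ (Suc i + 1)"
    by simp
  finally show ?case .
qed (use assms(2) in simp)

lemma code_index_le':
  assumes "ust q H M s" "q \<le> w" "i \<le> k"
  shows "code_index k B q H M i \<le> (w + 1) ^ (w + 1)"
  using code_index_le[OF assms(1,2), of i] power_increasing[of "i + 1" "w + 1" "w + 1"] assms(3) k
  by simp

lemma code_index_V:
  assumes "ust q H M s" "q \<le> w" "i \<le> k"
  shows "code_index k B q H M i \<le> V"
proof (rule addr(2))
  let ?x = "code_index k B q H M i"
  have "?x \<le> tab (5 + ?x * (2 * k + 1) + 0)"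
    by (simp add: tab_def)
  also have "\<dots> \<le> addr_bound w"
    by (rule table_addr[OF code_index_le'[OF assms] k]) simp
  finally show "?x \<le> addr_bound w" .
qed

lemma read_com:
  assumes "ust q H M s" "q \<le> w"
  shows "safe V read_com s \<and> ust q H M (sem read_com s) \<and> vl (sem read_com s) 13 = code_index k B q H M k"
proof -
  define I where "I i t \<longleftrightarrow> ust q H M t \<and> vl t 10 = i \<and> vl t 13 = code_index k B q H M i" for i t
  let ?b = "Get 11 3 10 5 ;; Zero 14 ;; MulAdd 14 11 7 ;; AddR 14 10 ;;
     Get 12 4 14 5 ;; Zero 15 ;; MulAdd 15 13 8 ;; AddR 15 12 ;; Mov 13 15 ;; Inc 10"
  let ?s = "sem (Zero 10) (sem (Mov 13 9) s)"
  have q: "q \<le> V"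
    using assms(2) w_le(1) by (rule order_trans)
  have "safe V (For 7 ?b) ?s \<and> I k (sem (For 7 ?b) ?s)"
  proof (rule For_inv)
    show "I 0 ?s" "vl ?s 7 = k"
      using assms q by (simp_all add: I_def uinv_def)
    show "k \<le> V"
      using k w_le(1) by (rule order_trans)
    fix i t assume i: "i < k" and I: "I i t"
    then have ust: "ust q H M t" and t: "vl t 10 = i" "vl t 13 = code_index k B q H M i"
      by (simp_all add: I_def)
    let ?x = "code_index k B q H M i"
    let ?a = "H i * k + i"
    have iw: "i \<le> w" and iV: "Suc i \<le> V"
      using i k w_le(1) by simp_all
    have H: "H i \<le> w" "H i \<le> V" and M: "M ?a \<le> w" "M ?a \<le> V"
      using arr_le'[OF ust] le_wV by blast+
    have a: "?a * w + w \<le> V" "?a \<le> V" "i * w + w \<le> V" "i \<le> V"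
      using addr[OF cell_addr[OF H(1) iw]] addr[OF cell_addr[of 0, OF _ iw]] by simp_all
    have x: "?x \<le> V" "?x * B + M ?a \<le> V"
      using code_index_V[OF ust assms(2), of i] code_index_V[OF ust assms(2), of "Suc i"] i by simp_all
    have kB: "k \<le> V" "B \<le> V"
      using k B le_wV by blast+
    show "safe V ?b t \<and> I (Suc i) (sem ?b t)"
      using [[simproc del: fast_arith_nat]] ust t H M a x kB i iV w_le(1) unfolding I_def uinv_def by simp
  qed
  moreover have "safe V (Mov 13 9 ;; Zero 10) s"
    using assms q by (simp add: uinv_def)
  ultimately show ?thesis
    unfolding read_com_def I_def by simp
qed

lemma write_com:
  assumes "ust q H M s" "vl s 13 = x" "x \<le> (w + 1) ^ (w + 1)" "q \<le> w"
  defines "e \<equiv> 5 + x * (2 * k + 1)"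
  shows "safe V write_com s \<and>
    ust (E (tab e)) (fst (apply_acts w k E e H M k)) (snd (apply_acts w k E e H M k)) (sem write_com s)"
proof -
  let ?q = "E (tab e)"
  define I where "I i t \<longleftrightarrow> ust ?q (fst (apply_acts w k E e H M i)) (snd (apply_acts w k E e H M i)) t \<and>
    vl t 10 = i \<and> vl t 18 = e + 1 + 2 * i" for i and t :: st
  let ?b = "Get 11 3 10 5 ;; fetch 12 ;; Zero 14 ;; MulAdd 14 11 7 ;; AddR 14 10 ;;
       Put 4 14 12 5 15 ;; Inc 18 ;; fetch 12 ;; AddR 11 12 ;; Dec 11 ;; Put 3 10 11 5 15 ;; Inc 18 ;; Inc 10"
  let ?p = "Zero 18 ;; Incs 5 18 ;; AddR 18 13 ;; MulAdd 18 13 7 ;; MulAdd 18 13 7"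
  let ?p' = "fetch 9 ;; Inc 18 ;; Zero 10"
  let ?s = "sem ?p' (sem ?p s)"
  have addr_e: "tab (e + y) \<le> addr_bound w" if "y \<le> 2 * k + 1" for y
    using table_addr[OF assms(3) k that] unfolding e_def .
  have kB: "k \<le> V" "B \<le> V" "q \<le> V"
    using k B assms(4) le_wV by blast+
  have xV: "x \<le> V" "e \<le> V" "Suc e \<le> V" "tab e \<le> V" "tab e * w + w \<le> V"
    using addr[OF addr_e[of 0]] by (auto simp: e_def tab_def)
  have EV: "E i \<le> V" for i
    using E w_le(1) by (rule order_trans)
  have p: "safe V ?p s" "sem ?p s = s\<lparr>vl := (vl s)(18 := e)\<rparr>"
    using assms(1,2) xV kB by (auto simp: uinv_def e_def algebra_simps)
  have p': "safe V ?p' (sem ?p s)"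
    unfolding p(2) using [[simproc del: fast_arith_nat]] assms(1) xV kB EV w_le(1) by (simp add: uinv_def)
  have "safe V (For 7 ?b) ?s \<and> I k (sem (For 7 ?b) ?s)"
  proof (rule For_inv[where I = I and n = k])
    have s: "vl s 5 = w" "arr w (bt s 2) = E" "vl s 7 = k"
      using assms(1) unfolding uinv_def by blast+
    have eq: "?s = s\<lparr>vl := (vl s)(18 := Suc e, 14 := tab e, 9 := ?q, 2 := 0, 10 := 0)\<rparr>"
      unfolding p(2) by (simp add: s fun_upd_twist)
    have "vl ?s 18 = e + 1 + 2 * 0 \<and> vl ?s 10 = 0"
      unfolding eq by simp
    moreover have "ust ?q H M ?s"
      using assms(1) xV(3,4) unfolding eq uinv_def by simp
    ultimately show "I 0 ?s"
      unfolding I_def by simp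
    show "vl ?s 7 = k"
      unfolding eq by (simp add: s)
    show "k \<le> V" by (rule kB)
    fix i t assume i: "i < k" and I: "I i t"
    obtain H' M' where HM: "apply_acts w k E e H M i = (H', M')"
      by fastforce
    have ust: "ust ?q H' M' t" and t: "vl t 10 = i" "vl t 18 = Suc (e + 2 * i)"
      using I by (simp_all add: I_def HM)
    let ?a = "H' i * k + i"
    have iw: "i \<le> w" and iV: "Suc i \<le> V"
      using i k w_le(1) by simp_all
    have H: "H' i \<le> w" "H' i \<le> V"
      using arr_le'(1)[OF ust] le_wV by blast+
    have a: "?a * w + w \<le> V" "?a \<le> V" "i * w + w \<le> V" "i \<le> V"
      using addr[OF cell_addr[OF H(1) iw]] addr[OF cell_addr[of 0, OF _ iw]] by simp_all
    have e: "tab (Suc (e + 2 * i)) \<le> addr_bound w" "tab (Suc (Suc (e + 2 * i))) \<le> addr_bound w"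
      using addr_e[of "1 + 2 * i"] addr_e[of "2 + 2 * i"] i by simp_all
    note e' = addr[OF e(1)] addr[OF e(2)]
    have eV: "Suc (e + 2 * i) \<le> V" "Suc (Suc (e + 2 * i)) \<le> V" "Suc (Suc (Suc (e + 2 * i))) \<le> V"
      using e'(2,4) by (simp_all add: tab_def)
    have "H' i + E j \<le> 17 * (w + 2) ^ 2" for j
      using add_mono[OF H(1) E[of j]] by (simp add: power2_eq_square)
    then have HE: "H' i + E j \<le> V" "H' i + E j - Suc 0 \<le> V" for j
      using small[of "H' i + E j"] by simp_all
    \<comment> \<open>\<open>Put\<close> leaves the excess of its argument over \<open>w\<close> in
      variable 15, which must stay bounded as well.\<close>
    have d: "x - w \<le> V" "x - Suc w \<le> V" if "x \<le> V" for x
      by (rule order_trans[OF diff_le_self that])+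
    show "safe V ?b t \<and> I (Suc i) (sem ?b t)"
      using [[simproc del: fast_arith_nat]] ust t H a e' eV HE d EV kB i iV w_le(1) unfolding I_def uinv_def by (simp add: HM)
  qed
  then show ?thesis
    using p(1) p' unfolding write_com_def I_def by simp
qed

lemma scan_query_le: "fst (scan_query g i) \<le> 1" "snd (scan_query g i) + 1 \<le> 2 ^ (i + 1)"
  by (induction i) (auto simp: Let_def split: prod.splits)

text \<open>The scan visits the positions T + i for i < T, and 2 * T \<le> w keeps them in the range
  of head positions. A string of at most \<open>T\<close> bits has a code below 2^(T + 1), hence an
  admissible address.\<close>

lemma query_com:
  assumes "ust q H M s" "vl s 16 = 0" "q \<le> w" "2 * T \<le> w"
  defines "c \<equiv> snd (scan_query (\<lambda>i. M ((T + i) * k + 1)) T)"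
  shows "safe V query_com s \<and>
    ust (if E (3 * c) = 0 then E (tab 4) else E (tab 3)) H M (sem query_com s)"
proof -
  define g where "g = (\<lambda>i. M ((T + i) * k + 1))"
  define I where "I i t \<longleftrightarrow> ust q H M t \<and> vl t 11 = T + i \<and> vl t 16 = fst (scan_query g i) \<and>
    vl t 17 = snd (scan_query g i)" for i and t :: st
  let ?b = "Zero 14 ;; MulAdd 14 11 7 ;; Inc 14 ;; Get 12 4 14 5 ;;
       IfZ 16 (IfZ 12 (Inc 16) (Dec 12 ;; IfZ 12 (AddR 17 17) (Dec 12 ;; IfZ 12 (AddR 17 17 ;; Inc 17) (Inc 16)))) Nop ;;
       Inc 11"
  let ?p = "Zero 17 ;; Inc 17 ;; Mov 11 6"
  let ?q = "Zero 14 ;; AddR 14 17 ;; AddR 14 17 ;; AddR 14 17 ;; Get 12 2 14 5 ;;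
     Zero 14 ;; IfZ 12 (Incs 14 14) (Incs 11 14) ;; Get 9 2 14 5"
  let ?s = "sem ?p s"
  have kT: "k \<le> V" "T \<le> V" "q \<le> V"
    using k T assms(3) le_wV by blast+
  have EV: "E i \<le> V" for i
    using E w_le(1) by (rule order_trans)
  have c: "3 * snd (scan_query g i) \<le> addr_bound w" if "i \<le> T" for i
  proof -
    have "snd (scan_query g i) \<le> 2 ^ (i + 1)"
      using scan_query_le(2)[of g i] by simp
    also have "\<dots> \<le> 2 ^ (w + 2)"
      using that T by (intro power_increasing) simp_all
    also have "\<dots> \<le> (w + 2) ^ (w + 2)"
      by (intro power_mono) simp_all
    finally show ?thesis
      by (simp only: addr_bound_def)
  qed
  have p: "safe V ?p s"
    using assms(1) kT by (simp add: uinv_def)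
  have "safe V (For 6 ?b) ?s \<and> I T (sem (For 6 ?b) ?s)"
  proof (rule For_inv)
    show "I 0 ?s" "vl ?s 6 = T"
      using assms(1,2) kT order_trans[OF _ w_le(2), of 1] by (simp_all add: I_def uinv_def)
    show "T \<le> V" by (rule kT)
    fix i t assume i: "i < T" and I: "I i t"
    then have ust: "ust q H M t"
      by (simp add: I_def)
    have M: "M j \<le> V" for j
      using arr_le'(2)[OF ust] w_le(1) by (rule order_trans)
    have Ti: "T + i \<le> w"
      using i assms(4) by simp
    have a: "Suc ((T + i) * k) * w + w \<le> V" "Suc ((T + i) * k) \<le> V" "T + i \<le> V" "Suc (T + i) \<le> V"
    proof -
      have "(T + i) * k \<le> w * w"
        using Ti k by (rule mult_le_mono)
      then have "Suc ((T + i) * k) \<le> addr_bound w"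
        by (intro small_addr) (simp add: power2_eq_square)
      then show "Suc ((T + i) * k) * w + w \<le> V" "Suc ((T + i) * k) \<le> V"
        using addr by blast+
      show "T + i \<le> V" "Suc (T + i) \<le> V"
        using Ti w_le(2) by simp_all
    qed
    have c': "snd (scan_query g i) \<le> V" "snd (scan_query g (Suc i)) \<le> V"
      using addr(2)[OF c[of i]] addr(2)[OF c[of "Suc i"]] i by simp_all
    have 1: "1 \<le> V" "2 \<le> V"
      using w_le(2) by simp_all
    obtain f n where fn: "scan_query g i = (f, n)"
      by fastforce
    have g: "M (Suc ((T + i) * k)) = g i"
      by (simp add: g_def)
    have gV: "g i \<le> V" "g i - 1 \<le> V" "g i - 2 \<le> V"
      using M[of "Suc ((T + i) * k)"] unfolding g by simp_all
    consider "f \<noteq> 0" | "f = 0" "g i = 0" | "f = 0" "g i = 1" | "f = 0" "g i = 2" | "f = 0" "g i > 2"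
      by linarith
    then show "safe V ?b t \<and> I (Suc i) (sem ?b t)"
      using I a kT c' 1 gV unfolding I_def uinv_def by cases (simp_all add: fn g)
  qed
  then have 2: "safe V (For 6 ?b) ?s" "I T (sem (For 6 ?b) ?s)"
    by blast+
  let ?t = "sem (For 6 ?b) ?s"
  define d where "d = snd (scan_query g T)"
  have d3: "3 * d = d + d + d" "c = d"
    by (simp_all add: d_def c_def g_def)
  have d: "(d + d + d) * w + w \<le> V" "d + d + d \<le> V" "d \<le> V"
    using addr[OF c[OF order.refl]] unfolding d_def[symmetric] d3(1) by simp_all
  \<comment> \<open>14 and 11 are \<open>tab 4\<close> and \<open>tab 3\<close>, the places of the
    two answer states.\<close>
  have "14 \<le> addr_bound w" "11 \<le> addr_bound w"
    by (rule small_addr, simp add: power2_eq_square)+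
  note n = addr[OF this(1)] addr[OF this(2)]
  have t: "ust q H M ?t" "vl ?t 17 = d"
    using 2(2) by (simp_all add: I_def d_def)
  have 3: "safe V ?q u \<and> ust (if E (3 * c) = 0 then E (tab 4) else E (tab 3)) H M (sem ?q u)"
    if "ust q H M u" "vl u 17 = d" for u
    unfolding d3(2) d3(1)
    using that d n kT EV by (cases "E (d + d + d) = 0") (simp_all add: uinv_def tab_def)
  show ?thesis
    using p 2(1) 3[OF t] unfolding query_com_def by (simp only: sem.simps(5) safe.simps(5) simp_thms)
qed

lemma flag_com:
  assumes "ust q H M s" "q \<le> w"
  shows "safe V flag_com s \<and> ust q H M (sem flag_com s) \<and> vl (sem flag_com s) 16 = E (3 * q + 1)"
proof -
  have "3 * q + 1 \<le> 17 * (w + 2) ^ 2"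
    using assms(2) by (simp add: power2_eq_square)
  note a = addr[OF small_addr[OF this]]
  have q3: "3 * q + 1 = Suc (q + q + q)"
    by simp
  have "q \<le> V" "E (3 * q + 1) \<le> V"
    using le_wV assms(2) E by simp_all
  then show ?thesis
    using assms(1) a unfolding q3 by (simp add: flag_com_def uinv_def)
qed

lemma step_com:
  assumes "ust q H M s" "q \<le> w" "2 * T \<le> w" "ustep w T k B E (q, H, M) = (q', H', M')"
  shows "safe V step_com s \<and> ust q' H' M' (sem step_com s) \<and> q' \<le> w"
proof -
  let ?f = "E (3 * q + 1)" and ?s = "sem flag_com s"
  note f = flag_com[OF assms(1,2)]
  consider "?f = 0" | "?f = 1" | "?f > 1"
    by linarith
  then show ?thesis
  proof cases
    case 1
    let ?x = "code_index k B q H M k"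
    have "safe V read_com ?s \<and> ust q H M (sem read_com ?s) \<and> vl (sem read_com ?s) 13 = ?x"
      using read_com[of q H M ?s] f assms(2) by simp
    note r = this
    have "?x \<le> (w + 1) ^ (w + 1)"
      by (rule code_index_le'[OF assms(1,2) order.refl])
    note wr = write_com[OF conjunct1[OF conjunct2[OF r]] conjunct2[OF conjunct2[OF r]] this assms(2)]
    have "q' = E (tab (5 + ?x * (2 * k + 1)))"
      "(H', M') = apply_acts w k E (5 + ?x * (2 * k + 1)) H M k"
      using assms(4) 1 by (simp_all add: ustep_def Let_def)
    then have "q' = E (tab (5 + ?x * (2 * k + 1)))"
      "H' = fst (apply_acts w k E (5 + ?x * (2 * k + 1)) H M k)"
      "M' = snd (apply_acts w k E (5 + ?x * (2 * k + 1)) H M k)"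
      by (metis fst_conv, metis fst_conv, metis snd_conv)
    then show ?thesis
      using f r wr E 1 by (simp add: step_com_def)
  next
    case 2
    let ?t = "sem (Dec 16) ?s"
    have t: "ust q H M ?t" "vl ?t 16 = 0"
      using f 2 by (auto simp: uinv_def)
    note qu = query_com[OF t assms(2,3)]
    have "q' \<le> w"
      using assms(4) 2 E by (auto simp: ustep_def Let_def split: if_splits)
    then show ?thesis
      using f qu t(2) 2 assms(4) by (simp add: step_com_def ustep_def Let_def split: if_splits)
  next
    case 3
    have "ust q H M (sem (Dec 16) ?s)"
      using f by (auto simp: uinv_def)
    then show ?thesis
      using f 3 assms by (simp add: step_com_def ustep_def Let_def)
  qed
qed

end

text \<open>The input is read as a list of numbers in unary, each terminated by a 0 bit. The number at
  index \<open>i\<close> is written to row \<open>i\<close> of a bit array with rows of width \<open>w\<close>.\<close>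

fun parse_bit :: "nat \<Rightarrow> nat \<times> nat \<times> (nat \<Rightarrow> bool) \<Rightarrow> bool \<Rightarrow> nat \<times> nat \<times> (nat \<Rightarrow> bool)" where
  "parse_bit w (i, p, f) b = (if b then (i, Suc p, f(p := True)) else (Suc i, Suc i * w, f))"

definition parse :: "nat \<Rightarrow> bool list \<Rightarrow> nat \<times> nat \<times> (nat \<Rightarrow> bool)" where
  "parse w x = foldl (parse_bit w) (0, 0, \<lambda>_. False) x"

definition parsed :: "nat \<Rightarrow> bool list \<Rightarrow> nat \<Rightarrow> nat" where
  "parsed w x = arr w (snd (snd (parse w x)))"

text \<open>Cell \<open>i\<close> of tape 0 is at position \<open>T + i\<close> and hence at index
  (T + i) * k.\<close>

fun input_cells :: "bool list \<Rightarrow> nat \<Rightarrow> nat \<Rightarrow> nat \<Rightarrow> nat \<Rightarrow> nat \<Rightarrow> nat" where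
  "input_cells x w T k 0 = (\<lambda>_. 0)"
| "input_cells x w T k (Suc i) =
    (input_cells x w T k i)(T * k + i * k := min (if x ! i then 2 else 1) w)"

definition uinit :: "nat \<Rightarrow> nat \<Rightarrow> nat \<Rightarrow> nfun \<Rightarrow> bool list \<Rightarrow> nat \<times> nfun \<times> nfun" where
  "uinit w T k E x = (E (tab 2), (\<lambda>j. if j < k then min T w else 0), input_cells x w T k (length x))"

definition size_com :: com where
  "size_com = Inc 6 ;; For 1 (AddR 6 6) ;; AddR 5 6 ;; AddR 5 6"

definition parse_com :: com where
  "parse_com = Zero 0 ;; For 1 (IfB 0 (SetB 2 True ;; Inc 2) (Inc 13 ;; Zero 2 ;; MulAdd 2 13 5) ;; Inc 0)"

definition param_com :: com where
  "param_com = Zero 2 ;; Zero 18 ;; fetch 7 ;; Inc 18 ;; fetch 8 ;; Inc 18 ;; fetch 9"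

definition cells_com :: com where
  "cells_com = Zero 0 ;; Zero 13 ;; MulAdd 13 6 7 ;;
     For 1 (Zero 12 ;; Inc 12 ;; IfB 0 (Inc 12) Nop ;; Put 4 13 12 5 15 ;; AddR 13 7 ;; Inc 0)"

definition heads_com :: com where
  "heads_com = Zero 10 ;; For 7 (Put 3 10 6 5 15 ;; Inc 10)"

definition universal_com :: com where
  "universal_com = size_com ;; parse_com ;; param_com ;; cells_com ;; heads_com ;;
     For 6 step_com ;; flag_com ;; Dec 16 ;; Dec 16"

text \<open>Heads start at position \<open>T\<close> and move at most \<open>T\<close> cells in
  \<open>T\<close> steps, so w = 2 * T covers every position. As accepting states have type 3 in a
  proper description, the result is 0 for a rejecting run and also for one that has not
  halted.\<close>

definition uresult :: "bool list \<Rightarrow> nat" where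
  "uresult x = (let T = 2 ^ length x; w = 2 * T; E = parsed w x; k = E (tab 0); B = E (tab 1);
      (q, H, M) = (ustep w T k B E ^^ T) (uinit w T k E x)
    in E (3 * q + 1) - 2)"

section \<open>Setting up the simulation and correctness of the universal program\<close>

definition xin :: "nat \<Rightarrow> bool list \<Rightarrow> st \<Rightarrow> bool" where
  "xin V x s \<longleftrightarrow> vl s 1 = length x \<and> bt s 0 = bt (input_st x) 0 \<and> vl s 0 \<le> V"

lemma arr_False: "arr w (\<lambda>_. False) = (\<lambda>_. 0)"
  by (simp add: arr_def fun_eq_iff)

lemma parse_bounds:
  "fst (parse w x) \<le> length x \<and> fst (snd (parse w x)) \<le> length x * w + length x"
proof (induction x rule: rev_induct)
  case (snoc b x)
  obtain i p f where p: "parse w x = (i, p, f)"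
    by (metis prod_cases3)
  then have "parse w (x @ [b]) = parse_bit w (i, p, f) b"
    by (simp add: parse_def)
  moreover have "i * w \<le> Suc (length x * w + length x)"
  proof -
    have "i * w \<le> length x * w"
      by (rule mult_le_mono1) (use snoc p in simp)
    then show ?thesis by linarith
  qed
  ultimately show ?case
    using snoc p by simp
qed (simp add: parse_def)

context
  fixes x :: "bool list" and T w V :: nat
  assumes T: "T = 2 ^ length x" and w: "w = 2 * T" and V: "value_bound w \<le> V"
begin

lemma n_less: "length x < T"
  unfolding T by (rule less_exp)

lemma small_V: "y \<le> 17 * (w + 2) ^ 2 \<Longrightarrow> y \<le> V"
  using addr_value(2)[OF small_addr, of y w] V by simp

lemma row_V: "i \<le> 3 * w * w + w + w \<Longrightarrow> i * w + w \<le> V"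
proof -
  assume "i \<le> 3 * w * w + w + w"
  then have "i \<le> 17 * (w + 2) ^ 2"
    by (simp add: power2_eq_square)
  then show ?thesis
    using addr_value(1)[OF small_addr, of i w] V by simp
qed

lemma wV: "3 * w * w + w + w + 20 \<le> V" "w + 2 \<le> V" "length x + 2 \<le> V" "length x \<le> w" "T \<le> V" "length x \<le> V"
proof -
  show 1: "3 * w * w + w + w + 20 \<le> V"
    by (rule small_V) (simp add: power2_eq_square)
  show 2: "w + 2 \<le> V"
    by (rule small_V) (simp add: power2_eq_square)
  show 3: "length x \<le> w"
    using n_less w by simp
  show "length x + 2 \<le> V" "T \<le> V" "length x \<le> V"
    using 2 3 w by simp_all
qed

lemma size_com:
  "safe V size_com (input_st x) \<and> xin V x (sem size_com (input_st x)) \<and>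
   uinv V w T 0 0 (\<lambda>_. 0) 0 (\<lambda>_. 0) (\<lambda>_. 0) (sem size_com (input_st x)) \<and>
   bt (sem size_com (input_st x)) 2 = (\<lambda>_. False) \<and> vl (sem size_com (input_st x)) 2 = 0 \<and>
   vl (sem size_com (input_st x)) 13 = 0"
proof -
  define I where "I i t \<longleftrightarrow> t = (input_st x)\<lparr>vl := (vl (input_st x))(6 := 2 ^ i)\<rparr>" for i t
  have "safe V (For 1 (AddR 6 6)) (sem (Inc 6) (input_st x)) \<and>
      I (length x) (sem (For 1 (AddR 6 6)) (sem (Inc 6) (input_st x)))"
  proof (rule For_inv)
    show "I 0 (sem (Inc 6) (input_st x))" "vl (sem (Inc 6) (input_st x)) 1 = length x"
      by (simp_all add: I_def input_state_def)
    show "length x \<le> V" by (rule wV)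
    fix i t assume "i < length x" "I i t"
    have "2 ^ i \<le> T"
      unfolding T by (rule power_increasing) (use \<open>i < length x\<close> in simp_all)
    then have "2 ^ i \<le> V"
      using wV(5) by (rule order_trans)
    then show "safe V (AddR 6 6) t \<and> I (Suc i) (sem (AddR 6 6) t)"
      using \<open>I i t\<close> by (simp add: I_def mult_2)
  qed
  then have f: "safe V (For 1 (AddR 6 6)) (sem (Inc 6) (input_st x))"
      "sem (For 1 (AddR 6 6)) (sem (Inc 6) (input_st x)) = (input_st x)\<lparr>vl := (vl (input_st x))(6 := T)\<rparr>"
    by (simp_all only: I_def T)
  have "safe V size_com (input_st x)"
    unfolding size_com_def safe.simps(5) sem.simps(5) f(2) using f(1) wV(5) by (simp only: safe.simps(2) simp_thms) (simp add: input_state_def)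
  moreover have "sem size_com (input_st x) = (input_st x)\<lparr>vl := (vl (input_st x))(6 := T, 5 := w)\<rparr>"
    unfolding size_com_def sem.simps(5) f(2) using w by (simp add: input_state_def mult_2)
  ultimately show ?thesis
    using wV by (simp add: xin_def uinv_def input_state_def arr_False)
qed

lemma parse_com:
  assumes "xin V x s" "uinv V w T 0 0 (\<lambda>_. 0) 0 (\<lambda>_. 0) (\<lambda>_. 0) s" "bt s 2 = (\<lambda>_. False)" "vl s 2 = 0" "vl s 13 = 0"
  shows "safe V parse_com s \<and> xin V x (sem parse_com s) \<and>
    uinv V w T 0 0 (parsed w x) 0 (\<lambda>_. 0) (\<lambda>_. 0) (sem parse_com s)"
proof -
  define I where "I i t \<longleftrightarrow> xin V x t \<and> vl t 0 = i \<and> (vl t 13, vl t 2, bt t 2) = parse w (take i x) \<and>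
      uinv V w T 0 0 (parsed w (take i x)) 0 (\<lambda>_. 0) (\<lambda>_. 0) t" for i and t :: st
  let ?b = "IfB 0 (SetB 2 True ;; Inc 2) (Inc 13 ;; Zero 2 ;; MulAdd 2 13 5) ;; Inc 0"
  let ?s = "sem (Zero 0) s"
  have "safe V (For 1 ?b) ?s \<and> I (length x) (sem (For 1 ?b) ?s)"
  proof (rule For_inv)
    show "I 0 ?s" "vl ?s 1 = length x"
      using assms by (simp_all add: I_def xin_def uinv_def parse_def parsed_def arr_False)
    show "length x \<le> V" by (rule wV)
    fix i t assume i: "i < length x" and I: "I i t"
    obtain c p f where p: "parse w (take i x) = (c, p, f)"
      by (metis prod_cases3)
    have t: "vl t 13 = c" "vl t 2 = p" "bt t 2 = f"
      using I by (simp_all add: I_def p)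
    have step: "parse w (take (Suc i) x) = parse_bit w (c, p, f) (x ! i)"
      using i p by (simp add: parse_def take_Suc_conv_app_nth)
    have cp: "c \<le> i" "p \<le> i * w + i"
      using parse_bounds[of w "take i x"] p i by simp_all
    have iw: "i < w"
      using i wV(4) by simp
    have "i * w \<le> w * w" "c * w \<le> w * w"
      using iw cp(1) by (intro mult_le_mono1; simp)+
    moreover have "i * w + w * w + w + w + 20 \<le> V"
    proof -
      have "i * w \<le> w * w"
        by (rule mult_le_mono1) (use iw in simp)
      then have "i * w + w * w + w + w + 20 \<le> 3 * (w * w) + w + w + 20"
        by linarith
      also have "3 * (w * w) = 3 * w * w"
        by (rule mult.assoc[symmetric])
      finally show ?thesis
        using wV(1) by (rule order_trans)
    qed
    ultimately have b: "p \<le> V" "Suc p \<le> V" "c \<le> V" "Suc c \<le> V" "w + c * w \<le> V"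
      using cp iw wV(1) by linarith+
    have X: "bt t 0 i \<longleftrightarrow> x ! i" "vl t 0 = i"
      using I i by (simp_all add: I_def xin_def input_state_def)
    have wV': "w \<le> V" "Suc i \<le> V"
      using wV i by simp_all
    show "safe V ?b t \<and> I (Suc i) (sem ?b t)"
      using I b t X wV' step by (cases "x ! i") (simp_all add: I_def xin_def uinv_def parsed_def p)
  qed
  moreover have "safe V (Zero 0) s"
    using assms(1) by (simp add: xin_def)
  moreover have "take (length x) x = x"
    by simp
  ultimately show ?thesis
    unfolding parse_com_def I_def safe.simps(5)[of V "Zero 0"] sem.simps(5)[of "Zero 0"] by metis
qed

lemma param_com:
  assumes "xin V x s" "uinv V w T 0 0 E 0 H M s"
  shows "safe V param_com s \<and> xin V x (sem param_com s) \<and>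
    uinv V w T (E (tab 0)) (E (tab 1)) E (E (tab 2)) H M (sem param_com s)"
proof -
  have E: "E i \<le> w" for i
    using assms(2) unfolding uinv_def by (metis arr_le)
  have E': "E i \<le> V" for i
    using E[of i] wV(2) by linarith
  have "tab i \<le> addr_bound w" if "i \<le> 2" for i
    by (rule small_addr) (use that in \<open>simp add: tab_def power2_eq_square\<close>)
  note tab = addr_value[OF this]
  have t: "tab 0 * w + w \<le> V" "tab (Suc 0) * w + w \<le> V" "tab (Suc (Suc 0)) * w + w \<le> V"
      "tab 0 \<le> V" "tab (Suc 0) \<le> V" "tab (Suc (Suc 0)) \<le> V"
    by (rule order_trans[OF _ V], rule tab, simp)+
  have "2 \<le> V" "w \<le> V"
    using wV(2) by simp_all
  with t show ?thesis
    using assms E' by (simp add: param_com_def xin_def uinv_def numeral_2_eq_2)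
qed

lemma cells_com:
  assumes "xin V x s" "uinv V w T k B E q H (\<lambda>_. 0) s" "k \<le> w"
  shows "safe V cells_com s \<and> xin V x (sem cells_com s) \<and>
    uinv V w T k B E q H (input_cells x w T k (length x)) (sem cells_com s)"
proof -
  define I where "I i t \<longleftrightarrow> xin V x t \<and> vl t 0 = i \<and> vl t 13 = T * k + i * k \<and>
      uinv V w T k B E q H (input_cells x w T k i) t" for i and t :: st
  let ?b = "Zero 12 ;; Inc 12 ;; IfB 0 (Inc 12) Nop ;; Put 4 13 12 5 15 ;; AddR 13 7 ;; Inc 0"
  let ?s = "sem (MulAdd 13 6 7) (sem (Zero 13) (sem (Zero 0) s))"
  have kV: "k \<le> V" "w \<le> V" "2 \<le> V"
    using assms(3) wV(2) by simp_all
  have a: "T * k + i * k \<le> 3 * w * w + w" if "i \<le> length x" for i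
  proof -
    have "i \<le> w"
      using that wV(4) by simp
    then have "i * k \<le> w * w"
      using assms(3) by (rule mult_le_mono)
    moreover have "T * k \<le> w * w"
      by (rule mult_le_mono) (use assms(3) w in simp_all)
    ultimately show ?thesis by simp
  qed
  have aV: "T * k + i * k \<le> V" if "i \<le> length x" for i
    using a[OF that] wV(1) by simp
  have "safe V (For 1 ?b) ?s \<and> I (length x) (sem (For 1 ?b) ?s)"
  proof (rule For_inv)
    show "I 0 ?s" "vl ?s 1 = length x"
      using assms aV[of 0] by (simp_all add: I_def xin_def uinv_def)
    show "length x \<le> V" by (rule wV)
    fix i t assume i: "i < length x" and I: "I i t"
    let ?a = "T * k + i * k"
    have X: "bt t 0 i \<longleftrightarrow> x ! i"
      using I i by (simp add: I_def xin_def input_state_def)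
    have b: "?a * w + w \<le> V" "?a \<le> V" "?a + k \<le> V" "Suc i \<le> V" "Suc 0 \<le> V" "2 - w \<le> V" "Suc 0 - w \<le> V"
      using row_V[of ?a] a[of i] aV[of i] aV[of "Suc i"] i wV(1,3) kV(3) by simp_all
    have sw: "i * k + T * k = T * k + i * k" for i
      by simp
    show "safe V ?b t \<and> I (Suc i) (sem ?b t)"
      using I b kV X unfolding I_def
      by (cases "x ! i") (simp_all add: xin_def uinv_def numeral_2_eq_2 add_ac)
  qed
  moreover have "safe V (Zero 0) s" "safe V (Zero 13) (sem (Zero 0) s)" "safe V (MulAdd 13 6 7) (sem (Zero 13) (sem (Zero 0) s))"
    using assms(1,2) kV wV(5) by (simp_all add: xin_def uinv_def)
  ultimately show ?thesis
    unfolding cells_com_def I_def safe.simps(5)[of V "Zero v" for v] sem.simps(5)[of "Zero v" for v]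
      safe.simps(5)[of V "MulAdd 13 6 7"] sem.simps(5)[of "MulAdd 13 6 7"] by blast
qed

lemma heads_com:
  assumes "xin V x s" "uinv V w T k B E q (\<lambda>_. 0) M s" "k \<le> w"
  shows "safe V heads_com s \<and>
    uinv V w T k B E q (\<lambda>j. if j < k then min T w else 0) M (sem heads_com s)"
proof -
  define I where "I i t \<longleftrightarrow> vl t 10 = i \<and> uinv V w T k B E q (\<lambda>j. if j < i then min T w else 0) M t" for i and t :: st
  let ?b = "Put 3 10 6 5 15 ;; Inc 10"
  let ?s = "sem (Zero 10) s"
  have kV: "k \<le> V" "w \<le> V"
    using assms(3) wV(2) by simp_all
  have "safe V (For 7 ?b) ?s \<and> I k (sem (For 7 ?b) ?s)"
  proof (rule For_inv)
    show "I 0 ?s" "vl ?s 7 = k"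
      using assms by (simp_all add: I_def uinv_def)
    show "k \<le> V" by (rule kV)
    fix i t assume i: "i < k" and I: "I i t"
    have b: "i * w + w \<le> V" "Suc i \<le> V" "i \<le> V" "T - w \<le> V" "T \<le> V"
      using row_V[of i] i assms(3) kV wV(5) by simp_all
    have "(\<lambda>j. if j < i then min T w else 0)(i := min T w) = (\<lambda>j. if j < Suc i then min T w else 0)"
      by (auto simp: fun_eq_iff)
    then show "safe V ?b t \<and> I (Suc i) (sem ?b t)"
      using I b kV unfolding I_def by (simp add: uinv_def)
  qed
  moreover have "safe V (Zero 10) s"
    using assms(2) by (simp add: uinv_def)
  ultimately show ?thesis
    unfolding heads_com_def I_def safe.simps(5)[of V "Zero 10"] sem.simps(5)[of "Zero 10"] by blast
qed

text \<open>It has to hold for every input, also for one that describes no machine. All array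
  entries are at most \<open>w\<close>, being counts of bits in rows of width \<open>w\<close>, and
  this bounds the addresses.\<close>

lemma universal_com:
  "safe V universal_com (input_st x)" "vl (sem universal_com (input_st x)) 16 = uresult x"
proof -
  define E where "E = parsed w x"
  define k where "k = E (tab 0)"
  define B where "B = E (tab 1)"
  have E: "E i \<le> w" for i
    unfolding E_def parsed_def by (rule arr_le)
  then have kB: "k \<le> w" "B \<le> w"
    by (simp_all add: k_def B_def)
  let ?s1 = "sem size_com (input_st x)"
  let ?s2 = "sem parse_com ?s1"
  let ?s3 = "sem param_com ?s2"
  let ?s4 = "sem cells_com ?s3"
  let ?s5 = "sem heads_com ?s4"
  let ?s6 = "sem (For 6 step_com) ?s5"
  note 1 = size_com
  have 2: "safe V parse_com ?s1 \<and> xin V x ?s2 \<and> uinv V w T 0 0 E 0 (\<lambda>_. 0) (\<lambda>_. 0) ?s2"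
    unfolding E_def using 1 by (intro parse_com) blast+
  have 3: "safe V param_com ?s2 \<and> xin V x ?s3 \<and> uinv V w T k B E (E (tab 2)) (\<lambda>_. 0) (\<lambda>_. 0) ?s3"
    unfolding k_def B_def using 2 by (intro param_com) blast+
  have 4: "safe V cells_com ?s3 \<and> xin V x ?s4 \<and> uinv V w T k B E (E (tab 2)) (\<lambda>_. 0) (input_cells x w T k (length x)) ?s4"
    using 3 kB(1) by (intro cells_com) blast+
  have 5: "safe V heads_com ?s4 \<and> uinv V w T k B E (E (tab 2)) (\<lambda>j. if j < k then min T w else 0) (input_cells x w T k (length x)) ?s5"
    using 4 kB(1) by (intro heads_com) blast+
  define U where "U i = (ustep w T k B E ^^ i) (uinit w T k E x)" for i
  define I where "I i t \<longleftrightarrow> (\<exists>q H M. U i = (q, H, M) \<and> uinv V w T k B E q H M t \<and> q \<le> w)" for i t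
  have "safe V (For 6 step_com) ?s5 \<and> I T ?s6"
  proof (rule For_inv)
    show "I 0 ?s5"
      using 5 E by (simp add: I_def U_def uinit_def)
    show "vl ?s5 6 = T"
      using 5 by (simp add: uinv_def)
    show "T \<le> V" by (rule wV)
    fix i t assume "I i t"
    then obtain q H M where I: "U i = (q, H, M)" "uinv V w T k B E q H M t" "q \<le> w"
      unfolding I_def by blast
    obtain q' H' M' where st: "ustep w T k B E (q, H, M) = (q', H', M')"
      by (metis prod_cases3)
    have "safe V step_com t \<and> uinv V w T k B E q' H' M' (sem step_com t) \<and> q' \<le> w"
      by (rule step_com[OF V _ kB E I(2,3) _ st]) (simp_all add: w)
    moreover have "U (Suc i) = (q', H', M')"
      using I(1) st by (simp add: U_def)
    ultimately show "safe V step_com t \<and> I (Suc i) (sem step_com t)"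
      unfolding I_def by blast
  qed
  note 6 = this
  then obtain q H M where I: "U T = (q, H, M)" "uinv V w T k B E q H M ?s6" "q \<le> w"
    unfolding I_def by blast
  have 7: "safe V flag_com ?s6 \<and> vl (sem flag_com ?s6) 16 = E (3 * q + 1)"
    using flag_com[OF V _ kB E I(2,3)] w by simp
  show "safe V universal_com (input_st x)"
    using 1 2 3 4 5 6 7 unfolding universal_com_def by (simp only: safe.simps(3,5) sem.simps(5) simp_thms)
  have "uresult x = E (3 * q + 1) - 2"
    using I(1) unfolding uresult_def U_def k_def B_def E_def w T by (simp add: Let_def)
  moreover have "vl (sem universal_com (input_st x)) 16 = vl (sem flag_com ?s6) 16 - 2"
    unfolding universal_com_def by (simp only: sem.simps(3,5)) simp
  ultimately show "vl (sem universal_com (input_st x)) 16 = uresult x"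
    using 7 by simp
qed

end

section \<open>Encoding finite tables in inputs\<close>

text \<open>The final zero bits only append zero entries; they bring the input to a prescribed
  length without changing the table.\<close>

definition encode :: "nfun \<Rightarrow> nat \<Rightarrow> nat \<Rightarrow> bool list" where
  "encode E N z = concat (map (\<lambda>i. replicate (E i) True @ [False]) [0..<N]) @ replicate z False"

lemma foldl_parse_True:
  "foldl (parse_bit w) (i, p, f) (replicate c True) = (i, p + c, (\<lambda>a. f a \<or> p \<le> a \<and> a < p + c))"
proof (induction c arbitrary: p f)
  case (Suc c)
  have "(\<lambda>a. (f(p := True)) a \<or> Suc p \<le> a \<and> a < Suc p + c) = (\<lambda>a. f a \<or> p \<le> a \<and> a < p + Suc c)"
    by (auto simp: fun_eq_iff)
  then show ?case
    using Suc[of "Suc p" "f(p := True)"] by (simp del: fun_upd_apply)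
qed (auto simp: fun_eq_iff)

lemma foldl_parse_False: "snd (snd (foldl (parse_bit w) (i, p, f) (replicate c False))) = f"
  by (induction c arbitrary: i p) simp_all

lemma parse_prefix:
  "foldl (parse_bit w) (0, 0, \<lambda>_. False) (concat (map (\<lambda>i. replicate (E i) True @ [False]) [0..<N])) =
    (N, N * w, (\<lambda>a. \<exists>i<N. i * w \<le> a \<and> a < i * w + E i))"
proof (induction N)
  case (Suc N)
  have "(\<lambda>a. (\<exists>i<N. i * w \<le> a \<and> a < i * w + E i) \<or> N * w \<le> a \<and> a < N * w + E N) =
      (\<lambda>a. \<exists>i<Suc N. i * w \<le> a \<and> a < i * w + E i)"
    by (auto simp: fun_eq_iff less_Suc_eq)
  then show ?case
    using Suc by (simp add: foldl_parse_True)
qed simp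

text \<open>Entries of size at most \<open>w\<close> fit into their own rows, so the unary blocks do
  not interfere.\<close>

lemma parsed_encode:
  assumes "\<And>i. E i \<le> w" "\<And>i. N \<le> i \<Longrightarrow> E i = 0"
  shows "parsed w (encode E N z) = E"
proof
  fix i
  have "snd (snd (parse w (encode E N z))) = (\<lambda>a. \<exists>i<N. i * w \<le> a \<and> a < i * w + E i)"
    unfolding parse_def encode_def foldl_append parse_prefix by (rule foldl_parse_False)
  moreover have "{u. u < w \<and> (\<exists>j<N. j * w \<le> i * w + u \<and> i * w + u < j * w + E j)} = {..<E i}" (is "?l = ?r")
  proof
    show "?l \<subseteq> ?r"
    proof
      fix u assume "u \<in> ?l"
      then obtain j where u: "u < w" and j: "j < N" "j * w \<le> i * w + u" "i * w + u < j * w + E j"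
        by blast
      have "i * w < Suc j * w" "j * w < Suc i * w"
        using u j assms(1)[of j] by simp_all
      then have "i < Suc j" "j < Suc i"
        by (simp_all only: mult_less_cancel2)
      then have "i = j"
        by simp
      then show "u \<in> ?r"
        using j(3) by simp
    qed
    show "?r \<subseteq> ?l"
    proof
      fix u assume "u \<in> ?r"
      then have "u < E i"
        by simp
      moreover from this have "i < N"
        using assms(2)[of i] by (cases "i < N") auto
      ultimately show "u \<in> ?l"
        using assms(1)[of i] by auto
    qed
  qed
  ultimately show "parsed w (encode E N z) i = E i"
    by (simp add: parsed_def arr_def)
qed

lemma length_encode: "length (encode E N z) = (\<Sum>i<N. E i + 1) + z"
  by (induction N) (simp_all add: encode_def)

lemma encode_exists:
  assumes "\<And>i. E i \<le> w" "\<And>i. N \<le> i \<Longrightarrow> E i = 0" "\<And>i. E i \<le> D" "N * (D + 1) \<le> n"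
  obtains x where "length x = n" "parsed w x = E"
proof -
  have "(\<Sum>i<N. E i + 1) \<le> of_nat (card {..<N}) * (D + 1)"
    by (rule sum_bounded_above) (use assms(3) in simp)
  then have "(\<Sum>i<N. E i + 1) \<le> n"
    using assms(4) by simp
  then have "length (encode E N (n - (\<Sum>i<N. E i + 1))) = n"
    by (simp add: length_encode)
  then show thesis
    by (rule that) (rule parsed_encode[OF assms(1,2)])
qed

section \<open>Codes of strings and descriptions of oracle machines\<close>

definition scode :: "bool list \<Rightarrow> nat" where
  "scode s = foldl (\<lambda>a b. 2 * a + of_bool b) 1 s"

lemma scode_snoc: "scode (s @ [b]) = 2 * scode s + of_bool b"
  by (simp add: scode_def)

lemma scode_pos: "0 < scode s"
  by (induction s rule: rev_induct) (simp_all add: scode_snoc, simp add: scode_def)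

lemma scode_less: "scode s < 2 ^ Suc (length s)"
proof (induction s rule: rev_induct)
  case (snoc b s)
  then show ?case
    by (cases b) (simp_all add: scode_snoc)
qed (simp add: scode_def)

lemma scode_inj: "scode s = scode s' \<Longrightarrow> s = s'"
proof (induction s arbitrary: s' rule: rev_induct)
  case Nil
  show ?case
  proof (cases s' rule: rev_cases)
    case (snoc t b)
    then have "scode s' \<ge> 2"
      using scode_pos[of t] by (simp add: scode_snoc)
    then show ?thesis
      using Nil by (simp add: scode_def)
  qed simp
next
  case (snoc b s)
  show ?case
  proof (cases s' rule: rev_cases)
    case Nil
    then show ?thesis
      using snoc.prems scode_pos[of s] by (cases b) (simp_all add: scode_snoc, simp_all add: scode_def)
  next
    case (snoc t b')
    have eq: "2 * scode s + of_bool b = 2 * scode t + of_bool b'"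
      using snoc.prems snoc by (simp add: scode_snoc)
    then have "b = b'"
      by (cases b; cases b') (simp_all, presburger+)
    then show ?thesis
      using eq snoc snoc.IH by simp
  qed
qed

definition tidx :: "nat \<Rightarrow> nat \<Rightarrow> nat list \<Rightarrow> nat" where
  "tidx B q ss = foldl (\<lambda>a s. a * B + s) q ss"

lemma tidx_snoc: "tidx B q (ss @ [s]) = tidx B q ss * B + s"
  by (simp add: tidx_def)

text \<open>The symbols are recovered one by one as remainders; the state is the leading digit and
  may exceed the base.\<close>

lemma tidx_inj:
  assumes "length ss = length ss'" "set ss \<subseteq> {..<B}" "set ss' \<subseteq> {..<B}" "tidx B q ss = tidx B q' ss'"
  shows "q = q' \<and> ss = ss'"
  using assms
proof (induction ss arbitrary: ss' rule: rev_induct)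
  case Nil
  then show ?case by (simp add: tidx_def)
next
  case (snoc s ss)
  then obtain t ts where t: "ss' = ts @ [t]" "length ts = length ss"
    by (cases ss' rule: rev_cases) auto
  have eq: "tidx B q ss * B + s = tidx B q' ts * B + t" and st: "s < B" "t < B"
    using snoc.prems t by (auto simp: tidx_snoc)
  have "s = (tidx B q ss * B + s) mod B" "t = (tidx B q' ts * B + t) mod B"
    using st by simp_all
  then have s: "s = t"
    using eq by simp
  then have "tidx B q ss = tidx B q' ts"
    using eq st by simp
  then show ?case
    using snoc.IH[of ts] snoc.prems t s by simp
qed

definition move_num :: "move \<Rightarrow> nat" where
  "move_num m = (case m of Go_Left \<Rightarrow> 0 | Stay \<Rightarrow> 1 | Go_Right \<Rightarrow> 2)"

definition tabulates :: "oracle_tm \<Rightarrow> nfun \<Rightarrow> bool" where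
  "tabulates M t \<longleftrightarrow>
     (\<forall>q ss q' as. q < num_states M \<longrightarrow> length ss = num_tapes M \<longrightarrow> set ss \<subseteq> {..<num_symbols M} \<longrightarrow>
       delta M q ss = (q', as) \<longrightarrow>
       (let e = tidx (num_symbols M) q ss * (2 * num_tapes M + 1)
        in t e = q' \<and> (\<forall>j<num_tapes M. t (e + (1 + 2 * j)) = fst (as ! j) \<and>
             t (e + (2 + 2 * j)) = move_num (snd (as ! j)))))"

definition describes :: "oracle_tm \<Rightarrow> language \<Rightarrow> nfun \<Rightarrow> bool" where
  "describes M F E \<longleftrightarrow>
     (\<forall>s. E (3 * scode s) = 0 \<longleftrightarrow> s \<notin> F) \<and>
     (\<forall>q<num_states M. E (3 * q + 1) =
       (if q = query M then 1 else if q = reject M then 2 else if q = accept M then 3 else 0)) \<and>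
     E (tab 0) = num_tapes M \<and> E (tab 1) = num_symbols M \<and> E (tab 2) = start M \<and>
     E (tab 3) = answer_yes M \<and> E (tab 4) = answer_no M \<and> tabulates M (\<lambda>b. E (tab (5 + b)))"

text \<open>By \<open>tidx_inj\<close> distinct pairs of state and symbols have distinct rows, so
  the table is defined by inverting the index; it ends because there are finitely many
  pairs.\<close>

lemma table_exists:
  fixes M :: oracle_tm
  assumes "wf_tm M"
  shows "\<exists>(t :: nat \<Rightarrow> nat) N. (\<forall>i\<ge>N. t i = 0) \<and> tabulates M t"
proof -
  let ?k = "num_tapes M" and ?B = "num_symbols M"
  let ?D = "{..<num_states M} \<times> {ss. set ss \<subseteq> {..<?B} \<and> length ss = ?k}"
  let ?i = "\<lambda>(q, ss). tidx ?B q ss"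
  have fin: "finite ?D"
    by (intro finite_cartesian_product finite_lists_length_eq) simp_all
  have inj: "inj_on ?i ?D"
  proof (rule inj_onI)
    fix a b assume ab: "a \<in> ?D" "b \<in> ?D" "?i a = ?i b"
    then have "fst a = fst b \<and> snd a = snd b"
      by (intro tidx_inj[of "snd a" "snd b" ?B]) (auto simp: case_prod_beta)
    then show "a = b"
      by (simp add: prod_eq_iff)
  qed
  \<comment> \<open>Column 0 is the next state, column 1 + 2 * j the symbol and column 2 + 2 * j the
    move for tape \<open>j\<close>; the divisions recover \<open>j\<close>.\<close>
  define ent where "ent i l = (let (q, ss) = inv_into ?D ?i i; (q', as) = delta M q ss
    in if l = 0 then q' else if odd l then fst (as ! (l div 2)) else move_num (snd (as ! (l div 2 - 1))))" for i l
  define t where "t b = (if b div (2 * ?k + 1) \<in> ?i ` ?D then ent (b div (2 * ?k + 1)) (b mod (2 * ?k + 1)) else 0)" for b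
  define N where "N = (Max (insert 0 (?i ` ?D)) + 1) * (2 * ?k + 1)"
  have t: "t (tidx ?B q ss * (2 * ?k + 1) + l) = (let (q', as) = delta M q ss
    in if l = 0 then q' else if odd l then fst (as ! (l div 2)) else move_num (snd (as ! (l div 2 - 1))))"
    if "q < num_states M" "length ss = ?k" "set ss \<subseteq> {..<?B}" "l < 2 * ?k + 1" for q ss l
  proof -
    let ?b = "tidx ?B q ss * (2 * ?k + 1) + l"
    have b: "?b div (2 * ?k + 1) = tidx ?B q ss" "?b mod (2 * ?k + 1) = l"
      using that(4) by (simp_all add: div_mult_self3 del: mult_Suc_right)
    have D: "(q, ss) \<in> ?D"
      using that by simp
    have "tidx ?B q ss \<in> ?i ` ?D"
      using imageI[OF D, of ?i] by simp
    moreover have "inv_into ?D ?i (tidx ?B q ss) = (q, ss)"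
      using inv_into_f_f[OF inj D] by simp
    ultimately show ?thesis
      unfolding t_def b ent_def by simp
  qed
  show ?thesis
    unfolding tabulates_def Let_def
  proof (rule exI[of _ t], rule exI[of _ N], intro conjI allI impI)
    fix i assume "N \<le> i"
    then have "Max (insert 0 (?i ` ?D)) + 1 \<le> i div (2 * ?k + 1)"
      unfolding N_def by (simp add: less_eq_div_iff_mult_less_eq)
    then have "i div (2 * ?k + 1) \<notin> ?i ` ?D"
      using Max_ge[of "insert 0 (?i ` ?D)" "i div (2 * ?k + 1)"] fin by fastforce
    then show "t i = 0"
      by (simp only: t_def if_False)
  next
    fix q ss q' as
    assume *: "q < num_states M" "length ss = ?k" "set ss \<subseteq> {..<?B}" "delta M q ss = (q', as)"
    show "t (tidx ?B q ss * (2 * ?k + 1)) = q'"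
      using t[OF *(1-3), of 0] *(4) by simp
    fix j assume "j < ?k"
    then show "t (tidx ?B q ss * (2 * ?k + 1) + (1 + 2 * j)) = fst (as ! j)"
      "t (tidx ?B q ss * (2 * ?k + 1) + (2 + 2 * j)) = move_num (snd (as ! j))"
      using t[OF *(1-3), of "1 + 2 * j"] t[OF *(1-3), of "2 + 2 * j"] *(4) by simp_all
  qed
qed

text \<open>\<open>C\<close> and \<open>D\<close> depend on \<open>M\<close> only, so the description of a large finite oracle is dominated by the oracle.\<close>

lemma description_exists:
  fixes M :: oracle_tm
  assumes "wf_tm M"
  obtains C D :: nat where "\<And>F m. \<forall>s\<in>F. length s < m \<Longrightarrow>
    \<exists>E. describes M F E \<and> (\<forall>i. E i \<le> D) \<and> (\<forall>i\<ge>3 * (C + 2 ^ m). E i = 0)"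
proof -
  obtain t N where t': "\<forall>i\<ge>N. t i = (0::nat)" and tt: "tabulates M t"
    using table_exists[OF assms] by blast
  note t = t'[rule_format]
  define par where "par b = (if b < 5 then [num_tapes M, num_symbols M, start M, answer_yes M, answer_no M] ! b else t (b - 5))" for b
  define flag where "flag q = (if q < num_states M then if q = query M then 1 else if q = reject M then 2 else if q = accept M then 3 else 0 else (0::nat))" for q
  define C where "C = N + 5 + num_states M"
  \<comment> \<open>\<open>par\<close> vanishes from \<open>C\<close> on, so it has a maximum, and
    this does not depend on the oracle.\<close>
  have fin: "finite (range par)"
  proof (rule finite_subset)
    show "range par \<subseteq> insert 0 (par ` {..<C})"
    proof
      fix y assume "y \<in> range par"
      then obtain b where y: "y = par b"
        by blast
      show "y \<in> insert 0 (par ` {..<C})"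
      proof (cases "b < C")
        case False
        then have "par b = 0"
          by (simp add: par_def C_def t)
        then show ?thesis
          by (simp add: y)
      qed (simp add: y)
    qed
  qed simp
  define P where "P = Max (range par)"
  define D where "D = 3 + P"
  have par_le: "par b \<le> D" for b
    using Max_ge[OF fin rangeI[of par b]] unfolding D_def P_def by (rule trans_le_add2)
  have "flag q \<le> 3" for q
    by (simp add: flag_def)
  then have flag_le: "flag q \<le> D" for q
    unfolding D_def by (rule trans_le_add1)
  have D3: "3 \<le> D"
    unfolding D_def by (rule le_add1)
  show thesis
  proof (rule that[of D C])
    fix F :: language and m
    assume F: "\<forall>s\<in>F. length s < (m::nat)"
    define E where "E i = (if i mod 3 = 0 then (if i div 3 \<in> scode ` F then 1 else 0)
      else if i mod 3 = 1 then flag (i div 3) else par (i div 3))" for i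
    have E: "E (3 * c) = (if c \<in> scode ` F then 1 else 0)" "E (3 * c + 1) = flag c" "E (tab c) = par c" for c
    proof -
      have "(3 * c + 1) mod 3 = 1" "(3 * c + 1) div 3 = c" "(3 * c + 2) mod 3 = 2" "(3 * c + 2) div 3 = c"
        by presburger+
      then show "E (3 * c) = (if c \<in> scode ` F then 1 else 0)" "E (3 * c + 1) = flag c" "E (tab c) = par c"
        unfolding E_def tab_def by simp_all
    qed
    have p5: "par (5 + b) = t b" for b
      by (simp add: par_def)
    have "describes M F E"
      unfolding describes_def E p5
    proof (intro conjI)
      show "\<forall>s. ((if scode s \<in> scode ` F then 1 else 0) = (0::nat)) = (s \<notin> F)"
      proof
        fix s
        have "scode s \<in> scode ` F \<longleftrightarrow> s \<in> F"
          using scode_inj by blast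
        then show "((if scode s \<in> scode ` F then 1 else 0) = (0::nat)) = (s \<notin> F)"
          by simp
      qed
      show "\<forall>q<num_states M. flag q = (if q = query M then 1 else if q = reject M then 2 else if q = accept M then 3 else 0)"
        by (simp add: flag_def)
    qed (rule tt | simp add: par_def)+
    moreover have "E i \<le> D" for i
    proof -
      consider "E i \<le> 1" | "E i = flag (i div 3)" | "E i = par (i div 3)"
        unfolding E_def by (cases "i mod 3 = 0"; cases "i mod 3 = 1"; cases "i div 3 \<in> scode ` F") simp_all
      then show ?thesis
        using flag_le[of "i div 3"] par_le[of "i div 3"] D3 by cases linarith+
    qed
    moreover have "E i = 0" if i: "i \<ge> 3 * (C + 2 ^ m)" for i
    proof -
      \<comment> \<open>From here on all three tables are exhausted, as strings shorter than
        \<open>m\<close> have codes below 2^m.\<close>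
      have d: "C + 2 ^ m \<le> i div 3"
        using div_le_mono[OF i, of 3] by simp
      have "c < 2 ^ m" if c: "c \<in> scode ` F" for c
      proof -
        obtain s where s: "s \<in> F" "c = scode s"
          using c by blast
        have "(2::nat) ^ Suc (length s) \<le> 2 ^ m"
          using F s(1) by (intro power_increasing) auto
        then show ?thesis
          using scode_less[of s] s(2) by simp
      qed
      then have "i div 3 \<notin> scode ` F"
        using d by (metis add_leD2 not_less)
      moreover have "flag (i div 3) = 0" "par (i div 3) = 0"
        using d t by (simp_all add: flag_def par_def C_def)
      ultimately show ?thesis
        by (simp add: E_def)
    qed
    ultimately show "\<exists>E. describes M F E \<and> (\<forall>i. E i \<le> D) \<and> (\<forall>i\<ge>3 * (C + 2 ^ m). E i = 0)"
      by blast
  qed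
qed

section \<open>Simulation of an oracle machine\<close>

lemma cell_index_inj:
  fixes k :: nat
  assumes "i < k" "j < k"
  shows "p * k + j = p' * k + i \<longleftrightarrow> p = p' \<and> j = i"
proof
  assume eq: "p * k + j = p' * k + i"
  have "(p * k + j) div k = p" "(p' * k + i) div k = p'"
    using assms by simp_all
  then have "p = p'"
    using eq by simp
  then show "p = p' \<and> j = i"
    using eq by simp
qed simp

lemma code_index_tidx: "code_index k B q H S i = tidx B q (map (\<lambda>j. S (H j * k + j)) [0..<i])"
  by (induction i) (simp_all add: tidx_snoc, simp add: tidx_def)

lemma apply_acts_fst:
  "fst (apply_acts w k E e H S i) j = (if j < i then min (H j + E (tab (e + 2 + 2 * j)) - 1) w else H j)"
  by (induction i) (auto simp: case_prod_beta less_Suc_eq)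

lemma apply_acts_snd:
  assumes "i \<le> k" "j < k"
  shows "snd (apply_acts w k E e H S i) (p * k + j) =
    (if j < i \<and> p = H j then min (E (tab (e + 1 + 2 * j))) w else S (p * k + j))"
  using assms(1)
proof (induction i)
  case (Suc i)
  have "fst (apply_acts w k E e H S i) i = H i"
    by (simp add: apply_acts_fst)
  moreover have "p * k + j = H i * k + i \<longleftrightarrow> p = H i \<and> j = i"
    by (rule cell_index_inj) (use Suc.prems assms(2) in simp_all)
  ultimately show ?case
    using Suc by (auto simp: case_prod_beta less_Suc_eq)
qed simp

lemma scan_query_prefix:
  assumes "\<And>i. i < l \<Longrightarrow> g i = 1 \<or> g i = 2" "i \<le> l"
  shows "scan_query g i = (0, scode (map (\<lambda>i. g i = 2) [0..<i]))"
  using assms(2)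
proof (induction i)
  case (Suc i)
  then have "g i = 1 \<or> g i = 2"
    using assms(1) by simp
  then show ?case
    using Suc by (auto simp: scode_snoc)
qed (simp add: scode_def)

lemma scan_query_code:
  assumes "\<And>i. i < l \<Longrightarrow> g i = 1 \<or> g i = 2" "g l \<noteq> 1" "g l \<noteq> 2" "l \<le> T"
  shows "snd (scan_query g T) = scode (map (\<lambda>i. g i = 2) [0..<l])"
proof -
  have pre: "scan_query g l = (0, scode (map (\<lambda>i. g i = 2) [0..<l]))"
    using scan_query_prefix[of l g l] assms(1) by simp
  have "scan_query g (Suc l + d) = (1, scode (map (\<lambda>i. g i = 2) [0..<l]))" for d
    using pre assms(2,3) by (induction d) simp_all
  from this[of "T - Suc l"] show ?thesis
    using pre assms(4) by (cases "T = l") simp_all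
qed

text \<open>A blank at cell \<open>t\<close> ends the string no later than there, so a scan of
  \<open>T\<close> cells sees all of it. The length bound confines queries to lengths on which the
  finite oracle is correct.\<close>

lemma tape_string_scan:
  assumes "\<And>i. cells tp (int i) = g i" "g t = 0" "t \<le> T"
  shows "snd (scan_query g T) = scode (tape_string tp) \<and> length (tape_string tp) \<le> t"
proof -
  define l where "l = (LEAST n. cells tp (int n) \<notin> range bit_sym)"
  have range: "a \<in> range bit_sym \<longleftrightarrow> a = 1 \<or> a = 2" for a
    by (auto simp: bit_sym_def image_iff)
  have blank: "cells tp (int t) \<notin> range bit_sym"
    unfolding range using assms(1,2) by simp
  have l: "cells tp (int l) \<notin> range bit_sym" "l \<le> t"
    using LeastI[of "\<lambda>n. cells tp (int n) \<notin> range bit_sym", OF blank]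
      Least_le[of "\<lambda>n. cells tp (int n) \<notin> range bit_sym", OF blank] unfolding l_def by blast+
  have "cells tp (int i) \<in> range bit_sym" if "i < l" for i
    using not_less_Least[of i "\<lambda>n. cells tp (int n) \<notin> range bit_sym"] that unfolding l_def by blast
  then have "snd (scan_query g T) = scode (map (\<lambda>i. g i = 2) [0..<l])"
    by (intro scan_query_code) (use l assms(1,3) in \<open>simp_all add: range\<close>)
  moreover have "tape_string tp = map (\<lambda>i. g i = 2) [0..<l]"
    unfolding tape_string_def l_def[symmetric] by (simp add: assms(1) bit_sym_def)
  ultimately show ?thesis
    using l(2) by simp
qed

text \<open>Two clauses limit the speed: after \<open>t\<close> steps every head is within distance
  \<open>t\<close> of cell 0, and the oracle tape is blank from cell \<open>t\<close> on. The former
  keeps positions between 0 and \<open>w\<close>, the latter keeps queries short.\<close>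

definition sim :: "oracle_tm \<Rightarrow> nat \<Rightarrow> config \<Rightarrow> nat \<Rightarrow> nat \<times> nfun \<times> nfun \<Rightarrow> bool" where
  "sim M T c t = (\<lambda>(q, H, S). q = state c \<and> config_ok M c \<and>
     (\<forall>j<num_tapes M. int (H j) = head (tapes c ! j) + int T \<and> \<bar>head (tapes c ! j)\<bar> \<le> int t) \<and>
     (\<forall>j<num_tapes M. \<forall>p. S (p * num_tapes M + j) = cells (tapes c ! j) (int p - int T)) \<and>
     (\<forall>i\<ge>int t. cells (tapes c ! 1) i = 0))"

lemma sim_Suc: "sim M T c t u \<Longrightarrow> sim M T c (Suc t) u"
  unfolding sim_def by fastforce

lemma head_act: "head (act (s, m) t) = head t + int (move_num m) - 1"
  by (cases t) (simp add: move_num_def split: move.splits)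

text \<open>A query at time t < T is no longer than \<open>t\<close>, where \<open>X\<close> and
  \<open>F\<close> agree, so the true and the finite oracle give the same answer.\<close>

lemma sim_step:
  assumes wf: "wf_oracle_tm M" and E: "describes M F E" "\<And>i. E i \<le> w" and w: "2 * T \<le> w"
    and F: "\<And>s. length s \<le> T \<Longrightarrow> s \<in> X \<longleftrightarrow> s \<in> F"
    and t: "t < T" and sim: "sim M T c t u"
  shows "sim M T (oracle_step X M c) (Suc t) (ustep w T (num_tapes M) (num_symbols M) E u)"
proof -
  let ?k = "num_tapes M" and ?B = "num_symbols M"
  obtain q H S where u: "u = (q, H, S)"
    by (metis prod_cases3)
  have wf': "wf_tm M" and k2: "2 \<le> ?k" and qr: "query M \<noteq> accept M" "query M \<noteq> reject M"
    and ans: "answer_yes M < num_states M" "answer_no M < num_states M"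
    using wf by (simp_all add: wf_oracle_tm_def)
  have q: "q = state c" and ok: "config_ok M c"
    and H: "\<And>j. j < ?k \<Longrightarrow> int (H j) = head (tapes c ! j) + int T"
    and hd: "\<And>j. j < ?k \<Longrightarrow> \<bar>head (tapes c ! j)\<bar> \<le> int t"
    and S: "\<And>j p. j < ?k \<Longrightarrow> S (p * ?k + j) = cells (tapes c ! j) (int p - int T)"
    and blank: "\<And>i. int t \<le> i \<Longrightarrow> cells (tapes c ! 1) i = 0"
    using sim by (simp_all add: u sim_def)
  have st: "state c < num_states M" and len: "length (tapes c) = ?k"
    using ok by (simp_all add: config_ok_def)
  have flag: "E (3 * q + 1) = (if q = query M then 1 else if q = reject M then 2 else if q = accept M then 3 else 0)"
    using E(1) st unfolding describes_def q by blast
  show ?thesis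
  proof (cases "q = query M")
    case True
    define g where "g = (\<lambda>i. S ((T + i) * ?k + 1))"
    let ?s = "tape_string (tapes c ! 1)"
    have g: "cells (tapes c ! 1) (int i) = g i" for i
      using S[of 1 "T + i"] k2 by (simp add: g_def)
    have scan: "snd (scan_query g T) = scode ?s \<and> length ?s \<le> t"
      by (rule tape_string_scan) (use g blank[of "int t"] t in auto)
    have "E (3 * scode ?s) = 0 \<longleftrightarrow> ?s \<notin> X"
      using E(1) F[of ?s] scan t unfolding describes_def by simp
    moreover have "E (tab 3) = answer_yes M" "E (tab 4) = answer_no M"
      using E(1) unfolding describes_def by blast+
    ultimately have "ustep w T ?k ?B E u = (if ?s \<in> X then answer_yes M else answer_no M, H, S)"
      using flag scan[unfolded g_def] True by (simp add: u ustep_def Let_def)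
    moreover have "oracle_step X M c = c\<lparr>state := if ?s \<in> X then answer_yes M else answer_no M\<rparr>"
      using True q by (simp add: oracle_step_def)
    ultimately have "sim M T (oracle_step X M c) t (ustep w T ?k ?B E u)"
      using sim ans by (auto simp: sim_def u config_ok_def)
    then show ?thesis
      by (rule sim_Suc)
  next
    case False
    then have os: "oracle_step X M c = step M c"
      using q by (simp add: oracle_step_def)
    show ?thesis
    proof (cases "halted M c")
      case True
      then have "E (3 * q + 1) > 1"
        using flag False q by (auto simp: halted_def)
      then have "ustep w T ?k ?B E u = u"
        by (simp add: u ustep_def Let_def)
      then show ?thesis
        using True sim os by (simp add: step_def sim_Suc)
    next
      case nh: False
      then have flag0: "E (3 * q + 1) = 0"
        using flag False q by (auto simp: halted_def)
      obtain q' as where d: "delta M (state c) (map read (tapes c)) = (q', as)"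
        by fastforce
      have as: "length as = ?k"
        using wf'[unfolded wf_tm_def] st config_ok_reads[OF ok] d by metis
      have sc: "step M c = \<lparr>state = q', tapes = map2 act as (tapes c)\<rparr>"
        using nh d by (simp add: step_def)
      have reads: "map (\<lambda>j. S (H j * ?k + j)) [0..<?k] = map read (tapes c)"
      proof (rule nth_equalityI)
        fix j assume "j < length (map (\<lambda>j. S (H j * ?k + j)) [0..<?k])"
        then have j: "j < ?k"
          by simp
        have "S (H j * ?k + j) = read (tapes c ! j)"
          unfolding read_def S[OF j] using H[OF j] by simp
        then show "map (\<lambda>j. S (H j * ?k + j)) [0..<?k] ! j = map read (tapes c) ! j"
          using j len by simp
      qed (simp add: len)
      define e where "e = 5 + code_index ?k ?B q H S ?k * (2 * ?k + 1)"
      have e: "e = 5 + tidx ?B (state c) (map read (tapes c)) * (2 * ?k + 1)"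
        unfolding e_def code_index_tidx reads q by simp
      let ?X = "tidx ?B (state c) (map read (tapes c)) * (2 * ?k + 1)"
      have "E (tab (5 + ?X)) = q' \<and> (\<forall>j<?k. E (tab (5 + (?X + (1 + 2 * j)))) = fst (as ! j) \<and>
          E (tab (5 + (?X + (2 + 2 * j)))) = move_num (snd (as ! j)))"
        using E(1) st config_ok_reads[OF ok] d unfolding describes_def tabulates_def Let_def by blast
      then have Ee: "E (tab e) = q'" "\<And>j. j < ?k \<Longrightarrow> E (tab (e + 1 + 2 * j)) = fst (as ! j)"
        "\<And>j. j < ?k \<Longrightarrow> E (tab (e + 2 + 2 * j)) = move_num (snd (as ! j))"
        unfolding e add.assoc by blast+
      define H' where "H' = fst (apply_acts w ?k E e H S ?k)"
      define S' where "S' = snd (apply_acts w ?k E e H S ?k)"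
      have us: "ustep w T ?k ?B E u = (q', H', S')"
      proof -
        have "ustep w T ?k ?B E u = (E (tab e), apply_acts w ?k E e H S ?k)"
          by (simp only: u ustep_def prod.case Let_def flag0 e_def simp_thms if_True)
        then show ?thesis
          by (simp add: Ee(1) H'_def S'_def)
      qed
      have tp: "tapes (step M c) ! j = act (as ! j) (tapes c ! j)" if "j < ?k" for j
        using that as len by (simp add: sc)
      have hd': "head (tapes (step M c) ! j) = head (tapes c ! j) + int (move_num (snd (as ! j))) - 1" if "j < ?k" for j
        unfolding tp[OF that] using head_act[of "fst (as ! j)" "snd (as ! j)"] by simp
      have mv: "move_num m \<le> 2" for m
        by (simp add: move_num_def split: move.splits)
      have "int (H' j) = head (tapes (step M c) ! j) + int T \<and> \<bar>head (tapes (step M c) ! j)\<bar> \<le> int (Suc t)"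
        if j: "j < ?k" for j
      proof -
        have "H' j = min (H j + move_num (snd (as ! j)) - 1) w"
          unfolding H'_def apply_acts_fst using j Ee(3)[OF j] by simp
        \<comment> \<open>The head is within t < T of cell 0, so its position is off both ends, and
          neither truncated subtraction nor \<open>min\<close> has an effect.\<close>
        moreover have "1 \<le> H j" "H j + 1 \<le> w"
          using H[OF j] hd[OF j] t w by linarith+
        ultimately have "int (H' j) = int (H j) + int (move_num (snd (as ! j))) - 1"
          using mv[of "snd (as ! j)"] by simp
        then show ?thesis
          using hd'[OF j] H[OF j] hd[OF j] mv[of "snd (as ! j)"] by linarith
      qed
      moreover have S': "S' (p * ?k + j) = cells (tapes (step M c) ! j) (int p - int T)" if j: "j < ?k" for j p
      proof -
        have "S' (p * ?k + j) = (if p = H j then min (fst (as ! j)) w else S (p * ?k + j))"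
          unfolding S'_def using apply_acts_snd[OF order.refl j] Ee(2)[OF j] j by simp
        moreover have "fst (as ! j) \<le> w"
          using E(2)[of "tab (e + 1 + 2 * j)"] Ee(2)[OF j] by simp
        moreover have "int p - int T = head (tapes c ! j) \<longleftrightarrow> p = H j"
          using H[OF j] by linarith
        ultimately show ?thesis
          unfolding tp[OF j] cells_act S[OF j] by simp
      qed
      moreover have "cells (tapes (step M c) ! 1) i = 0" if "int (Suc t) \<le> i" for i
      proof -
        have "i \<noteq> head (tapes c ! 1)"
          using hd[of 1] k2 that by simp
        then show ?thesis
          using tp[of 1] k2 blank[of i] that by (simp add: cells_act)
      qed
      moreover have "state (step M c) = q'"
        by (simp add: sc)
      ultimately show ?thesis
        unfolding os us sim_def using config_ok_step[OF wf' ok] by simp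
    qed
  qed
qed

lemma input_cells_row:
  assumes "0 < k" "j < k" "2 \<le> w" "i \<le> length x"
  shows "input_cells x w T k i (p * k + j) = (if j = 0 \<and> T \<le> p \<and> p < T + i then bit_sym (x ! (p - T)) else 0)"
  using assms(4)
proof (induction i)
  case (Suc i)
  have "p * k + j = (T + i) * k + 0 \<longleftrightarrow> p = T + i \<and> j = 0"
    by (rule cell_index_inj) (use assms in simp_all)
  moreover have "T * k + i * k = (T + i) * k + 0"
    by (simp add: algebra_simps)
  ultimately have "p * k + j = T * k + i * k \<longleftrightarrow> p = T + i \<and> j = 0"
    by simp
  then show ?case
    using Suc assms(3) by (auto simp: bit_sym_def less_Suc_eq)
qed simp

lemma sim_init:
  assumes "wf_oracle_tm M" "describes M F E" "T \<le> w" "2 \<le> w"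
  shows "sim M T (init M x) 0 (uinit w T (num_tapes M) E x)"
proof -
  let ?k = "num_tapes M"
  have k: "2 \<le> ?k" and wf: "wf_tm M"
    using assms(1) by (simp_all add: wf_oracle_tm_def)
  have tp: "tapes (init M x) ! j = (if j = 0 then input_tape x else blank_tape)" if "j < ?k" for j
    using that by (cases j) (simp_all add: init_def)
  have "E (tab 2) = start M"
    using assms(2) unfolding describes_def by blast
  moreover have "input_cells x w T ?k (length x) (p * ?k + j) = cells (tapes (init M x) ! j) (int p - int T)"
    if j: "j < ?k" for j p
  proof -
    have "nat (int p - int T) = p - T"
      by linarith
    moreover have "0 \<le> int p - int T \<and> p - T < length x \<longleftrightarrow> T \<le> p \<and> p < T + length x"
      by linarith
    ultimately show ?thesis
      unfolding tp[OF j] using input_cells_row[of ?k j w "length x" x T p] k j assms(4)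
      by (auto simp: input_tape_def blank_tape_def)
  qed
  moreover have "head (tapes (init M x) ! j) = 0" if "j < ?k" for j
    using tp[OF that] by (simp add: input_tape_def blank_tape_def)
  moreover have "cells (tapes (init M x) ! 1) i = 0" for i
    using tp[of 1] k by (simp add: blank_tape_def)
  moreover have "state (init M x) = start M"
    by (simp add: init_def)
  ultimately show ?thesis
    unfolding sim_def uinit_def using config_ok_init[OF wf] assms(3) by simp
qed

text \<open>The query state is neither accepting nor rejecting, so \<open>oracle_step\<close> leaves
  a halted machine alone. This carries the verdict on to the end of the clock.\<close>

lemma oracle_run_frozen:
  assumes "wf_oracle_tm M" "state (oracle_run X M x t) = accept M \<or> state (oracle_run X M x t) = reject M" "t \<le> t'"
  shows "oracle_run X M x t' = oracle_run X M x t"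
  using assms(3)
proof (induction t' rule: dec_induct)
  case (step n)
  have "state (oracle_run X M x t) \<noteq> query M"
    using assms(1,2) by (auto simp: wf_oracle_tm_def)
  then have "oracle_step X M (oracle_run X M x t) = oracle_run X M x t"
    using assms(2) by (auto simp: oracle_step_def step_def halted_def)
  then show ?case
    using step by (simp add: oracle_run_def)
qed simp

lemma uresult_sim:
  assumes wf: "wf_oracle_tm M" and x: "parsed (2 * 2 ^ length x) x = E" and E: "describes M F E"
    and F: "\<And>s. length s \<le> 2 ^ length x \<Longrightarrow> s \<in> X \<longleftrightarrow> s \<in> F"
    and run: "t \<le> 2 ^ length x" "state (oracle_run X M x t) = (if x \<in> L then accept M else reject M)"
  shows "uresult x = 0 \<longleftrightarrow> x \<notin> L"
proof -
  define T :: nat where "T = 2 ^ length x"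
  define w where "w = 2 * T"
  let ?k = "num_tapes M" and ?B = "num_symbols M"
  have T: "1 \<le> T"
    by (simp add: T_def)
  have Ew: "E i \<le> w" for i
    using x arr_le unfolding parsed_def w_def T_def by metis
  have kB: "E (tab 0) = ?k" "E (tab 1) = ?B"
    using E unfolding describes_def by blast+
  define U where "U i = (ustep w T ?k ?B E ^^ i) (uinit w T ?k E x)" for i
  have "sim M T (oracle_run X M x i) i (U i)" if "i \<le> T" for i
    using that
  proof (induction i)
    case 0
    then show ?case
      unfolding oracle_run_def U_def using sim_init[OF wf E, of T w x] T by (simp add: w_def)
  next
    case (Suc i)
    have "sim M T (oracle_step X M (oracle_run X M x i)) (Suc i) (ustep w T ?k ?B E (U i))"
      by (rule sim_step[OF wf E Ew]) (use Suc F in \<open>simp_all add: w_def T_def\<close>)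
    then show ?case
      by (simp add: oracle_run_def U_def)
  qed
  then have sim: "sim M T (oracle_run X M x T) T (U T)"
    by simp
  obtain q H S where u: "U T = (q, H, S)"
    by (metis prod_cases3)
  have q: "q = state (oracle_run X M x T)"
    using sim by (simp add: sim_def u)
  also have "\<dots> = (if x \<in> L then accept M else reject M)"
    using oracle_run_frozen[OF wf, of X x t T] run by (simp add: T_def split: if_splits)
  finally have q: "q = (if x \<in> L then accept M else reject M)" .
  have "q < num_states M" "query M \<noteq> accept M" "query M \<noteq> reject M" "accept M \<noteq> reject M"
    using wf q by (auto simp: wf_oracle_tm_def wf_tm_def)
  moreover from this have "E (3 * q + 1) = (if q = query M then 1 else if q = reject M then 2 else if q = accept M then 3 else 0)"
    using E unfolding describes_def by blast
  ultimately have "E (3 * q + 1) = (if x \<in> L then 3 else 2)"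
    using q by auto
  moreover have "uresult x = E (3 * q + 1) - 2"
    using u x kB unfolding uresult_def U_def w_def T_def by (simp add: Let_def)
  ultimately show ?thesis
    by simp
qed

section \<open>Time bounds and the main result\<close>

lemma poly_bound: "\<exists>C. \<forall>V. poly (p :: nat poly) V \<le> C * (V + 1) ^ C"
proof (induction p)
  case (pCons a p)
  then obtain C where C: "\<And>V. poly p V \<le> C * (V + 1) ^ C"
    by blast
  have "poly (pCons a p) V \<le> (a + C + 1) * (V + 1) ^ (a + C + 1)" for V
  proof -
    have "V * poly p V \<le> (V + 1) * (C * (V + 1) ^ C)"
      by (intro mult_le_mono C) simp
    moreover have "1 \<le> (V + 1) * (V + 1) ^ C"
      using one_le_power[of "V + 1" "Suc C"] by simp
    then have "a * 1 \<le> a * ((V + 1) * (V + 1) ^ C)"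
      by (rule mult_le_mono2)
    ultimately have "poly (pCons a p) V \<le> a * ((V + 1) * (V + 1) ^ C) + (V + 1) * (C * (V + 1) ^ C)"
      unfolding poly_pCons mult_1_right by (intro add_mono)
    also have "\<dots> = (a + C) * (V + 1) ^ (C + 1)"
      by (simp only: power_add power_one_right) (simp only: distrib_right mult_ac)
    also have "\<dots> \<le> (a + C + 1) * (V + 1) ^ (a + C + 1)"
      by (intro mult_le_mono power_increasing) simp_all
    finally show ?thesis .
  qed
  then show ?case by blast
qed simp

lemma linear_le_exp: "4 \<le> m \<Longrightarrow> 2 * m + 3 \<le> 2 ^ m" for m :: nat
  by (induction m rule: dec_induct) simp_all

lemma le_double_exp: "n \<le> 2 ^ 2 ^ n" for n :: nat
  using less_exp[of n] less_exp[of "2 ^ n"] by linarith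

text \<open>Raising a double exponential to a fixed power \<open>C\<close> multiplies the upper
  exponential by \<open>C\<close>; this turns 2 * n + 5 into at most 2 * n + 5 + C, which n^2
  exceeds for large \<open>n\<close>.\<close>

lemma time_bound_EEXP:
  assumes "\<And>n. V n + 1 \<le> 2 ^ 2 ^ (2 * n + 5)"
  shows "\<exists>N C. \<forall>n\<ge>N. time_bound c (V n) \<le> C * 2 ^ 2 ^ n ^ 2"
proof -
  obtain p :: "nat poly" where p: "\<And>V. time_bound c V = poly p V"
    using time_bound_poly by blast
  obtain C where C: "\<And>V. poly p V \<le> C * (V + 1) ^ C"
    using poly_bound[of p] by blast
  have "time_bound c (V n) \<le> C * 2 ^ 2 ^ n ^ 2" if n: "C + 5 \<le> n" for n
  proof -
    have "C + (2 * n + 5) \<le> (C + 5) * n"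
      using n by (cases n) (simp_all add: algebra_simps)
    also have "\<dots> \<le> n ^ 2"
      using n by (simp add: power2_eq_square)
    finally have e: "C + (2 * n + 5) \<le> n ^ 2" .
    have "2 ^ (2 * n + 5) * C \<le> 2 ^ (2 * n + 5) * 2 ^ C"
      using less_exp[of C] by simp
    also have "\<dots> = 2 ^ (C + (2 * n + 5))"
      by (simp only: power_add mult.commute)
    also have "\<dots> \<le> 2 ^ n ^ 2"
      using e by (rule power_increasing) simp
    finally have *: "2 ^ (2 * n + 5) * C \<le> 2 ^ n ^ 2" .
    have "time_bound c (V n) \<le> C * (V n + 1) ^ C"
      unfolding p by (rule C)
    also have "\<dots> \<le> C * (2 ^ 2 ^ (2 * n + 5)) ^ C"
      using assms by (intro mult_le_mono2 power_mono) simp_all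
    also have "\<dots> = C * 2 ^ (2 ^ (2 * n + 5) * C)"
      by (simp only: power_mult)
    also have "\<dots> \<le> C * 2 ^ 2 ^ n ^ 2"
      using * by (intro mult_le_mono2 power_increasing) simp_all
    finally show ?thesis .
  qed
  then show ?thesis by blast
qed

lemma decides_within_mono:
  assumes "decides_within M L T" "\<And>n. T n \<le> T' n"
  shows "decides_within M L T'"
  using assms unfolding decides_within_def by (meson order_trans)

text \<open>The finitely many lengths below \<open>N\<close> go into the additive constant of
  \<open>DTIME\<close>.\<close>

lemma EEXP_I:
  assumes "wf_tm M" "decides_within M L T" "1 \<le> k" "\<And>n. N \<le> n \<Longrightarrow> T n \<le> C * 2 ^ 2 ^ n ^ k"
  shows "L \<in> EEXP"
proof -
  define c where "c = C + (\<Sum>n<N. T n)"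
  have "T n \<le> c * 2 ^ 2 ^ n ^ k + c" for n
  proof (cases "N \<le> n")
    case True
    have "T n \<le> C * 2 ^ 2 ^ n ^ k"
      by (rule assms(4)[OF True])
    also have "\<dots> \<le> c * 2 ^ 2 ^ n ^ k"
      by (rule mult_le_mono1) (simp add: c_def)
    finally show ?thesis
      by (rule trans_le_add1)
  next
    case False
    then have "T n \<le> (\<Sum>n<N. T n)"
      by (intro member_le_sum) simp_all
    then show ?thesis
      unfolding c_def by linarith
  qed
  then have "decides_within M L (\<lambda>n. c * 2 ^ 2 ^ n ^ k + c)"
    by (rule decides_within_mono[OF assms(2)])
  then have "L \<in> DTIME (\<lambda>n. 2 ^ 2 ^ n ^ k)"
    using assms(1) unfolding DTIME_def by blast
  then show ?thesis
    using assms(3) unfolding EEXP_def by auto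
qed

lemma intersection_EEXP:
  assumes "S \<in> EEXP" "\<And>w. safe (V (length w)) c (input_st w)" "\<And>n. V n + 1 \<le> 2 ^ 2 ^ (2 * n + 5)"
  shows "{w \<in> S. vl (sem c (input_st w)) R = 0} \<in> EEXP"
proof -
  obtain k M c0 where k: "1 \<le> k" and M: "wf_tm M" "decides_within M S (\<lambda>n. c0 * 2 ^ 2 ^ n ^ k + c0)"
    using assms(1) unfolding EEXP_def DTIME_def by auto
  obtain M' :: tm where M': "wf_tm M'" "decides_within M' {w \<in> S. vl (sem c (input_st w)) R = 0}
      (\<lambda>n. 22 * n + time_bound c (V n) + 2 * (c0 * 2 ^ 2 ^ n ^ k + c0) + 30)"
    using intersection_machine[OF M, where V = V, OF assms(2)] .
  obtain N C where N: "\<And>n. N \<le> n \<Longrightarrow> time_bound c (V n) \<le> C * 2 ^ 2 ^ n ^ 2"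
    using time_bound_EEXP[where V = V, OF assms(3)] by blast
  show ?thesis
  \<comment> \<open>Since k \<ge> 1, the exponent \<open>k + 1\<close> dominates both
    \<open>k\<close>, from the machine for \<open>S\<close>, and 2, from the loop program.
    \<open>N + 1\<close> makes \<open>n\<close> positive, as monotonicity of n^i in i
    requires.\<close>
  proof (rule EEXP_I[OF M', of "k + 1" "N + 1"])
    fix n assume n: "N + 1 \<le> n"
    define Z :: nat where "Z = 2 ^ 2 ^ n ^ (k + 1)"
    have mono: "(2::nat) ^ 2 ^ n ^ i \<le> Z" if "i \<le> k + 1" for i
      unfolding Z_def using that n by (intro power_increasing) simp_all
    have sum: "22 * n + t + 2 * (y + c0) + 30 \<le> 22 * Z + 30 * Z + a + 2 * b + 2 * b"
      if "t \<le> a" "y \<le> b" "n \<le> Z" "1 \<le> Z" "c0 \<le> b" for t y a b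
    proof -
      have "22 * n + t + (2 * y + 2 * c0) + 30 * 1 \<le> 22 * Z + a + (2 * b + 2 * b) + 30 * Z"
        by (intro add_mono mult_le_mono2 that)
      then show ?thesis
        by (simp add: algebra_simps)
    qed
    have Z: "n \<le> Z" "1 \<le> Z"
      using le_double_exp[of n] mono[of 1] mono[of 0] n by simp_all
    have "22 * n + time_bound c (V n) + 2 * (c0 * 2 ^ 2 ^ n ^ k + c0) + 30 \<le>
        22 * Z + 30 * Z + C * Z + 2 * (c0 * Z) + 2 * (c0 * Z)"
    proof (rule sum)
      show "time_bound c (V n) \<le> C * Z"
        by (rule order_trans[OF N mult_le_mono2[OF mono]]) (use n k in simp_all)
      show "c0 * 2 ^ 2 ^ n ^ k \<le> c0 * Z"
        by (intro mult_le_mono2 mono) simp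
      show "c0 \<le> c0 * Z"
        using mult_le_mono2[OF Z(2), of c0] by simp
    qed (fact Z)+
    also have "\<dots> = (52 + C + 4 * c0) * Z"
      by (simp add: algebra_simps)
    finally show "22 * n + time_bound c (V n) + 2 * (c0 * 2 ^ 2 ^ n ^ k + c0) + 30 \<le> (52 + C + 4 * c0) * 2 ^ 2 ^ n ^ (k + 1)"
      unfolding Z_def .
  qed simp
qed

text \<open>Taken as \<open>S\<close> in \<open>intersection_EEXP\<close>, this covers languages
  given by a loop program alone. The machine starts in its accepting state.\<close>

lemma UNIV_EEXP: "UNIV \<in> EEXP"
proof -
  define M :: tm where "M = \<lparr>num_tapes = 1, num_symbols = 3, num_states = 2, start = 0, accept = 0, reject = 1,
    delta = (\<lambda>_ ss. (0, keep ss))\<rparr>"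
  have "wf_tm M"
    by (auto simp: M_def wf_tm_def keep_def)
  moreover have "decides_within M UNIV (\<lambda>_. 0)"
    by (simp add: decides_within_def run_def init_def M_def)
  ultimately show ?thesis
    by (rule EEXP_I[of M UNIV "\<lambda>_. 0" 1 0 0]) simp_all
qed

lemma part_EEXP:
  assumes "S \<in> EEXP"
  shows "{x. x \<in> S \<and> stage (length x) = i} \<in> EEXP"
proof -
  have "{w \<in> S. vl (sem (part_com i) (input_st w)) 7 = 0} \<in> EEXP"
  proof (rule intersection_EEXP[OF assms, where V = "\<lambda>n. 2 * n + 3"])
    show "safe (2 * length w + 3) (part_com i) (input_st w)" for w
      using part_com[OF order.refl] by blast
    show "2 * n + 3 + 1 \<le> 2 ^ 2 ^ (2 * n + 5)" for n :: nat
      using le_double_exp[of "2 * n + 5"] by linarith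
  qed
  then show ?thesis
    using part_com[OF order.refl] by simp
qed

section \<open>The diagonal language and the contradiction\<close>

definition diagonal :: language where
  "diagonal = {x. uresult x = 0}"

text \<open>With w = 2 * 2^n, the power (w + 2)^(w + 3) is at most 2 to the (n + 2) * (w + 3), and
  this exponent is at most 10 * 4^n. Adding 5 for the factor 18 stays below 32 * 4^n = 2^(2 * n +
  5).\<close>

lemma value_bound_le: "value_bound (2 * 2 ^ n) + 1 \<le> 2 ^ 2 ^ (2 * n + 5)"
proof -
  let ?w = "2 * 2 ^ n :: nat"
  have 1: "?w + 2 \<le> 2 ^ (n + 2)"
    using one_le_power[of "2::nat" n] by simp
  have "(?w + 2) ^ (?w + 3) \<le> (2 ^ (n + 2)) ^ (?w + 3)"
    by (rule power_mono[OF 1]) simp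
  also have "\<dots> = 2 ^ ((n + 2) * (?w + 3))"
    by (simp only: power_mult)
  finally have "value_bound ?w + 1 \<le> 18 * 2 ^ ((n + 2) * (?w + 3)) + 1"
    by (simp add: value_bound_def)
  also have "\<dots> \<le> 2 ^ ((n + 2) * (?w + 3) + 5)"
    using one_le_power[of "2::nat" "(n + 2) * (?w + 3)"] by (simp only: power_add) simp
  also have "\<dots> \<le> 2 ^ 2 ^ (2 * n + 5)"
  proof (rule power_increasing)
    have n: "n + 2 \<le> 2 * 2 ^ n" "(1::nat) \<le> 2 ^ n"
      using less_exp[of n] one_le_power[of "2::nat" n] by linarith+
    have "(n + 2) * (?w + 3) \<le> (2 * 2 ^ n) * (5 * 2 ^ n)"
      by (rule mult_le_mono) (use n in linarith)+
    moreover have "(5::nat) * (1 * 1) \<le> 5 * (2 ^ n * 2 ^ n)"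
      using n by (intro mult_le_mono) simp_all
    moreover have "(2::nat) ^ (2 * n + 5) = 32 * (2 ^ n * 2 ^ n)"
      by (simp only: mult_2 power_add) simp
    ultimately show "(n + 2) * (?w + 3) + 5 \<le> 2 ^ (2 * n + 5)"
      by (simp add: algebra_simps)
  qed simp
  finally show ?thesis .
qed

lemma diagonal_EEXP: "diagonal \<in> EEXP"
proof -
  have u: "safe (value_bound (2 * 2 ^ length x)) universal_com (input_st x)"
    "vl (sem universal_com (input_st x)) 16 = uresult x" for x
    by (rule universal_com[OF refl refl order.refl])+
  have "{x \<in> UNIV. vl (sem universal_com (input_st x)) 16 = 0} \<in> EEXP"
    by (rule intersection_EEXP[OF UNIV_EEXP, where V = "\<lambda>n. value_bound (2 * 2 ^ n)"]) (rule u value_bound_le)+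
  then show ?thesis
    by (simp add: u diagonal_def)
qed

text \<open>For n = 2^2^m, the power n^C has logarithm C * 2^m, which is below \<open>n\<close> once
  \<open>m\<close> exceeds \<open>C\<close> by a little.\<close>

lemma poly_le_exp:
  obtains C where "\<And>m. C \<le> m \<Longrightarrow> poly (p :: nat poly) (2 ^ 2 ^ m) \<le> 2 ^ 2 ^ 2 ^ m"
proof -
  obtain C where C: "\<And>V. poly p V \<le> C * (V + 1) ^ C"
    using poly_bound[of p] by blast
  have "poly p (2 ^ 2 ^ m) \<le> 2 ^ 2 ^ 2 ^ m" if m: "C + 4 \<le> m" for m
  proof -
    have Cm: "C \<le> 2 ^ m"
      using less_exp[of m] m by linarith
    have "2 * m + 3 \<le> 2 ^ m"
      by (rule linear_le_exp) (use m in simp)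
    then have "(2::nat) ^ (2 * m + 3) \<le> 2 ^ 2 ^ m"
      by (rule power_increasing) simp
    moreover have "(2 ^ m + 1) * C + C \<le> 8 * (2 ^ m * 2 ^ m)"
    proof -
      have 1: "(1::nat) \<le> 2 ^ m"
        by (rule one_le_power) simp
      have "(2 ^ m + 1) * C \<le> (2 * 2 ^ m) * 2 ^ m"
        by (rule mult_le_mono[OF _ Cm]) (use 1 in linarith)
      moreover have "C * 1 \<le> 2 ^ m * 2 ^ m"
        by (rule mult_le_mono[OF Cm 1])
      ultimately show ?thesis
        by linarith
    qed
    moreover have "(2::nat) ^ (2 * m + 3) = 8 * (2 ^ m * 2 ^ m)"
      by (simp only: mult_2 power_add) simp
    ultimately have e: "(2 ^ m + 1) * C + C \<le> 2 ^ 2 ^ m"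
      by linarith
    have "poly p (2 ^ 2 ^ m) \<le> C * (2 ^ 2 ^ m + 1) ^ C"
      by (rule C)
    also have "\<dots> \<le> 2 ^ C * (2 ^ (2 ^ m + 1)) ^ C"
      using less_exp[of C] one_le_power[of "2::nat" "2 ^ m"] by (intro mult_le_mono power_mono) simp_all
    also have "\<dots> = 2 ^ ((2 ^ m + 1) * C + C)"
      unfolding power_mult[symmetric] power_add[symmetric] by (simp only: add.commute)
    also have "\<dots> \<le> 2 ^ 2 ^ 2 ^ m"
      using e by (rule power_increasing) simp
    finally show ?thesis .
  qed
  then show thesis
    using that by blast
qed

lemma not_hard:
  assumes i: "i < 3" and A: "\<And>x. x \<in> A \<Longrightarrow> stage (length x) = i"
  shows "\<not> EEXP_hard_Turing A"
proof
  assume "EEXP_hard_Turing A"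
  then have "diagonal \<in> P_relative A"
    unfolding EEXP_hard_Turing_def using diagonal_EEXP by blast
  then obtain M and p :: "nat poly" where wf: "wf_oracle_tm M" and dec: "oracle_decides_within A M diagonal (poly p)"
    unfolding P_relative_def by blast
  obtain P where P: "\<And>m. P \<le> m \<Longrightarrow> poly p (2 ^ 2 ^ m) \<le> 2 ^ 2 ^ 2 ^ m"
    using poly_le_exp by blast
  have "wf_tm M"
    using wf by (simp add: wf_oracle_tm_def)
  then obtain C D where desc: "\<And>F m. \<forall>s\<in>F. length s < m \<Longrightarrow>
      \<exists>E. describes M F E \<and> (\<forall>i. E i \<le> D) \<and> (\<forall>i\<ge>3 * (C + 2 ^ m). E i = 0)"
    using description_exists by metis
  \<comment> \<open>\<open>P\<close> lets the clock outlast \<open>M\<close>, \<open>C\<close> and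
    \<open>D\<close> make the description fit, and 4 is the threshold of
    \<open>linear_le_exp\<close>.\<close>
  obtain m where m: "P + C + D + 4 \<le> m" and gap: "\<And>l. m \<le> l \<Longrightarrow> l \<le> 2 ^ 2 ^ 2 ^ m \<Longrightarrow> stage l \<noteq> i"
    using stage_gap[OF i] by metis
  define n :: nat where "n = 2 ^ 2 ^ m"
  define F where "F = {s \<in> A. length s < m}"
  obtain E where E: "describes M F E" "\<And>i. E i \<le> D" "\<And>i. 3 * (C + 2 ^ m) \<le> i \<Longrightarrow> E i = 0"
    using desc[of F m] unfolding F_def by blast
  have mm: "m < 2 ^ m"
    by (rule less_exp)
  have "C \<le> 2 ^ m" "D + 1 \<le> 2 ^ m"
    using order_trans[OF _ less_imp_le[OF mm], of C] order_trans[OF _ less_imp_le[OF mm], of "D + 1"] m by simp_all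
  then have "3 * (C + 2 ^ m) \<le> 8 * 2 ^ m" "D + 1 \<le> 2 ^ m"
    by simp_all
  \<comment> \<open>The description has 3 * (C + 2^m) entries of at most D + 1 bits each, including
    the terminator: about 4^m bits against n = 2^2^m.\<close>
  then have "3 * (C + 2 ^ m) * (D + 1) \<le> (8 * 2 ^ m) * 2 ^ m"
    by (rule mult_le_mono)
  also have "\<dots> = 2 ^ (2 * m + 3)"
    by (simp only: mult_2 power_add) simp
  also have "\<dots> \<le> n"
    unfolding n_def using linear_le_exp[of m] m by (intro power_increasing) simp_all
  finally have size: "3 * (C + 2 ^ m) * (D + 1) \<le> n" .
  have "D \<le> 2 * 2 ^ n"
  proof -
    have "m < n"
      using mm less_exp[of "2 ^ m"] unfolding n_def by linarith
    then show ?thesis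
      using less_exp[of n] m by linarith
  qed
  then have "E i \<le> 2 * 2 ^ n" for i
    using E(2)[of i] by (rule order_trans[rotated])
  then obtain x where x: "length x = n" "parsed (2 * 2 ^ n) x = E"
    using encode_exists[of E "2 * 2 ^ n" "3 * (C + 2 ^ m)" D n] E(2,3) size by metis
  \<comment> \<open>Below \<open>m\<close> this is the definition of \<open>F\<close>; from
    \<open>m\<close> to 2^n the gap keeps \<open>A\<close> empty.\<close>
  have F: "s \<in> A \<longleftrightarrow> s \<in> F" if "length s \<le> 2 ^ length x" for s
    using that gap[of "length s"] A[of s] x(1) unfolding F_def n_def by (cases "m \<le> length s") auto
  obtain t where t: "t \<le> poly p n" "state (oracle_run A M x t) = (if x \<in> diagonal then accept M else reject M)"
    using dec x(1) unfolding oracle_decides_within_def by blast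
  have "poly p n \<le> 2 ^ length x"
    using P[of m] m x(1) unfolding n_def by simp
  then have "t \<le> 2 ^ length x"
    using t(1) by (rule order_trans[rotated])
  then have "uresult x = 0 \<longleftrightarrow> x \<notin> diagonal"
    using x by (intro uresult_sim[OF wf _ E(1) F _ t(2)]) simp_all
  then show False
    by (cases "uresult x = 0") (simp_all add: diagonal_def)
qed

theorem theorem9:
  fixes S :: language
  assumes "EEXP_complete S"
  shows "\<exists>r :: nat \<Rightarrow> nat. computable_in_time_poly_in_argument r \<and>
    (let A = {x. x \<in> S \<and> r (length x) mod 3 = 0};
         B = {x. x \<in> S \<and> r (length x) mod 3 = 1};
         C = {x. x \<in> S \<and> r (length x) mod 3 = 2}
     in A \<inter> B = {} \<and> A \<inter> C = {} \<and> B \<inter> C = {} \<and>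
        A \<in> EEXP \<and> B \<in> EEXP \<and> C \<in> EEXP \<and>
        S = A \<union> B \<union> C \<and>
        \<not> EEXP_hard_Turing A \<and> \<not> EEXP_hard_Turing B \<and> \<not> EEXP_hard_Turing C)"
proof (intro exI[of _ stage] conjI)
  show "computable_in_time_poly_in_argument stage"
    by (rule stage_computable)
  define part where "part i = {x. x \<in> S \<and> stage (length x) = i}" for i
  have S: "S \<in> EEXP"
    using assms by (simp add: EEXP_complete_def)
  have mod: "stage l mod 3 = stage l" for l
    using stage_less[of l] by simp
  have "S = part 0 \<union> part 1 \<union> part 2"
    using stage_less by (fastforce simp: part_def numeral_3_eq_3 less_Suc_eq numeral_2_eq_2)
  moreover have "part 0 \<inter> part 1 = {}" "part 0 \<inter> part 2 = {}" "part 1 \<inter> part 2 = {}"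
    by (auto simp: part_def)
  moreover have "part i \<in> EEXP" for i
    unfolding part_def by (rule part_EEXP[OF S])
  moreover have "\<not> EEXP_hard_Turing (part i)" if "i < 3" for i
    by (rule not_hard[OF that]) (simp add: part_def)
  ultimately show "let A = {x. x \<in> S \<and> stage (length x) mod 3 = 0};
         B = {x. x \<in> S \<and> stage (length x) mod 3 = 1};
         C = {x. x \<in> S \<and> stage (length x) mod 3 = 2}
     in A \<inter> B = {} \<and> A \<inter> C = {} \<and> B \<inter> C = {} \<and>
        A \<in> EEXP \<and> B \<in> EEXP \<and> C \<in> EEXP \<and>
        S = A \<union> B \<union> C \<and>
        \<not> EEXP_hard_Turing A \<and> \<not> EEXP_hard_Turing B \<and> \<not> EEXP_hard_Turing C"
    unfolding Let_def mod part_def[symmetric] by simp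
qed

end
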